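(* Let $(X,W)$ be a Landau–Ginzburg pair and assume that the critical set $Z_W$ is compact. Then the inclusion $i:\mathrm{PV}_c(X)\hookrightarrow\mathrm{PV}(X)$ is a homotopy equivalence (and hence a quasi-isomorphism) of differential $\mathbb Z$-graded $\mathrm O(X)$-modules from $(\mathrm{PV}_c(X),\delta_W)$ to $(\mathrm{PV}(X),\delta_W)$.
   Context: Landau–Ginzburg pair: $X$ is a connected, paracompact, non-compact complex manifold of dimension $d\ge1$ which admits a Kähler metric and whose canonical bundle $\wedge^dT^*X$ is holomorphically trivial; $W:X\to\mathbb C$ is a non-constant holomorphic function. $Z_W=\{p\in X:(\partial W)(p)=0\}$. $TX$ is the holomorphic tangent bundle and $\mathrm O(X)$ is the algebra of holomorphic functions on $X$. $\mathrm{PV}(X)=\bigoplus_{-d\le i\le 0,\,0\le j\le d}\mathrm{PV}^{i,j}(X)$, where $\mathrm{PV}^{i,j}(X)$ is the space of smooth $(0,j)$-forms valued in $\wedge^{|i|}TX$, with product $(\rho_1\otimes P_1)(\rho_2\otimes P_2)=(-1)^{ij}(\rho_1\wedge\rho_2)\otimes(P_1\wedge P_2)$ for $P_1$ of polyvector degree $i$ and $\rho_2$ of form degree $j$, and canonical $\mathbb Z$-grading $\mathrm{PV}^k(X)=\bigoplus_{i+j=k}\mathrm{PV}^{i,j}(X)$. $\mathrm{PV}_c(X)\subset\mathrm{PV}(X)$ is the subspace of compactly supported elements. $\iota_W$ is the unique $C^\infty(X)$-linear map of bidegree $(1,0)$ on $\mathrm{PV}(X)$ which is an odd derivation with respect to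 the canonical grading and equals contraction with $-\mathbf i\,\partial W$ ($\mathbf i$ the imaginary unit) on smooth sections of $TX$. $\delta_W=\bar\partial_{\wedge TX}+\iota_W$ is an $\mathrm O(X)$-linear differential of degree $+1$, preserving $\mathrm{PV}_c(X)$. *)

theory Defs
  imports "HOL-Analysis.Analysis" "HOL-Algebra.Module" "HOL-Algebra.AbelCoset"
begin

section \<open>Smooth and holomorphic functions on open subsets of complex coordinate space\<close>

primrec Ck_on :: "nat \<Rightarrow> 'a::real_normed_vector set \<Rightarrow> ('a \<Rightarrow> 'b::real_normed_vector) \<Rightarrow> bool" where
  "Ck_on 0 S f \<longleftrightarrow> continuous_on S f"
| "Ck_on (Suc k) S f \<longleftrightarrow>
     (\<forall>x\<in>S. f differentiable (at x)) \<and> (\<forall>v. Ck_on k S (\<lambda>x. frechet_derivative f (at x) v))"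

definition smooth_on :: "'a::real_normed_vector set \<Rightarrow> ('a \<Rightarrow> 'b::real_normed_vector) \<Rightarrow> bool" where
  "smooth_on S f \<longleftrightarrow> (\<forall>k. Ck_on k S f)"

text \<open>Holomorphic in several variables: a smooth function satisfying the Cauchy-Riemann
  equations, i.e. whose real derivative is complex linear.\<close>

definition holo_on :: "(complex^'d) set \<Rightarrow> (complex^'d \<Rightarrow> complex) \<Rightarrow> bool" where
  "holo_on S f \<longleftrightarrow> smooth_on S f \<and>
     (\<forall>z\<in>S. \<forall>v. frechet_derivative f (at z) (\<i> *s v) = \<i> * frechet_derivative f (at z) v)"


section \<open>Complex manifolds\<close>

text \<open>A manifold is the whole type \<open>'x\<close> with an atlas; its complex dimension is \<open>CARD('d)\<close>.
  A chart is a pair of its domain and its coordinate map (arbitrary outside the domain).\<close>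

type_synonym ('x, 'd) chart = "'x set \<times> ('x \<Rightarrow> complex^'d)"

definition coord_image :: "('x, 'd) chart \<Rightarrow> (complex^'d) set" where
  "coord_image c = snd c ` fst c"

definition coord_inv :: "('x, 'd) chart \<Rightarrow> complex^'d \<Rightarrow> 'x" where
  "coord_inv c = inv_into (fst c) (snd c)"

definition complex_atlas :: "('x::topological_space, 'd::finite) chart set \<Rightarrow> bool" where
  "complex_atlas \<A> \<longleftrightarrow>
     (\<Union>c\<in>\<A>. fst c) = UNIV \<and>
     (\<forall>c\<in>\<A>. open (fst c) \<and> open (coord_image c) \<and>
        homeomorphism (fst c) (coord_image c) (snd c) (coord_inv c)) \<and>
     (\<forall>c\<in>\<A>. \<forall>c'\<in>\<A>. \<forall>a.
        holo_on (snd c ` (fst c \<inter> fst c')) (\<lambda>z. snd c' (coord_inv c z) $ a))"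

definition paracompact_type :: "'x::topological_space itself \<Rightarrow> bool" where
  "paracompact_type _ \<longleftrightarrow>
     (\<forall>\<U>::'x set set. (\<forall>U\<in>\<U>. open U) \<and> \<Union>\<U> = UNIV \<longrightarrow>
        (\<exists>\<V>. (\<forall>V\<in>\<V>. open V) \<and> \<Union>\<V> = UNIV \<and> (\<forall>V\<in>\<V>. \<exists>U\<in>\<U>. V \<subseteq> U) \<and>
             locally_finite_in euclidean \<V>))"

definition smooth_in :: "('x, 'd::finite) chart \<Rightarrow> ('x \<Rightarrow> complex) \<Rightarrow> bool" where
  "smooth_in c f \<longleftrightarrow> smooth_on (coord_image c) (f \<circ> coord_inv c)"

definition holo_in :: "('x, 'd::finite) chart \<Rightarrow> ('x \<Rightarrow> complex) \<Rightarrow> bool" where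
  "holo_in c f \<longleftrightarrow> holo_on (coord_image c) (f \<circ> coord_inv c)"

definition smooth_fun :: "('x, 'd::finite) chart set \<Rightarrow> ('x \<Rightarrow> complex) \<Rightarrow> bool" where
  "smooth_fun \<A> f \<longleftrightarrow> (\<forall>c\<in>\<A>. smooth_in c f)"

definition holo_fun :: "('x, 'd::finite) chart set \<Rightarrow> ('x \<Rightarrow> complex) \<Rightarrow> bool" where
  "holo_fun \<A> f \<longleftrightarrow> (\<forall>c\<in>\<A>. holo_in c f)"

text \<open>Real directional derivative in the coordinates of \<open>c\<close>, and the Wirtinger derivatives
  with respect to the coordinate \<open>z\<^sub>a\<close> and its conjugate.\<close>

definition chart_dir :: "('x, 'd::finite) chart \<Rightarrow> complex^'d \<Rightarrow> ('x \<Rightarrow> complex) \<Rightarrow> 'x \<Rightarrow> complex" where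
  "chart_dir c v f p = frechet_derivative (f \<circ> coord_inv c) (at (snd c p)) v"

definition del :: "('x, 'd::finite) chart \<Rightarrow> 'd \<Rightarrow> ('x \<Rightarrow> complex) \<Rightarrow> 'x \<Rightarrow> complex" where
  "del c a f p = (chart_dir c (axis a 1) f p - \<i> * chart_dir c (axis a \<i>) f p) / 2"

definition delbar :: "('x, 'd::finite) chart \<Rightarrow> 'd \<Rightarrow> ('x \<Rightarrow> complex) \<Rightarrow> 'x \<Rightarrow> complex" where
  "delbar c a f p = (chart_dir c (axis a 1) f p + \<i> * chart_dir c (axis a \<i>) f p) / 2"

text \<open>\<open>jac c c' p a b\<close> is the partial derivative of the \<open>a\<close>-th coordinate of \<open>c'\<close>
  with respect to the \<open>b\<close>-th coordinate of \<open>c\<close>.\<close>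

definition jac :: "('x, 'd::finite) chart \<Rightarrow> ('x, 'd) chart \<Rightarrow> 'x \<Rightarrow> 'd \<Rightarrow> 'd \<Rightarrow> complex" where
  "jac c c' p a b = del c b (\<lambda>q. snd c' q $ a) p"


section \<open>Landau-Ginzburg pairs\<close>

text \<open>A Hermitian metric is given by its matrices \<open>h c p a b\<close> in the charts \<open>c\<close>.\<close>

definition hermitian_metric ::
    "('x, 'd::finite) chart set \<Rightarrow> (('x, 'd) chart \<Rightarrow> 'x \<Rightarrow> 'd \<Rightarrow> 'd \<Rightarrow> complex) \<Rightarrow> bool" where
  "hermitian_metric \<A> h \<longleftrightarrow>
     (\<forall>c\<in>\<A>. (\<forall>a b. smooth_in c (\<lambda>p. h c p a b)) \<and>
        (\<forall>p\<in>fst c. (\<forall>a b. h c p b a = cnj (h c p a b)) \<and>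
           (\<forall>v::complex^'d. v \<noteq> 0 \<longrightarrow> 0 < Re (\<Sum>a\<in>UNIV. \<Sum>b\<in>UNIV. h c p a b * v $ a * cnj (v $ b))))) \<and>
     (\<forall>c\<in>\<A>. \<forall>c'\<in>\<A>. \<forall>p\<in>fst c \<inter> fst c'. \<forall>a b.
        h c p a b = (\<Sum>a'\<in>UNIV. \<Sum>b'\<in>UNIV. jac c c' p a' a * cnj (jac c c' p b' b) * h c' p a' b'))"

text \<open>The fundamental form \<open>(i/2) \<Sum> h\<^sub>a\<^sub>b dz\<^sub>a \<and> d\<close>conj\<open>(z\<^sub>b)\<close>, evaluated on two real
  tangent vectors written in the coordinates of \<open>c\<close>.\<close>

definition fundamental_form ::
    "(('x, 'd::finite) chart \<Rightarrow> 'x \<Rightarrow> 'd \<Rightarrow> 'd \<Rightarrow> complex) \<Rightarrow>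
     ('x, 'd) chart \<Rightarrow> complex^'d \<Rightarrow> complex^'d \<Rightarrow> 'x \<Rightarrow> complex" where
  "fundamental_form h c u v p =
     \<i> / 2 * (\<Sum>a\<in>UNIV. \<Sum>b\<in>UNIV. h c p a b * (u $ a * cnj (v $ b) - v $ a * cnj (u $ b)))"

definition kaehler_metric ::
    "('x, 'd::finite) chart set \<Rightarrow> (('x, 'd) chart \<Rightarrow> 'x \<Rightarrow> 'd \<Rightarrow> 'd \<Rightarrow> complex) \<Rightarrow> bool" where
  "kaehler_metric \<A> h \<longleftrightarrow> hermitian_metric \<A> h \<and>
     (\<forall>c\<in>\<A>. \<forall>p\<in>fst c. \<forall>u v w.
        chart_dir c u (fundamental_form h c v w) p
      - chart_dir c v (fundamental_form h c u w) p
      + chart_dir c w (fundamental_form h c u v) p = 0)"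

text \<open>Triviality of the canonical line bundle: a nowhere vanishing holomorphic section
  \<open>s c dz\<^sub>1 \<and> \<dots> \<and> dz\<^sub>d\<close>, i.e. the image of the constant section 1 under a trivialization.\<close>

definition canonical_trivial :: "('x, 'd::finite) chart set \<Rightarrow> bool" where
  "canonical_trivial \<A> \<longleftrightarrow>
     (\<exists>s :: ('x, 'd) chart \<Rightarrow> 'x \<Rightarrow> complex.
        (\<forall>c\<in>\<A>. holo_in c (s c) \<and> (\<forall>p\<in>fst c. s c p \<noteq> 0)) \<and>
        (\<forall>c\<in>\<A>. \<forall>c'\<in>\<A>. \<forall>p\<in>fst c \<inter> fst c'.
           s c p = det ((\<chi> a b. jac c c' p a b) :: complex^'d^'d) * s c' p))"

definition LG_pair :: "('x::t2_space, 'd::finite) chart set \<Rightarrow> ('x \<Rightarrow> complex) \<Rightarrow> bool" where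
  "LG_pair \<A> W \<longleftrightarrow>
     complex_atlas \<A> \<and> connected (UNIV :: 'x set) \<and> paracompact_type TYPE('x) \<and>
     \<not> compact (UNIV :: 'x set) \<and> (\<exists>h. kaehler_metric \<A> h) \<and> canonical_trivial \<A> \<and>
     holo_fun \<A> W \<and> \<not> W constant_on UNIV"

definition crit_set :: "('x, 'd::finite) chart set \<Rightarrow> ('x \<Rightarrow> complex) \<Rightarrow> 'x set" where
  "crit_set \<A> W = {p. \<forall>c\<in>\<A>. p \<in> fst c \<longrightarrow> (\<forall>a. del c a W p = 0)}"


section \<open>Polyvector-valued forms\<close>

text \<open>An element of \<open>PV(X)\<close> is given by its tensor components: \<open>\<alpha> c p A B\<close> is the component
  at \<open>p\<close>, in the coordinates of \<open>c\<close>, with polyvector indices \<open>A\<close> (contravariant, holomorphic)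
  and form indices \<open>B\<close> (covariant, antiholomorphic). Components of all lengths are collected in
  one object, which encodes the direct sum over the bidegrees
  \<open>(i, j) = (- length A, length B)\<close>; antisymmetry forces them to vanish for lengths
  above the dimension. For \<open>A\<close>, \<open>B\<close> with distinct entries, \<open>\<alpha> c p A B\<close> is the coefficient of
  the wedge of the \<open>d\<close>conj\<open>(z\<^sub>b)\<close> tensored with the wedge of the coordinate vector fields.
  Components that make no sense (\<open>c\<close> not in the atlas, or \<open>p\<close> outside \<open>c\<close>) are 0, so that
  equality of elements is equality of functions.\<close>

type_synonym ('x, 'd) pv = "('x, 'd) chart \<Rightarrow> 'x \<Rightarrow> 'd list \<Rightarrow> 'd list \<Rightarrow> complex"

definition alternating :: "('d list \<Rightarrow> complex) \<Rightarrow> bool" where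
  "alternating t \<longleftrightarrow>
     (\<forall>A i j. i < length A \<and> j < length A \<and> i \<noteq> j \<longrightarrow> t (A[i := A ! j, j := A ! i]) = - t A)"

definition PV :: "('x, 'd::finite) chart set \<Rightarrow> ('x, 'd) pv set" where
  "PV \<A> = {\<alpha>.
     (\<forall>c p A B. \<not> (c \<in> \<A> \<and> p \<in> fst c) \<longrightarrow> \<alpha> c p A B = 0) \<and>
     (\<forall>c p B. alternating (\<lambda>A. \<alpha> c p A B)) \<and>
     (\<forall>c p A. alternating (\<lambda>B. \<alpha> c p A B)) \<and>
     (\<forall>c\<in>\<A>. \<forall>A B. smooth_in c (\<lambda>p. \<alpha> c p A B)) \<and>
     (\<forall>c\<in>\<A>. \<forall>c'\<in>\<A>. \<forall>p\<in>fst c \<inter> fst c'. \<forall>A B.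
        \<alpha> c' p A B =
          (\<Sum>A' | length A' = length A. \<Sum>B' | length B' = length B.
             (\<Prod>i<length A. jac c c' p (A ! i) (A' ! i)) *
             (\<Prod>j<length B. cnj (jac c' c p (B' ! j) (B ! j))) * \<alpha> c p A' B'))}"

definition PV_bideg :: "('x, 'd::finite) chart set \<Rightarrow> int \<Rightarrow> int \<Rightarrow> ('x, 'd) pv set" where
  "PV_bideg \<A> i j =
     {\<alpha> \<in> PV \<A>. \<forall>c p A B. \<alpha> c p A B \<noteq> 0 \<longrightarrow> - int (length A) = i \<and> int (length B) = j}"

definition PV_deg :: "('x, 'd::finite) chart set \<Rightarrow> int \<Rightarrow> ('x, 'd) pv set" where
  "PV_deg \<A> k =
     {\<alpha> \<in> PV \<A>. \<forall>c p A B. \<alpha> c p A B \<noteq> 0 \<longrightarrow> - int (length A) + int (length B) = k}"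

definition pv_support :: "('x::topological_space, 'd) pv \<Rightarrow> 'x set" where
  "pv_support \<alpha> = closure {p. \<exists>c A B. \<alpha> c p A B \<noteq> 0}"

definition PVc :: "('x::topological_space, 'd::finite) chart set \<Rightarrow> ('x, 'd) pv set" where
  "PVc \<A> = {\<alpha> \<in> PV \<A>. compact (pv_support \<alpha>)}"

definition pv_zero :: "('x, 'd) pv" where
  "pv_zero = (\<lambda>c p A B. 0)"

definition pv_add :: "('x, 'd) pv \<Rightarrow> ('x, 'd) pv \<Rightarrow> ('x, 'd) pv" where
  "pv_add \<alpha> \<beta> = (\<lambda>c p A B. \<alpha> c p A B + \<beta> c p A B)"

definition pv_smult :: "('x \<Rightarrow> complex) \<Rightarrow> ('x, 'd) pv \<Rightarrow> ('x, 'd) pv" where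
  "pv_smult f \<alpha> = (\<lambda>c p A B. f p * \<alpha> c p A B)"

text \<open>Sign of the shuffle moving the positions in \<open>S \<subseteq> {..<n}\<close> before the others.\<close>

definition shuffle_sign :: "nat \<Rightarrow> nat set \<Rightarrow> complex" where
  "shuffle_sign n S = (-1) ^ card {(s, t). s \<in> S \<and> t \<in> {..<n} - S \<and> t < s}"

text \<open>The product, with both wedge products given by the shuffle formula. The last sign is the
  \<open>(-1)\<^sup>i\<^sup>j\<close> for polyvector degree \<open>i\<close> of the first and form degree \<open>j\<close> of the second factor.\<close>

definition pv_mult :: "('x, 'd) pv \<Rightarrow> ('x, 'd) pv \<Rightarrow> ('x, 'd) pv" where
  "pv_mult \<alpha> \<beta> = (\<lambda>c p A B.
     \<Sum>S\<in>Pow {..<length A}. \<Sum>T\<in>Pow {..<length B}.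
       shuffle_sign (length A) S * shuffle_sign (length B) T *
       (-1) ^ (card S * (length B - card T)) *
       \<alpha> c p (nths A S) (nths B T) * \<beta> c p (nths A (- S)) (nths B (- T)))"

definition pv_one :: "('x, 'd) chart set \<Rightarrow> ('x, 'd) pv" where
  "pv_one \<A> = (\<lambda>c p A B. if c \<in> \<A> \<and> p \<in> fst c \<and> A = [] \<and> B = [] then 1 else 0)"

text \<open>The Dolbeault operator of the holomorphic bundle of polyvectors: the usual antisymmetrized
  derivative of the coefficients in the holomorphic coordinate frames.\<close>

definition pv_dbar :: "('x, 'd::finite) chart set \<Rightarrow> ('x, 'd) pv \<Rightarrow> ('x, 'd) pv" where
  "pv_dbar \<A> \<alpha> = (\<lambda>c p A B.
     if c \<in> \<A> \<and> p \<in> fst c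
     then \<Sum>k<length B. (-1) ^ k * delbar c (B ! k) (\<lambda>q. \<alpha> c q A (take k B @ drop (Suc k) B)) p
     else 0)"

text \<open>Contraction with \<open>-i \<partial>W\<close>, moved past the form part by the sign \<open>(-1)\<^sup>j\<close>. The lemma
  \<open>is_iota_iota\<close> below shows that it has the properties \<open>is_iota\<close>, by which it is
  characterized.\<close>

definition iota :: "('x \<Rightarrow> complex) \<Rightarrow> ('x, 'd::finite) pv \<Rightarrow> ('x, 'd) pv" where
  "iota W \<alpha> = (\<lambda>c p A B.
     (-1) ^ length B * (\<Sum>a\<in>UNIV. - \<i> * del c a W p * \<alpha> c p (a # A) B))"

definition is_iota ::
    "('x, 'd::finite) chart set \<Rightarrow> ('x \<Rightarrow> complex) \<Rightarrow> (('x, 'd) pv \<Rightarrow> ('x, 'd) pv) \<Rightarrow> bool" where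
  "is_iota \<A> W F \<longleftrightarrow>
     (\<forall>\<alpha>\<in>PV \<A>. F \<alpha> \<in> PV \<A>) \<and>
     (\<forall>\<alpha>\<in>PV \<A>. \<forall>\<beta>\<in>PV \<A>. F (pv_add \<alpha> \<beta>) = pv_add (F \<alpha>) (F \<beta>)) \<and>
     (\<forall>f. smooth_fun \<A> f \<longrightarrow> (\<forall>\<alpha>\<in>PV \<A>. F (pv_smult f \<alpha>) = pv_smult f (F \<alpha>))) \<and>
     (\<forall>i j. \<forall>\<alpha>\<in>PV_bideg \<A> i j. F \<alpha> \<in> PV_bideg \<A> (i + 1) j) \<and>
     (\<forall>k. \<forall>\<alpha>\<in>PV_deg \<A> k. \<forall>\<beta>\<in>PV \<A>.
        F (pv_mult \<alpha> \<beta>) =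
          pv_add (pv_mult (F \<alpha>) \<beta>) (pv_smult (\<lambda>_. (-1) powi k) (pv_mult \<alpha> (F \<beta>)))) \<and>
     (\<forall>v\<in>PV_bideg \<A> (- 1) 0. \<forall>c\<in>\<A>. \<forall>p\<in>fst c.
        F v c p [] [] = (\<Sum>a\<in>UNIV. - \<i> * del c a W p * v c p [a] []))"

lemma Ck_on_cong:
  assumes "open S" "\<And>x. x \<in> S \<Longrightarrow> f x = g x" "Ck_on k S f"
  shows "Ck_on k S g"
  using assms(2,3)
proof (induction k arbitrary: f g)
  case 0
  then show ?case by (metis Ck_on.simps(1) continuous_on_cong)
next
  case (Suc k)
  have eq: "frechet_derivative f (at x) = frechet_derivative g (at x)" if "x \<in> S" for x
    using Suc.prems that assms(1) by (intro frechet_derivative_transform_within_open) auto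
  have "g differentiable (at x)" if x: "x \<in> S" for x
  proof -
    have "(f has_derivative frechet_derivative f (at x)) (at x)"
      using Suc.prems(2) x by (simp add: frechet_derivative_works)
    then have "(g has_derivative frechet_derivative f (at x)) (at x)"
      by (rule has_derivative_transform_within_open[OF _ assms(1) x]) (use Suc.prems(1) in auto)
    then show ?thesis by (auto simp: differentiable_def)
  qed
  moreover have "Ck_on k S (\<lambda>x. frechet_derivative g (at x) v)" for v
    by (rule Suc.IH[of "\<lambda>x. frechet_derivative f (at x) v"]) (use eq Suc.prems(2) in auto)
  ultimately show ?case by simp
qed

lemma Ck_on_SucD: "Ck_on (Suc k) S f \<Longrightarrow> Ck_on k S f"
proof (induction k arbitrary: f)
  case 0
  then show ?case
    by (simp add: continuous_at_imp_continuous_on differentiable_imp_continuous_within)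
next
  case (Suc k)
  then show ?case by (metis Ck_on.simps(2))
qed

lemma Ck_on_const: "Ck_on k S (\<lambda>x. a)"
  by (induction k arbitrary: a) auto

lemma Ck_on_add:
  assumes "open S" "Ck_on k S f" "Ck_on k S g"
  shows "Ck_on k S (\<lambda>x. f x + g x)"
  using assms(2,3)
proof (induction k arbitrary: f g)
  case 0
  then show ?case by (simp add: continuous_on_add)
next
  case (Suc k)
  have "Ck_on k S (\<lambda>x. frechet_derivative (\<lambda>x. f x + g x) (at x) v)" for v
  proof (rule Ck_on_cong[OF assms(1)])
    show "Ck_on k S (\<lambda>x. frechet_derivative f (at x) v + frechet_derivative g (at x) v)"
      using Suc by simp
    fix x assume "x \<in> S"
    then have "f differentiable (at x)" "g differentiable (at x)" using Suc.prems by auto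
    then have "((\<lambda>x. f x + g x) has_derivative
        (\<lambda>v. frechet_derivative f (at x) v + frechet_derivative g (at x) v)) (at x)"
      by (intro has_derivative_add) (simp_all add: frechet_derivative_works)
    from frechet_derivative_at[OF this]
    show "frechet_derivative f (at x) v + frechet_derivative g (at x) v =
        frechet_derivative (\<lambda>x. f x + g x) (at x) v" by metis
  qed
  then show ?case using Suc.prems by simp
qed

lemma Ck_on_mult:
  fixes f g :: "'a::real_normed_vector \<Rightarrow> complex"
  assumes "open S" "Ck_on k S f" "Ck_on k S g"
  shows "Ck_on k S (\<lambda>x. f x * g x)"
  using assms(2,3)
proof (induction k arbitrary: f g)
  case 0
  then show ?case by (simp add: continuous_on_mult)
next
  case (Suc k)
  have "Ck_on k S (\<lambda>x. frechet_derivative (\<lambda>x. f x * g x) (at x) v)" for v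
  proof (rule Ck_on_cong[OF assms(1)])
    show "Ck_on k S (\<lambda>x. f x * frechet_derivative g (at x) v + frechet_derivative f (at x) v * g x)"
      using Suc.prems[THEN Ck_on_SucD] Suc.prems
      by (intro Ck_on_add[OF assms(1)] Suc.IH) auto
    fix x assume "x \<in> S"
    then have "f differentiable (at x)" "g differentiable (at x)" using Suc.prems by auto
    then have "((\<lambda>x. f x * g x) has_derivative
        (\<lambda>v. f x * frechet_derivative g (at x) v + frechet_derivative f (at x) v * g x)) (at x)"
      by (intro has_derivative_mult) (simp_all add: frechet_derivative_works)
    from frechet_derivative_at[OF this]
    show "f x * frechet_derivative g (at x) v + frechet_derivative f (at x) v * g x =
        frechet_derivative (\<lambda>x. f x * g x) (at x) v" by metis
  qed
  then show ?case using Suc.prems by simp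
qed

lemma Ck_on_sum:
  assumes "open S" "\<And>i. i \<in> I \<Longrightarrow> Ck_on k S (f i)"
  shows "Ck_on k S (\<lambda>x. \<Sum>i\<in>I. f i x)"
  using assms(2)
  by (induction I rule: infinite_finite_induct)
     (auto intro: Ck_on_const Ck_on_add[OF assms(1)])

context
  fixes \<A> :: "('x::t2_space, 'd::finite) chart set"
  assumes atlas: "complex_atlas \<A>"
begin

lemma open_coord_image: "c \<in> \<A> \<Longrightarrow> open (coord_image c)"
  using atlas by (auto simp: complex_atlas_def)

lemma coord_inv_coord: "c \<in> \<A> \<Longrightarrow> p \<in> fst c \<Longrightarrow> coord_inv c (snd c p) = p"
  using atlas by (auto simp: complex_atlas_def homeomorphism_def)

lemma open_overlap:
  assumes "c \<in> \<A>" "c' \<in> \<A>"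
  shows "open (snd c ` (fst c \<inter> fst c'))"
proof -
  have h: "homeomorphism (fst c) (coord_image c) (snd c) (coord_inv c)"
    and o: "open (fst c \<inter> fst c')"
    using atlas assms by (auto simp: complex_atlas_def)
  have "openin (top_of_set (fst c)) (fst c \<inter> fst c')"
    using o by (meson inf_le1 open_subset)
  from homeomorphism_imp_open_map[OF h this] show ?thesis
    using open_coord_image[OF assms(1)] openin_open_trans by blast
qed

lemma smooth_inI:
  "(\<And>k. Ck_on k (coord_image c) (\<lambda>z. f (coord_inv c z))) \<Longrightarrow> smooth_in c f"
  by (simp add: smooth_in_def smooth_on_def o_def)

lemma smooth_inD:
  "smooth_in c f \<Longrightarrow> Ck_on k (coord_image c) (\<lambda>z. f (coord_inv c z))"
  by (simp add: smooth_in_def smooth_on_def o_def)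

lemma smooth_in_del:
  assumes c: "c \<in> \<A>" and f: "smooth_in c f"
  shows "smooth_in c (del c a f)"
proof (rule smooth_inI)
  fix k
  let ?D = "\<lambda>v z. frechet_derivative (f \<circ> coord_inv c) (at z) v"
  have D: "Ck_on k (coord_image c) (?D v)" for v
    using f unfolding smooth_in_def smooth_on_def by (metis Ck_on.simps(2))
  have "Ck_on k (coord_image c) (\<lambda>z. (1/2) * (?D (axis a 1) z + (- \<i>) * ?D (axis a \<i>) z))"
    by (intro Ck_on_mult Ck_on_add Ck_on_const D open_coord_image[OF c])
  then show "Ck_on k (coord_image c) (\<lambda>z. del c a f (coord_inv c z))"
    by (rule Ck_on_cong[OF open_coord_image[OF c], rotated])
       (auto simp: del_def chart_dir_def coord_inv_coord[OF c] coord_image_def)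
qed

lemma holo_in_smooth_in: "holo_in c f \<Longrightarrow> smooth_in c f"
  by (simp add: holo_in_def smooth_in_def holo_on_def)

lemma del_holo:
  assumes c: "c \<in> \<A>" "p \<in> fst c" and f: "holo_in c f"
  shows "del c a f p = chart_dir c (axis a 1) f p"
proof -
  have "axis a \<i> = \<i> *s (axis a 1 :: complex^'d)"
    by (simp add: vec_eq_iff axis_def)
  moreover have "snd c p \<in> coord_image c" using c by (auto simp: coord_image_def)
  ultimately have "chart_dir c (axis a \<i>) f p = \<i> * chart_dir c (axis a 1) f p"
    using f by (simp add: holo_in_def holo_on_def chart_dir_def)
  then show ?thesis by (simp add: del_def)
qed

lemma complex_linear_expand:
  fixes D :: "complex^'d \<Rightarrow> complex"
  assumes "linear D" "\<And>v. D (\<i> *s v) = \<i> * D v"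
  shows "D w = (\<Sum>a\<in>UNIV. w $ a * D (axis a 1))"
proof -
  have sc: "D (r *s v) = r * D v" for r v
  proof -
    have "r *s v = Re r *\<^sub>R v + Im r *\<^sub>R (\<i> *s v)"
      by (simp add: vec_eq_iff complex_eq_iff algebra_simps)
    then have "D (r *s v) = Re r *\<^sub>R D v + Im r *\<^sub>R (\<i> * D v)"
      by (simp add: linear_add[OF assms(1)] linear_scale[OF assms(1)] assms(2))
    also have "\<dots> = r * D v" by (simp add: complex_eq_iff algebra_simps)
    finally show ?thesis .
  qed
  have "w = (\<Sum>a\<in>UNIV. w $ a *s axis a 1)"
    by (simp add: basis_expansion)
  then have "D w = D (\<Sum>a\<in>UNIV. w $ a *s axis a 1)" by simp
  also have "\<dots> = (\<Sum>a\<in>UNIV. D (w $ a *s axis a 1))" by (rule linear_sum[OF assms(1)])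
  finally show ?thesis by (simp add: sc)
qed

lemma del_change:
  assumes c: "c \<in> \<A>" "p \<in> fst c" and c': "c' \<in> \<A>" "p \<in> fst c'" and W: "holo_fun \<A> W"
  shows "del c b W p = (\<Sum>a\<in>UNIV. jac c c' p a b * del c' a W p)"
proof -
  let ?O = "snd c ` (fst c \<inter> fst c')"
  let ?T = "\<lambda>z. snd c' (coord_inv c z)"
  let ?z = "snd c p"
  let ?Dg = "frechet_derivative (W \<circ> coord_inv c') (at (snd c' p))"
  have z: "?z \<in> ?O" using c c' by auto
  have O: "open ?O" by (rule open_overlap[OF c(1) c'(1)])
  have Ta: "holo_on ?O (\<lambda>z. ?T z $ a)" for a
    using atlas c(1) c'(1) by (auto simp: complex_atlas_def)
  have Wc: "holo_in c W" and Wc': "holo_in c' W" using W c c' by (auto simp: holo_fun_def)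
  have dTa: "(\<lambda>z. ?T z $ a) differentiable (at ?z)" for a
    using Ta[of a] z unfolding holo_on_def smooth_on_def by (metis Ck_on.simps(2))
  have dT: "(?T has_derivative (\<lambda>v. \<chi> a. frechet_derivative (\<lambda>z. ?T z $ a) (at ?z) v)) (at ?z)"
    (is "(_ has_derivative ?DT) _")
  proof -
    have "((\<lambda>z. \<Sum>a\<in>UNIV. axis a (?T z $ a)) has_derivative
            (\<lambda>v. \<Sum>a\<in>UNIV. axis a (frechet_derivative (\<lambda>z. ?T z $ a) (at ?z) v))) (at ?z)"
    proof (intro has_derivative_sum)
      fix a :: 'd
      have "linear (\<lambda>x::complex. axis a x :: complex^'d)"
        by (rule linearI) (auto simp: vec_eq_iff axis_def)
      then have "bounded_linear (\<lambda>x::complex. axis a x :: complex^'d)"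
        by (simp add: linear_conv_bounded_linear)
      then show "((\<lambda>z. axis a (?T z $ a) :: complex^'d) has_derivative
            (\<lambda>v. axis a (frechet_derivative (\<lambda>z. ?T z $ a) (at ?z) v))) (at ?z)"
        by (rule bounded_linear.has_derivative) (use dTa in \<open>simp add: frechet_derivative_works\<close>)
    qed
    moreover have "(\<Sum>a\<in>UNIV. axis a (y a)) = (\<chi> a. y a)" for y :: "'d \<Rightarrow> complex"
      by (simp add: vec_eq_iff axis_def)
    ultimately show ?thesis by simp
  qed
  have Tz: "?T ?z = snd c' p" by (simp add: coord_inv_coord c)
  have in': "snd c' p \<in> coord_image c'" using c' by (auto simp: coord_image_def)
  have "(W \<circ> coord_inv c') differentiable (at (snd c' p))"
    using Wc' in' unfolding holo_in_def holo_on_def smooth_on_def by (metis Ck_on.simps(2))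
  then have dg: "((W \<circ> coord_inv c') has_derivative ?Dg) (at (?T ?z))"
    by (simp add: frechet_derivative_works Tz)
  have "((W \<circ> coord_inv c') \<circ> ?T has_derivative ?Dg \<circ> ?DT) (at ?z)"
    by (rule diff_chain_at[OF dT dg])
  then have "(W \<circ> coord_inv c has_derivative ?Dg \<circ> ?DT) (at ?z)"
    by (rule has_derivative_transform_within_open[OF _ O z])
       (use c c' in \<open>auto simp: coord_inv_coord\<close>)
  from frechet_derivative_at[OF this]
  have Df: "frechet_derivative (W \<circ> coord_inv c) (at ?z) = ?Dg \<circ> ?DT" by (rule sym)
  have "del c b W p = ?Dg (?DT (axis b 1))"
    unfolding del_holo[OF c Wc] chart_dir_def Df by simp
  also have "\<dots> = (\<Sum>a\<in>UNIV. ?DT (axis b 1) $ a * ?Dg (axis a 1))"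
  proof (rule complex_linear_expand)
    show "linear ?Dg" using dg has_derivative_linear by blast
    show "?Dg (\<i> *s v) = \<i> * ?Dg v" for v
      using Wc' in' by (simp add: holo_in_def holo_on_def)
  qed
  also have "\<dots> = (\<Sum>a\<in>UNIV. jac c c' p a b * del c' a W p)"
  proof (rule sum.cong[OF refl])
    fix a
    let ?h = "(\<lambda>q. snd c' q $ a) \<circ> coord_inv c"
    have "jac c c' p a b = frechet_derivative (\<lambda>z. ?T z $ a) (at ?z) (axis b 1)"
    proof -
      have "axis b \<i> = \<i> *s (axis b 1 :: complex^'d)"
        by (simp add: vec_eq_iff axis_def)
      then have "frechet_derivative (\<lambda>z. ?T z $ a) (at ?z) (axis b \<i>) =
            \<i> * frechet_derivative (\<lambda>z. ?T z $ a) (at ?z) (axis b 1)"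
        using bspec[OF conjunct2[OF Ta[of a, unfolded holo_on_def]] z] by simp
      then show ?thesis by (simp add: jac_def del_def chart_dir_def o_def)
    qed
    then show "?DT (axis b 1) $ a * ?Dg (axis a 1) = jac c c' p a b * del c' a W p"
      by (simp add: del_holo[OF c' Wc'] chart_dir_def)
  qed
  finally show ?thesis .
qed

end

lemma sum_lists_Suc:
  "(\<Sum>A | length A = Suc n. f A) = (\<Sum>a\<in>UNIV. \<Sum>A | length A = n. f (a # A))"
  for f :: "'d::finite list \<Rightarrow> 'b::comm_monoid_add"
proof -
  have "(\<Sum>A | length A = Suc n. f A) = (\<Sum>(a, A)\<in>UNIV \<times> {A. length A = n}. f (a # A))"
    by (rule sum.reindex_bij_witness[of _ "\<lambda>(a, A). a # A" "\<lambda>A. (hd A, tl A)"])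
       (auto simp: length_Suc_conv)
  also have "\<dots> = (\<Sum>a\<in>UNIV. \<Sum>A | length A = n. f (a # A))"
    by (simp add: sum.cartesian_product)
  finally show ?thesis .
qed

lemma alternating_Cons:
  assumes "alternating t" shows "alternating (\<lambda>A. t (a # A))"
  unfolding alternating_def
proof (intro allI impI)
  fix A :: "'a list" and i j
  assume "i < length A \<and> j < length A \<and> i \<noteq> j"
  then show "t (a # A[i := A ! j, j := A ! i]) = - t (a # A)"
    using assms[unfolded alternating_def, rule_format, of "Suc i" "a # A" "Suc j"] by simp
qed

lemma alternating_scale: "alternating t \<Longrightarrow> alternating (\<lambda>A. r * t A)"
  by (simp add: alternating_def)

lemma alternating_sum:
  "(\<And>i. i \<in> I \<Longrightarrow> alternating (t i)) \<Longrightarrow> alternating (\<lambda>A. \<Sum>i\<in>I. t i A)"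
  by (simp add: alternating_def sum_negf)

lemma PV_D:
  assumes "\<alpha> \<in> PV \<A>"
  shows "\<not> (c \<in> \<A> \<and> p \<in> fst c) \<Longrightarrow> \<alpha> c p A B = 0"
    and "alternating (\<lambda>A. \<alpha> c p A B)"
    and "alternating (\<lambda>B. \<alpha> c p A B)"
    and "c \<in> \<A> \<Longrightarrow> smooth_in c (\<lambda>p. \<alpha> c p A B)"
  using assms unfolding PV_def mem_Collect_eq by blast+

lemma PV_transD:
  assumes "\<alpha> \<in> PV \<A>" "c \<in> \<A>" "c' \<in> \<A>" "p \<in> fst c \<inter> fst c'"
  shows "\<alpha> c' p A B =
          (\<Sum>A' | length A' = length A. \<Sum>B' | length B' = length B.
             (\<Prod>i<length A. jac c c' p (A ! i) (A' ! i)) *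
             (\<Prod>j<length B. cnj (jac c' c p (B' ! j) (B ! j))) * \<alpha> c p A' B')"
  by (rule assms(1)[unfolded PV_def mem_Collect_eq, THEN conjunct2, THEN conjunct2, THEN conjunct2,
        THEN conjunct2, rule_format, OF assms(2-4)])

lemma iota_PV:
  fixes \<A> :: "('a::t2_space, 'b::finite) chart set"
  assumes atlas: "complex_atlas \<A>" and W: "holo_fun \<A> W" and \<alpha>: "\<alpha> \<in> PV \<A>"
  shows "iota W \<alpha> \<in> PV \<A>"
  unfolding PV_def
proof (intro CollectI conjI allI ballI impI)
  fix c :: "('a, 'b) chart" and p A B
  assume "\<not> (c \<in> \<A> \<and> p \<in> fst c)"
  then have "\<alpha> c p A B = 0" for A B by (rule PV_D(1)[OF \<alpha>])
  then show "iota W \<alpha> c p A B = 0" by (simp add: iota_def)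
next
  fix c :: "('a, 'b) chart" and p B
  have "alternating (\<lambda>A. \<alpha> c p A B)" by (rule PV_D(2)[OF \<alpha>])
  then show "alternating (\<lambda>A. iota W \<alpha> c p A B)"
    unfolding iota_def by (intro alternating_scale alternating_sum alternating_Cons)
next
  fix c :: "('a, 'b) chart" and p A
  have "alternating (\<lambda>B. \<alpha> c p A B)" for A by (rule PV_D(3)[OF \<alpha>])
  then have "alternating (\<lambda>B. \<Sum>a\<in>UNIV. - \<i> * del c a W p * \<alpha> c p (a # A) B)"
    by (intro alternating_scale alternating_sum) auto
  then show "alternating (\<lambda>B. iota W \<alpha> c p A B)"
    unfolding iota_def alternating_def by simp
next
  fix c and A B :: "'b list"
  assume c: "c \<in> \<A>"
  have \<alpha>c: "smooth_in c (\<lambda>p. \<alpha> c p A B)" for A B by (rule PV_D(4)[OF \<alpha> c])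
  have del: "smooth_in c (del c a W)" for a
    using smooth_in_del[OF atlas c holo_in_smooth_in[OF atlas]] W c by (auto simp: holo_fun_def)
  show "smooth_in c (\<lambda>p. iota W \<alpha> c p A B)"
    unfolding iota_def
    by (rule smooth_inI[OF atlas])
       (intro Ck_on_mult Ck_on_sum Ck_on_const open_coord_image[OF atlas c]
          smooth_inD[OF atlas del] smooth_inD[OF atlas \<alpha>c])
next
  fix c c' p A B
  assume c: "c \<in> \<A>" and c': "c' \<in> \<A>" and p: "p \<in> fst c \<inter> fst c'"
  have tr: "\<alpha> c' p A B =
          (\<Sum>A' | length A' = length A. \<Sum>B' | length B' = length B.
             (\<Prod>i<length A. jac c c' p (A ! i) (A' ! i)) *
             (\<Prod>j<length B. cnj (jac c' c p (B' ! j) (B ! j))) * \<alpha> c p A' B')" for A B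
    by (rule PV_transD[OF \<alpha> c c' p])
  define P where "P A' = (\<Prod>i<length A. jac c c' p (A ! i) (A' ! i))" for A'
  define Q where "Q B' = (\<Prod>j<length B. cnj (jac c' c p (B' ! j) (B ! j)))" for B'
  define s where "s = (-1) ^ length B * (- \<i>)"
  have prod: "(\<Prod>i<Suc (length A). jac c c' p ((a # A) ! i) ((b # A') ! i)) = jac c c' p a b * P A'"
    for a b A'
    unfolding P_def prod.lessThan_Suc_shift nth_Cons_0 nth_Cons_Suc ..
  have exp: "\<alpha> c' p (a # A) B = (\<Sum>b\<in>UNIV. \<Sum>A' | length A' = length A. \<Sum>B' | length B' = length B.
         jac c c' p a b * P A' * Q B' * \<alpha> c p (b # A') B')" for a
    unfolding tr[of "a # A" B] length_Cons sum_lists_Suc prod Q_def ..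
  have "iota W \<alpha> c' p A B = s * (\<Sum>a\<in>UNIV. del c' a W p *
      (\<Sum>b\<in>UNIV. \<Sum>A' | length A' = length A. \<Sum>B' | length B' = length B.
         jac c c' p a b * P A' * Q B' * \<alpha> c p (b # A') B'))"
    unfolding iota_def s_def exp by (simp only: sum_distrib_left mult.assoc)
  also have "\<dots> = s * (\<Sum>a\<in>UNIV. \<Sum>b\<in>UNIV. \<Sum>A' | length A' = length A. \<Sum>B' | length B' = length B.
         (jac c c' p a b * del c' a W p) * (P A' * Q B' * \<alpha> c p (b # A') B'))"
    by (simp add: sum_distrib_left mult_ac)
  also have "\<dots> = s * (\<Sum>b\<in>UNIV. \<Sum>A' | length A' = length A. \<Sum>B' | length B' = length B. \<Sum>a\<in>UNIV.
         (jac c c' p a b * del c' a W p) * (P A' * Q B' * \<alpha> c p (b # A') B'))"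
    by (subst sum.swap, rule arg_cong[where f = "(*) s"], rule sum.cong[OF refl],
        subst sum.swap, rule sum.cong[OF refl], rule sum.swap)
  also have "\<dots> = s * (\<Sum>b\<in>UNIV. \<Sum>A' | length A' = length A. \<Sum>B' | length B' = length B.
         del c b W p * (P A' * Q B' * \<alpha> c p (b # A') B'))"
    using del_change[OF atlas c _ c' _ W, of p] p by (simp flip: sum_distrib_right)
  also have "\<dots> = s * (\<Sum>A' | length A' = length A. \<Sum>B' | length B' = length B. \<Sum>b\<in>UNIV.
         del c b W p * (P A' * Q B' * \<alpha> c p (b # A') B'))"
    by (subst sum.swap, rule arg_cong[where f = "(*) s"], rule sum.cong[OF refl], rule sum.swap)
  also have "\<dots> = (\<Sum>A' | length A' = length A. \<Sum>B' | length B' = length B.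
             P A' * Q B' * iota W \<alpha> c p A' B')"
    by (simp add: iota_def s_def sum_distrib_left sum_negf mult_ac)
  finally show "iota W \<alpha> c' p A B =
          (\<Sum>A' | length A' = length A. \<Sum>B' | length B' = length B.
             (\<Prod>i<length A. jac c c' p (A ! i) (A' ! i)) *
             (\<Prod>j<length B. cnj (jac c' c p (B' ! j) (B ! j))) * iota W \<alpha> c p A' B')"
    by (simp add: P_def Q_def)
qed

lemma Pow_lessThan_Suc_sum:
  "(\<Sum>S\<in>Pow {..<Suc n}. f S) =
     (\<Sum>S\<in>Pow {..<n}. f (Suc ` S)) + (\<Sum>S\<in>Pow {..<n}. f (insert 0 (Suc ` S)))"
  for f :: "nat set \<Rightarrow> 'b::comm_monoid_add"
proof -
  have inj: "inj_on ((`) Suc) (Pow {..<n})" "inj_on (\<lambda>S. insert 0 (Suc ` S)) (Pow {..<n})"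
    by (auto simp: inj_on_def)
  have eq: "Pow {..<Suc n} = (`) Suc ` Pow {..<n} \<union> (\<lambda>S. insert 0 (Suc ` S)) ` Pow {..<n}"
    unfolding lessThan_Suc_eq_insert_0 Pow_insert image_Pow_surj[OF refl, symmetric]
    by (simp add: image_image)
  show ?thesis
    unfolding eq
    by (subst sum.union_disjoint) (auto simp: sum.reindex[OF inj(1)] sum.reindex[OF inj(2)])
qed

lemma shuffle_sign_insert0:
  "S \<subseteq> {..<n} \<Longrightarrow> shuffle_sign (Suc n) (insert 0 (Suc ` S)) = shuffle_sign n S"
proof -
  assume "S \<subseteq> {..<n}"
  have "{(s, t). s \<in> insert 0 (Suc ` S) \<and> t \<in> {..<Suc n} - insert 0 (Suc ` S) \<and> t < s} =
        map_prod Suc Suc ` {(s, t). s \<in> S \<and> t \<in> {..<n} - S \<and> t < s}"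
    by (force simp: lessThan_Suc_eq_insert_0 map_prod_def image_iff)
  moreover have "inj_on (map_prod Suc Suc) X" for X by (auto simp: inj_on_def)
  ultimately show ?thesis by (simp add: shuffle_sign_def card_image)
qed

lemma shuffle_sign_Suc:
  assumes S: "S \<subseteq> {..<n}"
  shows "shuffle_sign (Suc n) (Suc ` S) = (-1) ^ card S * shuffle_sign n S"
proof -
  let ?X = "{(s, t). s \<in> S \<and> t \<in> {..<n} - S \<and> t < s}"
  have fin: "finite S" using S finite_subset by blast
  have "?X \<subseteq> S \<times> {..<n}" by auto
  then have fX: "finite ?X" using fin finite_subset by blast
  have "{(s, t). s \<in> Suc ` S \<and> t \<in> {..<Suc n} - Suc ` S \<and> t < s} =
        map_prod Suc Suc ` ?X \<union> (\<lambda>s. (Suc s, 0)) ` S"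
    by (force simp: lessThan_Suc_eq_insert_0 map_prod_def image_iff)
  moreover have "card (map_prod Suc Suc ` ?X \<union> (\<lambda>s. (Suc s, 0)) ` S) = card ?X + card S"
  proof (subst card_Un_disjoint)
    show "finite (map_prod Suc Suc ` ?X)" "finite ((\<lambda>s. (Suc s, 0)) ` S)" using fX fin by auto
    show "map_prod Suc Suc ` ?X \<inter> (\<lambda>s. (Suc s, 0)) ` S = {}" by auto
    show "card (map_prod Suc Suc ` ?X) + card ((\<lambda>s. (Suc s, 0::nat)) ` S) = card ?X + card S"
      by (subst (1 2) card_image) (auto simp: inj_on_def)
  qed
  ultimately show ?thesis by (simp add: shuffle_sign_def power_add)
qed

lemma length_nths_Pow: "S \<subseteq> {..<length A} \<Longrightarrow> length (nths A S) = card S"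
  unfolding length_nths by (rule arg_cong[where f = card]) auto

lemma length_nths_Compl: "S \<subseteq> {..<length A} \<Longrightarrow> length (nths A (- S)) = length A - card S"
proof -
  assume S: "S \<subseteq> {..<length A}"
  have "{i. i < length A \<and> i \<in> - S} = {..<length A} - S" by auto
  then show ?thesis using S by (simp add: length_nths card_Diff_subset finite_subset)
qed

lemma iota_mult:
  fixes \<A> :: "('x::t2_space, 'd::finite) chart set"
  assumes \<alpha>: "\<alpha> \<in> PV_deg \<A> k"
  shows "iota W (pv_mult \<alpha> \<beta>) =
    pv_add (pv_mult (iota W \<alpha>) \<beta>) (pv_smult (\<lambda>_. (-1) powi k) (pv_mult \<alpha> (iota W \<beta>)))"
proof (intro ext)
  fix c :: "('x, 'd) chart" and p and A B :: "'d list"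
  let ?n = "length A" and ?m = "length B"
  define w where "w a = - \<i> * del c a W p" for a
  define sg where "sg S T = shuffle_sign ?n S * shuffle_sign ?m T" for S T
  define e where "e a S T = sg S T * (-1) ^ ((card S + 1) * (?m - card T)) *
      \<alpha> c p (a # nths A S) (nths B T) * \<beta> c p (nths A (- S)) (nths B (- T))" for a S T
  define f where "f a S T = (-1) ^ card S * sg S T * (-1) ^ (card S * (?m - card T)) *
      \<alpha> c p (nths A S) (nths B T) * \<beta> c p (a # nths A (- S)) (nths B (- T))" for a S T
  have nths0: "nths (a # A) (insert 0 (Suc ` S)) = a # nths A S"
    "nths (a # A) (- insert 0 (Suc ` S)) = nths A (- S)"
    "nths (a # A) (Suc ` S) = nths A S"
    "nths (a # A) (- Suc ` S) = a # nths A (- S)" for a S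
    by (auto simp: nths_Cons image_iff intro!: arg_cong[where f = "nths A"])
  have cards: "card (insert 0 (Suc ` S)) = card S + 1" "card (Suc ` S) = card S"
    if "S \<subseteq> {..<?n}" for S
    using that finite_subset[OF that] by (auto simp: card_image card_insert_if)
  have mult_Cons: "pv_mult \<alpha> \<beta> c p (a # A) B =
      (\<Sum>S\<in>Pow {..<?n}. \<Sum>T\<in>Pow {..<?m}. f a S T) + (\<Sum>S\<in>Pow {..<?n}. \<Sum>T\<in>Pow {..<?m}. e a S T)" for a
    unfolding pv_mult_def e_def f_def sg_def length_Cons Pow_lessThan_Suc_sum nths0
    by (intro arg_cong2[where f = "(+)"] sum.cong refl)
       (auto simp: cards shuffle_sign_insert0 shuffle_sign_Suc)
  have sgn_eq: "(-1::complex) ^ ?m = (-1) ^ card T * (-1) ^ (?m - card T)" if "T \<subseteq> {..<?m}" for T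
  proof -
    have "card T \<le> ?m" using card_mono[OF _ that] by simp
    then show ?thesis by (simp flip: power_add)
  qed
  have "iota W (pv_mult \<alpha> \<beta>) c p A B = (-1) ^ ?m * (\<Sum>a\<in>UNIV. w a * pv_mult \<alpha> \<beta> c p (a # A) B)"
    by (simp add: iota_def w_def)
  also have "\<dots> = (-1) ^ ?m * (\<Sum>a\<in>UNIV. \<Sum>S\<in>Pow {..<?n}. \<Sum>T\<in>Pow {..<?m}. w a * e a S T) +
                  (-1) ^ ?m * (\<Sum>a\<in>UNIV. \<Sum>S\<in>Pow {..<?n}. \<Sum>T\<in>Pow {..<?m}. w a * f a S T)"
    by (simp add: mult_Cons sum_distrib_left sum.distrib algebra_simps)
  also have "\<dots> = (\<Sum>S\<in>Pow {..<?n}. \<Sum>T\<in>Pow {..<?m}. \<Sum>a\<in>UNIV. (-1) ^ ?m * (w a * e a S T)) +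
                  (\<Sum>S\<in>Pow {..<?n}. \<Sum>T\<in>Pow {..<?m}. \<Sum>a\<in>UNIV. (-1) ^ ?m * (w a * f a S T))"
    unfolding sum_distrib_left
    by (intro arg_cong2[where f = "(+)"]; subst sum.swap, intro sum.cong[OF refl], rule sum.swap)
  also have "(\<Sum>S\<in>Pow {..<?n}. \<Sum>T\<in>Pow {..<?m}. \<Sum>a\<in>UNIV. (-1) ^ ?m * (w a * e a S T)) =
      pv_mult (iota W \<alpha>) \<beta> c p A B"
    unfolding pv_mult_def
  proof (intro sum.cong refl)
    fix S T assume ST: "S \<in> Pow {..<?n}" "T \<in> Pow {..<?m}"
    have "(-1::complex) ^ ((card S + 1) * (?m - card T)) =
        (-1) ^ (card S * (?m - card T)) * (-1) ^ (?m - card T)"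
      by (simp add: power_add)
    moreover have "(-1::complex) ^ (?m - card T) * (-1) ^ (?m - card T) = 1"
      by (simp flip: power_mult_distrib)
    ultimately show "(\<Sum>a\<in>UNIV. (-1) ^ ?m * (w a * e a S T)) =
       shuffle_sign ?n S * shuffle_sign ?m T * (-1) ^ (card S * (?m - card T)) *
       iota W \<alpha> c p (nths A S) (nths B T) * \<beta> c p (nths A (- S)) (nths B (- T))"
      using ST
      by (simp add: e_def sg_def iota_def w_def length_nths_Pow sgn_eq sum_distrib_left
            sum_distrib_right sum_negf algebra_simps)
  qed
  also have "(\<Sum>S\<in>Pow {..<?n}. \<Sum>T\<in>Pow {..<?m}. \<Sum>a\<in>UNIV. (-1) ^ ?m * (w a * f a S T)) =
      (-1) powi k * pv_mult \<alpha> (iota W \<beta>) c p A B"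
    unfolding pv_mult_def sum_distrib_left
  proof (intro sum.cong refl)
    fix S T assume ST: "S \<in> Pow {..<?n}" "T \<in> Pow {..<?m}"
    let ?a = "\<alpha> c p (nths A S) (nths B T)"
    have k: "(-1) ^ ?m * (-1) ^ card S * ?a = (-1) powi k * (-1) ^ (?m - card T) * ?a"
    proof (cases "?a = 0")
      case False
      then have k: "- int (card S) + int (card T) = k"
      proof -
        have "- int (length (nths A S)) + int (length (nths B T)) = k"
          using \<alpha> False unfolding PV_deg_def by blast
        then show ?thesis using ST by (simp add: length_nths_Pow)
      qed
      have "(-1::complex) powi k = (-1) ^ card T * (-1) ^ card S"
        unfolding k[symmetric] by (simp add: power_int_diff minus_one_power_iff)
      then show ?thesis using sgn_eq[of T] ST by simp
    qed simp
    have "(\<Sum>a\<in>UNIV. (-1) ^ ?m * (w a * f a S T)) =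
       ((-1) ^ ?m * (-1) ^ card S * ?a) * (sg S T * (-1) ^ (card S * (?m - card T)) *
         (\<Sum>a\<in>UNIV. w a * \<beta> c p (a # nths A (- S)) (nths B (- T))))"
      by (simp add: f_def sum_distrib_left mult_ac)
    then show "(\<Sum>a\<in>UNIV. (-1) ^ ?m * (w a * f a S T)) = (-1) powi k *
       (shuffle_sign ?n S * shuffle_sign ?m T * (-1) ^ (card S * (?m - card T)) *
        \<alpha> c p (nths A S) (nths B T) * iota W \<beta> c p (nths A (- S)) (nths B (- T)))"
      unfolding k using ST
      by (simp add: sg_def iota_def w_def length_nths_Compl mult_ac)
  qed
  finally show "iota W (pv_mult \<alpha> \<beta>) c p A B =
    pv_add (pv_mult (iota W \<alpha>) \<beta>) (pv_smult (\<lambda>_. (-1) powi k) (pv_mult \<alpha> (iota W \<beta>))) c p A B"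
    by (simp add: pv_add_def pv_smult_def)
qed

lemma is_iota_iota:
  fixes \<A> :: "('x::t2_space, 'd::finite) chart set"
  assumes "complex_atlas \<A>" "holo_fun \<A> W"
  shows "is_iota \<A> W (iota W)"
  unfolding is_iota_def
proof (intro conjI allI ballI impI)
  show "iota W \<alpha> \<in> PV \<A>" if "\<alpha> \<in> PV \<A>" for \<alpha>
    using iota_PV[OF assms that] .
  show "iota W (pv_add \<alpha> \<beta>) = pv_add (iota W \<alpha>) (iota W \<beta>)" for \<alpha> \<beta> :: "('x, 'd) pv"
    by (simp add: iota_def pv_add_def fun_eq_iff sum.distrib sum_negf sum_subtractf algebra_simps)
  show "iota W (pv_smult f \<alpha>) = pv_smult f (iota W \<alpha>)" for f and \<alpha> :: "('x, 'd) pv"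
    by (simp add: iota_def pv_smult_def fun_eq_iff sum_distrib_left mult_ac)
  show "iota W (pv_mult \<alpha> \<beta>) =
      pv_add (pv_mult (iota W \<alpha>) \<beta>) (pv_smult (\<lambda>_. (-1) powi k) (pv_mult \<alpha> (iota W \<beta>)))"
    if "\<alpha> \<in> PV_deg \<A> k" for k \<alpha> \<beta>
    using iota_mult[OF that] .
  show "iota W v c p [] [] = (\<Sum>a\<in>UNIV. - \<i> * del c a W p * v c p [a] [])"
    for v and c :: "('x, 'd) chart" and p
    by (simp add: iota_def)
  show "iota W \<alpha> \<in> PV_bideg \<A> (i + 1) j" if \<alpha>: "\<alpha> \<in> PV_bideg \<A> i j" for i j \<alpha>
  proof -
    have "- int (length A) = i + 1 \<and> int (length B) = j" if nz: "iota W \<alpha> c p A B \<noteq> 0" for c p A B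
    proof -
      obtain a where "\<alpha> c p (a # A) B \<noteq> 0"
        using nz unfolding iota_def by (metis (no_types, lifting) mult_zero_right sum.neutral)
      then have "- int (length (a # A)) = i \<and> int (length B) = j"
        using \<alpha> unfolding PV_bideg_def by blast
      then show ?thesis by auto
    qed
    moreover have "\<alpha> \<in> PV \<A>" using \<alpha> by (simp add: PV_bideg_def)
    ultimately show ?thesis using iota_PV[OF assms] by (simp add: PV_bideg_def)
  qed
qed

definition delta :: "('x, 'd::finite) chart set \<Rightarrow> ('x \<Rightarrow> complex) \<Rightarrow> ('x, 'd) pv \<Rightarrow> ('x, 'd) pv" where
  "delta \<A> W \<alpha> = pv_add (pv_dbar \<A> \<alpha>) (iota W \<alpha>)"


section \<open>Differential graded modules\<close>

record ('a, 'b) dg_mod = "('a, 'b) module" +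
  grade :: "int \<Rightarrow> 'b set"
  differential :: "'b \<Rightarrow> 'b"

definition is_graded_module :: "('a, 'r) ring_scheme \<Rightarrow> ('a, 'b, 'm) dg_mod_scheme \<Rightarrow> bool" where
  "is_graded_module R M \<longleftrightarrow>
     Module.module R M \<and> (\<forall>k. submodule (grade M k) R M) \<and>
     (\<forall>x\<in>carrier M. \<exists>!g. (\<forall>k. g k \<in> grade M k) \<and> finite {k. g k \<noteq> \<zero>\<^bsub>M\<^esub>} \<and>
        x = (\<Oplus>\<^bsub>M\<^esub>k\<in>{k. g k \<noteq> \<zero>\<^bsub>M\<^esub>}. g k))"

definition graded_hom ::
    "('a, 'r) ring_scheme \<Rightarrow> ('a, 'b, 'm) dg_mod_scheme \<Rightarrow> ('a, 'c, 'n) dg_mod_scheme \<Rightarrow>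
     int \<Rightarrow> ('b \<Rightarrow> 'c) \<Rightarrow> bool" where
  "graded_hom R M N n f \<longleftrightarrow>
     (\<forall>x\<in>carrier M. f x \<in> carrier N) \<and>
     (\<forall>x\<in>carrier M. \<forall>y\<in>carrier M. f (x \<oplus>\<^bsub>M\<^esub> y) = f x \<oplus>\<^bsub>N\<^esub> f y) \<and>
     (\<forall>r\<in>carrier R. \<forall>x\<in>carrier M. f (r \<odot>\<^bsub>M\<^esub> x) = r \<odot>\<^bsub>N\<^esub> f x) \<and>
     (\<forall>k. \<forall>x\<in>grade M k. f x \<in> grade N (k + n))"

definition is_dg_module :: "('a, 'r) ring_scheme \<Rightarrow> ('a, 'b, 'm) dg_mod_scheme \<Rightarrow> bool" where
  "is_dg_module R M \<longleftrightarrow>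
     is_graded_module R M \<and> graded_hom R M M 1 (differential M) \<and>
     (\<forall>x\<in>carrier M. differential M (differential M x) = \<zero>\<^bsub>M\<^esub>)"

definition dg_morphism ::
    "('a, 'r) ring_scheme \<Rightarrow> ('a, 'b, 'm) dg_mod_scheme \<Rightarrow> ('a, 'c, 'n) dg_mod_scheme \<Rightarrow>
     ('b \<Rightarrow> 'c) \<Rightarrow> bool" where
  "dg_morphism R M N f \<longleftrightarrow>
     is_dg_module R M \<and> is_dg_module R N \<and> graded_hom R M N 0 f \<and>
     (\<forall>x\<in>carrier M. f (differential M x) = differential N (f x))"

definition dg_homotopic ::
    "('a, 'r) ring_scheme \<Rightarrow> ('a, 'b, 'm) dg_mod_scheme \<Rightarrow> ('a, 'c, 'n) dg_mod_scheme \<Rightarrow>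
     ('b \<Rightarrow> 'c) \<Rightarrow> ('b \<Rightarrow> 'c) \<Rightarrow> bool" where
  "dg_homotopic R M N f g \<longleftrightarrow>
     (\<exists>h. graded_hom R M N (- 1) h \<and>
        (\<forall>x\<in>carrier M. f x \<ominus>\<^bsub>N\<^esub> g x = differential N (h x) \<oplus>\<^bsub>N\<^esub> h (differential M x)))"

definition dg_homotopy_equivalence ::
    "('a, 'r) ring_scheme \<Rightarrow> ('a, 'b, 'm) dg_mod_scheme \<Rightarrow> ('a, 'c, 'n) dg_mod_scheme \<Rightarrow>
     ('b \<Rightarrow> 'c) \<Rightarrow> bool" where
  "dg_homotopy_equivalence R M N f \<longleftrightarrow>
     dg_morphism R M N f \<and>
     (\<exists>g. dg_morphism R N M g \<and>
        dg_homotopic R M M (g \<circ> f) id \<and> dg_homotopic R N N (f \<circ> g) id)"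

definition cocycles :: "('a, 'b, 'm) dg_mod_scheme \<Rightarrow> int \<Rightarrow> 'b set" where
  "cocycles M k = {x \<in> grade M k. differential M x = \<zero>\<^bsub>M\<^esub>}"

definition coboundaries :: "('a, 'b, 'm) dg_mod_scheme \<Rightarrow> int \<Rightarrow> 'b set" where
  "coboundaries M k = differential M ` grade M (k - 1)"

definition cohomology :: "('a, 'b, 'm) dg_mod_scheme \<Rightarrow> int \<Rightarrow> 'b set set" where
  "cohomology M k = a_r_coset M (coboundaries M k) ` cocycles M k"

definition cohomology_map ::
    "('a, 'c, 'n) dg_mod_scheme \<Rightarrow> int \<Rightarrow> ('b \<Rightarrow> 'c) \<Rightarrow> 'b set \<Rightarrow> 'c set" where
  "cohomology_map N k f C = (\<Union>x\<in>C. a_r_coset N (coboundaries N k) (f x))"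

definition quasi_isomorphism ::
    "('a, 'r) ring_scheme \<Rightarrow> ('a, 'b, 'm) dg_mod_scheme \<Rightarrow> ('a, 'c, 'n) dg_mod_scheme \<Rightarrow>
     ('b \<Rightarrow> 'c) \<Rightarrow> bool" where
  "quasi_isomorphism R M N f \<longleftrightarrow>
     dg_morphism R M N f \<and>
     (\<forall>k. bij_betw (cohomology_map N k f) (cohomology M k) (cohomology N k))"


section \<open>The two modules\<close>

definition holo_ring :: "('x, 'd::finite) chart set \<Rightarrow> ('x \<Rightarrow> complex) ring" where
  "holo_ring \<A> =
     \<lparr>carrier = {f. holo_fun \<A> f}, monoid.mult = (\<lambda>f g p. f p * g p), one = (\<lambda>p. 1),
      zero = (\<lambda>p. 0), add = (\<lambda>f g p. f p + g p)\<rparr>"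

definition PV_dg ::
    "('x, 'd::finite) chart set \<Rightarrow> ('x \<Rightarrow> complex) \<Rightarrow> ('x \<Rightarrow> complex, ('x, 'd) pv) dg_mod" where
  "PV_dg \<A> W =
     \<lparr>carrier = PV \<A>, monoid.mult = pv_mult, one = pv_one \<A>, zero = pv_zero, add = pv_add,
      smult = pv_smult, grade = PV_deg \<A>, differential = delta \<A> W\<rparr>"

definition PVc_dg ::
    "('x::topological_space, 'd::finite) chart set \<Rightarrow> ('x \<Rightarrow> complex) \<Rightarrow>
     ('x \<Rightarrow> complex, ('x, 'd) pv) dg_mod" where
  "PVc_dg \<A> W =
     (PV_dg \<A> W)\<lparr>carrier := PVc \<A>, grade := (\<lambda>k. PV_deg \<A> k \<inter> PVc \<A>)\<rparr>"

end

theory Submission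
  imports Defs
begin

text \<open>
  Let \<open>v\<close> be a smooth vector field, and let \<open>V\<close> be left exterior multiplication by \<open>v\<close>. The map
  \<open>L = 1 + [\<delta>\<^sub>W, V]\<close> commutes with \<open>\<delta>\<^sub>W\<close> and is homotopic to the identity, and so are its powers.
  Dividing the gradient of \<open>W\<close> for the Hermitian metric by \<open>|\<partial>W|\<^sup>2 + \<rho>\<close>, where \<open>\<rho> \<ge> 0\<close> is smooth
  with compact support and positive on the critical set, one obtains a \<open>v\<close> with \<open>[\<iota>\<^sub>W, V] = -1\<close>
  outside the support of \<open>\<rho>\<close>. There \<open>L\<close> reduces to \<open>[\<partial>bar, V]\<close>, which raises the polyvector length by
  one, so \<open>L\<^sup>d\<^sup>+\<^sup>1\<close> vanishes outside the support of \<open>\<rho>\<close>. Hence \<open>L\<^sup>d\<^sup>+\<^sup>1\<close> is a homotopy inverse of the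
  inclusion; \<open>V\<close> preserves compact supports, so the same homotopies work on both modules.
\<close>

text \<open>The field \<open>v\<close> is smooth but in general not holomorphic, and this is why a
  power of \<open>L\<close> is needed: for holomorphic \<open>v\<close> the anticommutator of
  \<partial>bar and \<open>V\<close> would vanish, and \<open>L\<close> itself would be zero off the
  support of \<rho>. In general there remains multiplication by \<partial>bar \<open>v\<close>,
  which is nilpotent because it carries a vector factor. Only its effect on the length of the index
  lists is used, never a formula for it. The value -1 of the other anticommutator serves to cancel
  the 1 in \<open>L\<close>. Since \<open>V\<close> is linear over all functions and the
  differential over holomorphic ones, every homotopy is linear over O(X). Much of the work is
  foundational. An element of \<open>PV\<close> is a family of components in charts, so each
  operator has to be shown to respect the transformation law. The delicate case is \<partial>bar,
  which also differentiates the transformation matrices; the second derivatives that arise are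
  symmetric and cancel in an alternating sum.\<close>

section \<open>Alternating sums and tensor transformations over index lists\<close>

text \<open>Equals the sum over \<open>k\<close> of \<open>(-1)\<^sup>k f (B ! k) (B without position k)\<close>; both the
  Dolbeault operator and the exterior product with a vector field have this form.\<close>

primrec ext_sum :: "'d list \<Rightarrow> ('d \<Rightarrow> 'd list \<Rightarrow> complex) \<Rightarrow> complex" where
  "ext_sum [] f = 0"
| "ext_sum (b # B) f = f b B - ext_sum B (\<lambda>x C. f x (b # C))"

lemma ext_sum_conv:
  "(\<Sum>k<length B. (-1) ^ k * f (B ! k) (take k B @ drop (Suc k) B)) = ext_sum B f"
proof (induction B arbitrary: f)
  case (Cons b B)
  show ?case
    by (simp add: sum.lessThan_Suc_shift Cons[symmetric] sum_negf del: sum.lessThan_Suc)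
qed simp

lemma ext_sum_cong:
  "(\<And>x C. Suc (length C) = length B \<Longrightarrow> f x C = g x C) \<Longrightarrow> ext_sum B f = ext_sum B g"
proof (induction B arbitrary: f g)
  case (Cons b B)
  from Cons.prems have "f b B = g b B" by simp
  moreover have "ext_sum B (\<lambda>x C. f x (b # C)) = ext_sum B (\<lambda>x C. g x (b # C))"
    by (rule Cons.IH) (simp add: Cons.prems)
  ultimately show ?case by simp
qed simp

lemma ext_sum_zero [simp]: "ext_sum B (\<lambda>x C. 0) = 0"
  by (induction B) auto

lemma ext_sum_neutral:
  "(\<And>x C. Suc (length C) = length B \<Longrightarrow> f x C = 0) \<Longrightarrow> ext_sum B f = 0"
  using ext_sum_cong[of B f "\<lambda>x C. 0"] by simp

lemma ext_sum_add: "ext_sum B (\<lambda>x C. f x C + g x C) = ext_sum B f + ext_sum B g"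
  by (induction B arbitrary: f g) auto

lemma ext_sum_diff: "ext_sum B (\<lambda>x C. f x C - g x C) = ext_sum B f - ext_sum B g"
  by (induction B arbitrary: f g) auto

lemma ext_sum_scale: "ext_sum B (\<lambda>x C. r * f x C) = r * ext_sum B f"
  by (induction B arbitrary: f) (auto simp: algebra_simps)

lemma ext_sum_minus: "ext_sum B (\<lambda>x C. - f x C) = - ext_sum B f"
  using ext_sum_scale[of B "-1" f] by simp

lemma ext_sum_sum: "ext_sum B (\<lambda>x C. \<Sum>i\<in>I. f i x C) = (\<Sum>i\<in>I. ext_sum B (f i))"
  by (induction I rule: infinite_finite_induct) (auto simp: ext_sum_add)

text \<open>This cancellation gives both \<open>\<partial>\<close>bar squared zero and the independence of \<open>\<partial>\<close>bar from the
  coordinates.\<close>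

lemma ext_sum_ext_sum_symmetric:
  assumes "\<And>x y D. f x y D = f y x D"
  shows "ext_sum B (\<lambda>x C. ext_sum C (\<lambda>y D. f x y D)) = 0"
  using assms
proof (induction B arbitrary: f)
  case (Cons b B)
  have "ext_sum B (\<lambda>x C. ext_sum C (\<lambda>y D. f x y (b # D))) = 0"
    by (rule Cons.IH) (rule Cons.prems)
  moreover have "ext_sum B (\<lambda>x C. f x b C) = ext_sum B (\<lambda>x C. f b x C)"
    by (rule ext_sum_cong) (rule Cons.prems)
  ultimately show ?case by (simp add: ext_sum_diff)
qed simp

lemma alternating_adjacent:
  assumes "alternating t" shows "t (xs @ a # b # ys) = - t (xs @ b # a # ys)"
proof -
  have "t ((xs @ b # a # ys)[length xs := (xs @ b # a # ys) ! (Suc (length xs)),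
      Suc (length xs) := (xs @ b # a # ys) ! length xs]) = - t (xs @ b # a # ys)"
    by (rule assms[unfolded alternating_def, rule_format]) simp
  then show ?thesis by (simp add: nth_append list_update_append)
qed

text \<open>An exchange across \<open>ys\<close> is composed of an odd number of adjacent exchanges.
  The criterion suits \<open>ext_sum\<close>, whose recursion sees only neighbouring
  entries.\<close>

lemma alternatingI:
  assumes adj: "\<And>xs a b ys. t (xs @ a # b # ys) = - t (xs @ b # a # ys)"
  shows "alternating t"
proof -
  have far: "t (xs @ a # ys @ b # zs) = - t (xs @ b # ys @ a # zs)" for xs a b ys zs
  proof (induction ys arbitrary: xs)
    case Nil
    show ?case using adj[of xs a b zs] by simp
  next
    case (Cons y ys)
    have "t (xs @ a # (y # ys) @ b # zs) = - t ((xs @ [y]) @ a # ys @ b # zs)"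
      using adj[of xs a y "ys @ b # zs"] by simp
    also have "\<dots> = t (xs @ y # b # ys @ a # zs)" by (subst Cons.IH) simp
    also have "\<dots> = - t (xs @ b # (y # ys) @ a # zs)" using adj[of xs y b "ys @ a # zs"] by simp
    finally show ?case .
  qed
  have less: "t (A[i := A ! j, j := A ! i]) = - t A" if "i < j" "j < length A" for A i j
  proof -
    let ?xs = "take i A" and ?ys = "take (j - Suc i) (drop (Suc i) A)" and ?zs = "drop (Suc j) A"
    have l: "length ?xs = i" "length ?ys = j - Suc i" using that by auto
    have "drop (Suc i) A = ?ys @ drop j A"
      using that append_take_drop_id[of "j - Suc i" "drop (Suc i) A"] by simp
    moreover have "drop j A = A ! j # ?zs" using that by (simp add: Cons_nth_drop_Suc)
    moreover have "A = ?xs @ A ! i # drop (Suc i) A" using that by (simp add: id_take_nth_drop)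
    ultimately have A: "A = ?xs @ A ! i # ?ys @ A ! j # ?zs" by metis
    have "A[i := A ! j] = (?xs @ A ! j # ?ys) @ A ! j # ?zs"
      by (subst A) (use list_update_length[of ?xs "A ! i" "?ys @ A ! j # ?zs" "A ! j"] l in simp)
    moreover have "length (?xs @ A ! j # ?ys) = j" using that l by simp
    ultimately have "A[i := A ! j, j := A ! i] = (?xs @ A ! j # ?ys) @ A ! i # ?zs"
      using list_update_length by metis
    then show ?thesis using far[of ?xs "A ! i" ?ys "A ! j" ?zs] A by simp
  qed
  show ?thesis unfolding alternating_def
  proof (intro allI impI)
    fix A :: "'a list" and i j assume ij: "i < length A \<and> j < length A \<and> i \<noteq> j"
    show "t (A[i := A ! j, j := A ! i]) = - t A"
    proof (cases "i < j")
      case True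
      then show ?thesis using ij less by blast
    next
      case False
      then have "t (A[j := A ! i, i := A ! j]) = - t A" using ij less by simp
      then show ?thesis using ij by (simp add: list_update_swap)
    qed
  qed
qed

text \<open>When two neighbours are exchanged, the terms that extract one of them trade places,
  where they carry opposite signs; in every other term both neighbours stay in the list, and the
  alternation of \<open>f x\<close> gives the sign.\<close>

lemma alternating_ext_sum:
  assumes "\<And>x. alternating (f x)"
  shows "alternating (\<lambda>B. ext_sum B f)"
proof (rule alternatingI)
  fix xs ys :: "'a list" and a b
  show "ext_sum (xs @ a # b # ys) f = - ext_sum (xs @ b # a # ys) f"
    using assms
  proof (induction xs arbitrary: f)
    case Nil
    have "f x (a # b # C) = - f x (b # a # C)" for x C
      using alternating_adjacent[OF Nil, of x "[]" a b C] by simp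
    then have "ext_sum ys (\<lambda>x C. f x (a # b # C)) = - ext_sum ys (\<lambda>x C. f x (b # a # C))"
      by (simp add: ext_sum_minus)
    then show ?case by simp
  next
    case (Cons x xs)
    have "ext_sum (xs @ a # b # ys) (\<lambda>y C. f y (x # C)) =
        - ext_sum (xs @ b # a # ys) (\<lambda>y C. f y (x # C))"
      by (rule Cons.IH) (rule alternating_Cons[OF Cons.prems])
    then show ?case using alternating_adjacent[OF Cons.prems, of x xs a b ys] by simp
  qed
qed

lemma alternating_not_distinct:
  assumes "alternating t" "\<not> distinct A" shows "t A = 0"
proof -
  obtain i j where ij: "i < length A" "j < length A" "i \<noteq> j" "A ! i = A ! j"
    using assms(2) by (auto simp: distinct_conv_nth)
  then have "t (A[i := A ! j, j := A ! i]) = - t A"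
    using assms(1) unfolding alternating_def by blast
  moreover have "A[i := A ! j, j := A ! i] = A"
    using ij by (metis list_update_id)
  ultimately show ?thesis by simp
qed

text \<open>By the pigeonhole principle an entry repeats. This bounds the degrees of elements of
  \<open>PV\<close> and is the origin of the exponent \<open>Suc CARD('d)\<close> in the final
  argument.\<close>

lemma alternating_length:
  fixes t :: "'d::finite list \<Rightarrow> complex"
  assumes "alternating t" "CARD('d) < length A" shows "t A = 0"
  using assms distinct_card[of A] card_mono[of UNIV "set A"]
  by (intro alternating_not_distinct) auto

section \<open>Change of coordinates for tensor components\<close>

primrec tensor_change :: "('d \<Rightarrow> 'd::finite \<Rightarrow> complex) \<Rightarrow> 'd list \<Rightarrow> ('d list \<Rightarrow> complex) \<Rightarrow> complex"
  where
  "tensor_change M [] t = t []"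
| "tensor_change M (a # A) t = (\<Sum>b\<in>UNIV. M a b * tensor_change M A (\<lambda>C. t (b # C)))"

text \<open>Links the recursion to the sums over index lists in the definition of \<open>PV\<close>.
  The recursive form treats one index at a time and so allows induction along the list in parallel
  with \<open>ext_sum\<close>.\<close>

lemma tensor_change_conv:
  "(\<Sum>A' | length A' = length A. (\<Prod>i<length A. M (A ! i) (A' ! i)) * t A') = tensor_change M A t"
proof (induction A arbitrary: t)
  case (Cons a A)
  show ?case
    by (simp add: sum_lists_Suc prod.lessThan_Suc_shift Cons[symmetric] sum_distrib_left mult_ac
             del: prod.lessThan_Suc)
qed simp

lemma tensor_change_cong:
  "(\<And>C. length C = length A \<Longrightarrow> t C = u C) \<Longrightarrow> tensor_change M A t = tensor_change M A u"
proof (induction A arbitrary: t u)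
  case (Cons a A)
  have "tensor_change M A (\<lambda>C. t (b # C)) = tensor_change M A (\<lambda>C. u (b # C))" for b
    by (rule Cons.IH) (simp add: Cons.prems)
  then show ?case by simp
qed simp

lemma tensor_change_zero [simp]: "tensor_change M A (\<lambda>C. 0) = 0"
  by (induction A) auto

lemma tensor_change_add:
  "tensor_change M A (\<lambda>C. t C + u C) = tensor_change M A t + tensor_change M A u"
  by (induction A arbitrary: t u) (auto simp: sum.distrib algebra_simps)

lemma tensor_change_scale: "tensor_change M A (\<lambda>C. r * t C) = r * tensor_change M A t"
  by (induction A arbitrary: t) (auto simp: sum_distrib_left mult_ac)

lemma tensor_change_minus: "tensor_change M A (\<lambda>C. - t C) = - tensor_change M A t"
  using tensor_change_scale[of M A "-1" t] by simp

lemma tensor_change_diff: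
  "tensor_change M A (\<lambda>C. t C - u C) = tensor_change M A t - tensor_change M A u"
  using tensor_change_add[of M A t "\<lambda>C. - u C"] by (simp add: tensor_change_minus)

lemma tensor_change_sum:
  "tensor_change M A (\<lambda>C. \<Sum>i\<in>I. t i C) = (\<Sum>i\<in>I. tensor_change M A (t i))"
  by (induction I rule: infinite_finite_induct) (auto simp: tensor_change_add)

lemma tensor_change_ext_sum_swap:
  "tensor_change M B (\<lambda>B'. ext_sum A (\<lambda>x C. f x C B')) =
     ext_sum A (\<lambda>x C. tensor_change M B (f x C))"
  by (induction A arbitrary: f) (simp_all add: tensor_change_diff)

text \<open>Each index is transformed independently, and the signs in \<open>ext_sum\<close> depend
  on positions only. An extracted index therefore takes its own factor of \<open>M\<close> with
  it.\<close>

lemma tensor_change_ext_sum: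
  "tensor_change M A (\<lambda>A'. ext_sum A' f) =
     ext_sum A (\<lambda>x C. \<Sum>y\<in>UNIV. M x y * tensor_change M C (f y))"
proof (induction A arbitrary: f)
  case (Cons a A)
  have "(\<Sum>y\<in>UNIV. M a y * ext_sum A (\<lambda>x C. \<Sum>z\<in>UNIV. M x z * tensor_change M C (\<lambda>D. f z (y # D))))
      = ext_sum A (\<lambda>x C. \<Sum>y\<in>UNIV. \<Sum>z\<in>UNIV. M a y * (M x z * tensor_change M C (\<lambda>D. f z (y # D))))"
    by (simp only: ext_sum_sum ext_sum_scale sum_distrib_left)
  also have "\<dots> = ext_sum A (\<lambda>x C. \<Sum>z\<in>UNIV. M x z * tensor_change M (a # C) (f z))"
    by (subst sum.swap) (simp add: sum_distrib_left mult_ac)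
  finally show ?case
    by (simp add: Cons tensor_change_diff right_diff_distrib sum_subtractf)
qed simp

text \<open>The terms of the Leibniz rule in which the transformation matrix is differentiated.\<close>

primrec tensor_change_deriv ::
    "('d \<Rightarrow> 'd::finite \<Rightarrow> complex) \<Rightarrow> ('d \<Rightarrow> 'd \<Rightarrow> complex) \<Rightarrow> 'd list \<Rightarrow> ('d list \<Rightarrow> complex) \<Rightarrow> complex"
  where
  "tensor_change_deriv M N [] t = 0"
| "tensor_change_deriv M N (a # A) t =
     (\<Sum>b\<in>UNIV. N a b * tensor_change M A (\<lambda>C. t (b # C))
        + M a b * tensor_change_deriv M N A (\<lambda>C. t (b # C)))"

text \<open>Alternation moves the index that meets \<open>N\<close> to the front, at the cost of the
  sign \<open>(-1)^k\<close> that \<open>ext_sum\<close> provides for position \<open>k\<close>.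
  This brings the Leibniz remainder into the shape to which \<open>ext_sum_ext_sum_symmetric\<close>
  applies.\<close>

lemma tensor_change_deriv_alternating:
  assumes "alternating t"
  shows "tensor_change_deriv M N A t =
    ext_sum A (\<lambda>x C. \<Sum>y\<in>UNIV. N x y * tensor_change M C (\<lambda>D. t (y # D)))"
  using assms
proof (induction A arbitrary: t)
  case (Cons a A)
  have sw: "t (b # y # D) = - t (y # b # D)" for b y D
    using alternating_adjacent[OF Cons.prems, of "[]" b y D] by simp
  have IH: "tensor_change_deriv M N A (\<lambda>C. t (b # C)) =
     - ext_sum A (\<lambda>x C. \<Sum>y\<in>UNIV. N x y * tensor_change M C (\<lambda>D. t (y # b # D)))" for b
    unfolding Cons.IH[OF alternating_Cons[OF Cons.prems, of b]]
    by (subst sw[of b]) (simp add: tensor_change_minus sum_negf ext_sum_minus)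
  have "(\<Sum>b\<in>UNIV. M a b * ext_sum A (\<lambda>x C. \<Sum>y\<in>UNIV. N x y * tensor_change M C (\<lambda>D. t (y # b # D))))
     = ext_sum A (\<lambda>x C. \<Sum>b\<in>UNIV. \<Sum>y\<in>UNIV. M a b * (N x y * tensor_change M C (\<lambda>D. t (y # b # D))))"
    by (simp only: ext_sum_sum ext_sum_scale sum_distrib_left)
  also have "\<dots> = ext_sum A (\<lambda>x C. \<Sum>y\<in>UNIV. N x y * tensor_change M (a # C) (\<lambda>D. t (y # D)))"
    by (subst sum.swap) (simp add: sum_distrib_left mult_ac)
  finally show ?case
    by (simp only: tensor_change_deriv.simps ext_sum.simps IH sum.distrib mult_minus_right
        sum_negf diff_conv_add_uminus)
qed simp


section \<open>Smooth functions on open sets\<close>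

text \<open>No differentiability is involved: \<open>f\<close> and \<open>g\<close> have the same
  derivatives as a relation, so even the arbitrary choice in \<open>frechet_derivative\<close>
  agrees.\<close>

lemma frechet_derivative_cong_open:
  assumes "open U" "x \<in> U" "\<And>y. y \<in> U \<Longrightarrow> f y = g y"
  shows "frechet_derivative f (at x) = frechet_derivative g (at x)"
proof -
  have "(f has_derivative D) (at x) \<longleftrightarrow> (g has_derivative D) (at x)" for D
    using has_derivative_transform_within_open[OF _ assms(1,2)] assms(3) by metis
  then show ?thesis by (simp add: frechet_derivative_def)
qed

lemma frechet_derivative_eqI:
  "(f has_derivative D) (at x) \<Longrightarrow> frechet_derivative f (at x) = D"
  using frechet_derivative_at by metis

lemma Ck_on_differentiable: "Ck_on (Suc k) S f \<Longrightarrow> x \<in> S \<Longrightarrow> f differentiable (at x)"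
  by simp

lemma Ck_on_frechet_derivative:
  "Ck_on (Suc k) S f \<Longrightarrow> Ck_on k S (\<lambda>x. frechet_derivative f (at x) v)"
  by simp

lemma Ck_on_SucI:
  assumes "open S" "\<And>x. x \<in> S \<Longrightarrow> (f has_derivative D x) (at x)" "\<And>v. Ck_on k S (\<lambda>x. D x v)"
  shows "Ck_on (Suc k) S f"
proof -
  have "Ck_on k S (\<lambda>x. frechet_derivative f (at x) v)" for v
    by (rule Ck_on_cong[OF assms(1) _ assms(3)[of v]])
       (simp add: frechet_derivative_eqI[OF assms(2)])
  then show ?thesis using assms(2) by (auto simp: differentiable_def)
qed

lemma Ck_on_Un:
  "open S \<Longrightarrow> open T \<Longrightarrow> Ck_on k S f \<Longrightarrow> Ck_on k T f \<Longrightarrow> Ck_on k (S \<union> T) f"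
  by (induction k arbitrary: f) (auto intro: continuous_on_open_Un)

lemma Ck_on_bounded_linear:
  assumes "open S" "bounded_linear h" "Ck_on k S f"
  shows "Ck_on k S (\<lambda>x. h (f x))"
  using assms(3)
proof (induction k arbitrary: f)
  case 0
  then show ?case by (simp add: bounded_linear.continuous_on[OF assms(2)])
next
  case (Suc k)
  show ?case
  proof (rule Ck_on_SucI[OF assms(1)])
    show "((\<lambda>x. h (f x)) has_derivative (\<lambda>v. h (frechet_derivative f (at x) v))) (at x)"
      if "x \<in> S" for x
      using Suc.prems that
      by (intro bounded_linear.has_derivative[OF assms(2)]) (simp add: frechet_derivative_works)
    show "Ck_on k S (\<lambda>x. h (frechet_derivative f (at x) v))" for v
      using Suc.prems by (intro Suc.IH) simp
  qed
qed

lemma Ck_on_diff: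
  fixes f g :: "'a::real_normed_vector \<Rightarrow> complex"
  assumes "open S" "Ck_on k S f" "Ck_on k S g"
  shows "Ck_on k S (\<lambda>x. f x - g x)"
  using Ck_on_add[OF assms(1,2) Ck_on_mult[OF assms(1) Ck_on_const[of k S "-1"] assms(3)]] by simp

lemma Ck_on_prod:
  fixes f :: "'i \<Rightarrow> 'a::real_normed_vector \<Rightarrow> complex"
  assumes "open S" "\<And>i. i \<in> I \<Longrightarrow> Ck_on k S (f i)"
  shows "Ck_on k S (\<lambda>x. \<Prod>i\<in>I. f i x)"
  using assms(2)
  by (induction I rule: infinite_finite_induct)
     (auto intro: Ck_on_const Ck_on_mult[OF assms(1)])

lemma Ck_on_inverse:
  fixes f :: "'a::real_normed_vector \<Rightarrow> complex"
  assumes "open S" "\<And>x. x \<in> S \<Longrightarrow> f x \<noteq> 0" "Ck_on k S f"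
  shows "Ck_on k S (\<lambda>x. inverse (f x))"
  using assms(3)
proof (induction k)
  case 0
  then show ?case using assms(2) by (auto intro: continuous_on_inverse)
next
  case (Suc k)
  have inv: "Ck_on k S (\<lambda>x. inverse (f x))" using Suc Ck_on_SucD by blast
  show ?case
  proof (rule Ck_on_SucI[OF assms(1)])
    show "((\<lambda>x. inverse (f x)) has_derivative
        (\<lambda>v. (- 1) * (inverse (f x) * frechet_derivative f (at x) v * inverse (f x)))) (at x)"
      if "x \<in> S" for x
    proof -
      have "(f has_derivative frechet_derivative f (at x)) (at x)"
        using Suc.prems that by (simp add: frechet_derivative_works)
      from Deriv.has_derivative_inverse[OF assms(2)[OF that] this] show ?thesis by simp
    qed
    show "Ck_on k S (\<lambda>x. (- 1) * (inverse (f x) * frechet_derivative f (at x) v * inverse (f x)))" for v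
      using Suc.prems by (intro Ck_on_mult[OF assms(1)] Ck_on_const inv) simp
  qed
qed

section \<open>Symmetry of second derivatives\<close>

lemma second_difference_mean_value:
  fixes f :: "'a::real_normed_vector \<Rightarrow> real"
  assumes S: "ball x e \<subseteq> S" and f: "Ck_on (Suc (Suc 0)) S f"
    and t: "0 < t" "t * (norm v + norm w) < e"
  shows "\<exists>y. dist x y < t * (norm v + norm w) + t \<and> y \<in> S \<and>
    f (x + t *\<^sub>R v + t *\<^sub>R w) - f (x + t *\<^sub>R v) - f (x + t *\<^sub>R w) + f x =
      t * (t * frechet_derivative (\<lambda>y. frechet_derivative f (at y) v) (at y) w)"
proof -
  have bound: "norm (s *\<^sub>R v + r *\<^sub>R w) \<le> t * (norm v + norm w)"
    if "0 \<le> s" "s \<le> t" "0 \<le> r" "r \<le> t" for s r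
  proof -
    have "norm (s *\<^sub>R v + r *\<^sub>R w) \<le> s * norm v + r * norm w"
      using norm_triangle_ineq[of "s *\<^sub>R v" "r *\<^sub>R w"] that by simp
    also have "\<dots> \<le> t * norm v + t * norm w"
      using that by (intro add_mono mult_right_mono) auto
    finally show ?thesis by (simp add: algebra_simps)
  qed
  have inS: "x + s *\<^sub>R v + r *\<^sub>R w \<in> S" if "0 \<le> s" "s \<le> t" "0 \<le> r" "r \<le> t" for s r
  proof -
    have "dist x (x + s *\<^sub>R v + r *\<^sub>R w) = norm (s *\<^sub>R v + r *\<^sub>R w)"
      by (metis add.assoc add_diff_cancel_left' dist_commute dist_norm)
    then show ?thesis using bound[OF that] t S by (auto simp: subset_eq)
  qed
  have D: "(f has_derivative frechet_derivative f (at y)) (at y)" if "y \<in> S" for y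
    using f that by (simp add: frechet_derivative_works)
  define g where "g y = frechet_derivative f (at y) v" for y
  have D2: "(g has_derivative frechet_derivative g (at y)) (at y)" if "y \<in> S" for y
    using f that unfolding g_def by (simp add: frechet_derivative_works)
  \<comment> \<open>The second difference is \<open>\<phi> t - \<phi> 0\<close>, to which the mean
    value theorem is applied, first in the direction \<open>v\<close> and then in the direction
    \<open>w\<close>. The idle summand \<open>0 *\<^sub>R w\<close> makes both terms instances of
    \<open>line\<close>.\<close>
  define \<phi> where "\<phi> s = f (x + s *\<^sub>R v + t *\<^sub>R w) - f (x + s *\<^sub>R v + 0 *\<^sub>R w)" for s
  have line: "((\<lambda>s. f (x + s *\<^sub>R v + r *\<^sub>R w)) has_real_derivative g (x + s *\<^sub>R v + r *\<^sub>R w)) (at s)"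
    if "0 \<le> s" "s \<le> t" "0 \<le> r" "r \<le> t" for s r
  proof -
    let ?y = "x + s *\<^sub>R v + r *\<^sub>R w"
    have "((\<lambda>s. x + s *\<^sub>R v + r *\<^sub>R w) has_derivative (\<lambda>h. h *\<^sub>R v)) (at s)"
      by (auto intro!: derivative_eq_intros)
    from diff_chain_at[OF this D[OF inS[OF that]]]
    have "((\<lambda>s. f (x + s *\<^sub>R v + r *\<^sub>R w)) has_derivative (\<lambda>h. frechet_derivative f (at ?y) (h *\<^sub>R v))) (at s)"
      by (simp add: o_def)
    moreover have "frechet_derivative f (at ?y) (h *\<^sub>R v) = g ?y * h" for h
      using linear_scale[OF has_derivative_linear[OF D[OF inS[OF that]]], of h v] by (simp add: g_def)
    ultimately show ?thesis by (simp add: has_field_derivative_def)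
  qed
  have line2: "((\<lambda>r. g (x + s *\<^sub>R v + r *\<^sub>R w)) has_real_derivative
      frechet_derivative g (at (x + s *\<^sub>R v + r *\<^sub>R w)) w) (at r)"
    if "0 \<le> s" "s \<le> t" "0 \<le> r" "r \<le> t" for s r
  proof -
    let ?y = "x + s *\<^sub>R v + r *\<^sub>R w"
    have "((\<lambda>r. x + s *\<^sub>R v + r *\<^sub>R w) has_derivative (\<lambda>h. h *\<^sub>R w)) (at r)"
      by (auto intro!: derivative_eq_intros)
    from diff_chain_at[OF this D2[OF inS[OF that]]]
    have "((\<lambda>r. g (x + s *\<^sub>R v + r *\<^sub>R w)) has_derivative (\<lambda>h. frechet_derivative g (at ?y) (h *\<^sub>R w))) (at r)"
      by (simp add: o_def)
    moreover have "frechet_derivative g (at ?y) (h *\<^sub>R w) = frechet_derivative g (at ?y) w * h" for h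
      using linear_scale[OF has_derivative_linear[OF D2[OF inS[OF that]]], of h w] by simp
    ultimately show ?thesis by (simp add: has_field_derivative_def)
  qed
  obtain s where s: "0 < s" "s < t"
    "\<phi> t - \<phi> 0 = (t - 0) * (g (x + s *\<^sub>R v + t *\<^sub>R w) - g (x + s *\<^sub>R v + 0 *\<^sub>R w))"
    using MVT2[OF t(1), of \<phi> "\<lambda>s. g (x + s *\<^sub>R v + t *\<^sub>R w) - g (x + s *\<^sub>R v + 0 *\<^sub>R w)"]
      line t(1) unfolding \<phi>_def by (force intro!: DERIV_diff)
  obtain r where r: "0 < r" "r < t"
    "g (x + s *\<^sub>R v + t *\<^sub>R w) - g (x + s *\<^sub>R v + 0 *\<^sub>R w) =
       (t - 0) * frechet_derivative g (at (x + s *\<^sub>R v + r *\<^sub>R w)) w"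
    using MVT2[OF t(1), of "\<lambda>r. g (x + s *\<^sub>R v + r *\<^sub>R w)"
        "\<lambda>r. frechet_derivative g (at (x + s *\<^sub>R v + r *\<^sub>R w)) w"] line2 s by force
  let ?y = "x + s *\<^sub>R v + r *\<^sub>R w"
  have "dist x ?y = norm (s *\<^sub>R v + r *\<^sub>R w)"
    by (metis add.assoc add_diff_cancel_left' dist_commute dist_norm)
  \<comment> \<open>The additional \<open>t\<close> in the bound makes it strict even if both
    vectors are 0.\<close>
  then have "dist x ?y < t * (norm v + norm w) + t"
    using bound[of s r] s r t(1) by linarith
  moreover have "?y \<in> S" using inS s r by simp
  moreover have "f (x + t *\<^sub>R v + t *\<^sub>R w) - f (x + t *\<^sub>R v) - f (x + t *\<^sub>R w) + f x = \<phi> t - \<phi> 0"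
    by (simp add: \<phi>_def)
  ultimately show ?thesis using s(3) r(3) unfolding g_def by auto
qed

text \<open>The second difference is symmetric in \<open>v\<close> and \<open>w\<close>, and for
  small \<open>t\<close> it is \<open>t * t\<close> times either mixed derivative at some point near
  \<open>x\<close>. Continuity of both mixed derivatives then forces them to agree at
  \<open>x\<close>.\<close>

lemma frechet_derivative_commute_real:
  fixes f :: "'a::real_normed_vector \<Rightarrow> real"
  assumes S: "open S" "x \<in> S" and f: "Ck_on (Suc (Suc 0)) S f"
  shows "frechet_derivative (\<lambda>y. frechet_derivative f (at y) v) (at x) w =
         frechet_derivative (\<lambda>y. frechet_derivative f (at y) w) (at x) v"
proof -
  define G where "G v w y = frechet_derivative (\<lambda>y. frechet_derivative f (at y) v) (at y) w" for v w y
  have "continuous_on S (G v w)" for v w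
    using f unfolding G_def by simp
  then have cont: "isCont (G v w) x" for v w
    using S by (simp add: continuous_on_eq_continuous_at)
  have "\<bar>G v w x - G w v x\<bar> < \<epsilon> + \<epsilon>" if \<epsilon>: "\<epsilon> > 0" for \<epsilon>
  proof -
    obtain d1 where d1: "d1 > 0" "\<And>y. dist y x < d1 \<Longrightarrow> dist (G v w y) (G v w x) < \<epsilon>"
      using cont[of v w] \<epsilon> unfolding continuous_at_eps_delta by metis
    obtain d2 where d2: "d2 > 0" "\<And>y. dist y x < d2 \<Longrightarrow> dist (G w v y) (G w v x) < \<epsilon>"
      using cont[of w v] \<epsilon> unfolding continuous_at_eps_delta by metis
    obtain e where e: "e > 0" "ball x e \<subseteq> S" using S openE by blast
    \<comment> \<open>The summand 1 absorbs the additional \<open>t\<close> in the bound on the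
      distance and keeps \<open>M\<close> positive if both vectors are 0.\<close>
    define M where "M = norm v + norm w + 1"
    define d where "d = min e (min d1 d2)"
    define t where "t = d / (2 * M)"
    have M: "M > 0" using norm_ge_zero[of v] norm_ge_zero[of w] unfolding M_def by linarith
    have d: "d > 0" using d1 d2 e by (simp add: d_def)
    have t: "t > 0" using d M by (simp add: t_def)
    have tM: "t * (norm v + norm w) + t < d"
    proof -
      have "t * (norm v + norm w) + t = t * M" by (simp add: M_def algebra_simps)
      also have "\<dots> = d / 2" using M by (simp add: t_def)
      finally show ?thesis using d by simp
    qed
    then have te: "t * (norm v + norm w) < e" using t by (simp add: d_def)
    obtain y where y: "dist x y < d"
      "f (x + t *\<^sub>R v + t *\<^sub>R w) - f (x + t *\<^sub>R v) - f (x + t *\<^sub>R w) + f x = t * (t * G v w y)"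
      using second_difference_mean_value[OF e(2) f t te] order.strict_trans[OF _ tM]
      unfolding G_def by metis
    have te': "t * (norm w + norm v) < e" and tM': "t * (norm w + norm v) + t < d"
      using te tM by (simp_all add: add.commute)
    obtain z where z: "dist x z < d"
      "f (x + t *\<^sub>R w + t *\<^sub>R v) - f (x + t *\<^sub>R w) - f (x + t *\<^sub>R v) + f x = t * (t * G w v z)"
      using second_difference_mean_value[OF e(2) f t te'] order.strict_trans[OF _ tM']
      unfolding G_def by metis
    have "t * (t * G v w y) = t * (t * G w v z)"
      using y(2) z(2) by (smt (verit) add.assoc add.commute)
    then have "G v w y = G w v z" using t by simp
    moreover have "dist (G v w y) (G v w x) < \<epsilon>" "dist (G w v z) (G w v x) < \<epsilon>"
      using y(1) z(1) d1(2)[of y] d2(2)[of z] by (simp_all add: d_def dist_commute)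
    ultimately show ?thesis by (simp add: dist_real_def)
  qed
  \<comment> \<open>For this \<epsilon> the estimate would say that a positive number is less than
    itself.\<close>
  from this[of "\<bar>G v w x - G w v x\<bar> / 2"] show ?thesis by (auto simp: G_def)
qed

text \<open>The mean value theorem is about real functions, hence the passage to real and imaginary
  parts; \<open>lin\<close> pulls a real linear functional out of both derivatives.\<close>

lemma frechet_derivative_commute:
  fixes f :: "'a::real_normed_vector \<Rightarrow> complex"
  assumes S: "open S" "x \<in> S" and f: "Ck_on (Suc (Suc 0)) S f"
  shows "frechet_derivative (\<lambda>y. frechet_derivative f (at y) v) (at x) w =
         frechet_derivative (\<lambda>y. frechet_derivative f (at y) w) (at x) v"
proof -
  have lin: "frechet_derivative (\<lambda>y. frechet_derivative (\<lambda>y. h (f y)) (at y) v) (at x) w =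
      h (frechet_derivative (\<lambda>y. frechet_derivative f (at y) v) (at x) w)"
    if h: "bounded_linear h" for h :: "complex \<Rightarrow> real" and v w
  proof -
    have chain: "frechet_derivative (\<lambda>y. h (g y)) (at y) = (\<lambda>v. h (frechet_derivative g (at y) v))"
      if "g differentiable (at y)" for g :: "'a \<Rightarrow> complex" and y
      using that by (intro frechet_derivative_eqI bounded_linear.has_derivative[OF h])
        (simp add: frechet_derivative_works)
    have "frechet_derivative (\<lambda>y. frechet_derivative (\<lambda>y. h (f y)) (at y) v) (at x) =
        frechet_derivative (\<lambda>y. h (frechet_derivative f (at y) v)) (at x)"
      by (rule frechet_derivative_cong_open[OF S]) (use f chain in simp)
    also have "\<dots> = (\<lambda>w. h (frechet_derivative (\<lambda>y. frechet_derivative f (at y) v) (at x) w))"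
      using f S by (intro chain) simp
    finally show ?thesis by simp
  qed
  have "Re (frechet_derivative (\<lambda>y. frechet_derivative f (at y) v) (at x) w) =
        Re (frechet_derivative (\<lambda>y. frechet_derivative f (at y) w) (at x) v)"
    using frechet_derivative_commute_real[OF S Ck_on_bounded_linear[OF S(1) bounded_linear_Re f], of v w]
    by (simp only: lin[OF bounded_linear_Re])
  moreover have "Im (frechet_derivative (\<lambda>y. frechet_derivative f (at y) v) (at x) w) =
        Im (frechet_derivative (\<lambda>y. frechet_derivative f (at y) w) (at x) v)"
    using frechet_derivative_commute_real[OF S Ck_on_bounded_linear[OF S(1) bounded_linear_Im f], of v w]
    by (simp only: lin[OF bounded_linear_Im])
  ultimately show ?thesis by (rule complex_eqI)
qed


text \<open>The functions \<open>p(1/t) exp(-1/t)\<close>, extended by 0 to \<open>t \<le> 0\<close>, form a family closed under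
  differentiation, so \<open>exp(-1/t)\<close> extends smoothly.\<close>

definition flat_exp :: "real poly \<Rightarrow> real \<Rightarrow> real" where
  "flat_exp p t = (if t > 0 then poly p (1 / t) * exp (- (1 / t)) else 0)"

lemma flat_exp_tendsto_0: "(flat_exp p \<longlongrightarrow> 0) (at_right 0)"
proof -
  have "((\<lambda>x::real. \<Sum>i\<le>degree p. coeff p i * (x ^ i / exp x)) \<longlongrightarrow> (\<Sum>i\<le>degree p. coeff p i * 0)) at_top"
    by (intro tendsto_sum tendsto_mult tendsto_const tendsto_power_div_exp_0)
  then have "((\<lambda>x. poly p x * exp (- x)) \<longlongrightarrow> 0) at_top"
    by (simp add: poly_altdef sum_distrib_left exp_minus divide_inverse mult_ac)
  from filterlim_compose[OF this filterlim_inverse_at_top_right]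
  have "((\<lambda>t. poly p (1 / t) * exp (- (1 / t))) \<longlongrightarrow> 0) (at_right 0)"
    by (simp add: inverse_eq_divide)
  moreover have "\<forall>\<^sub>F t in at_right 0. poly p (1 / t) * exp (- (1 / t)) = flat_exp p t"
    by (rule eventually_at_rightI[of 0 1]) (auto simp: flat_exp_def)
  ultimately show ?thesis by (rule Lim_transform_eventually)
qed

text \<open>The factor \<open>[:0, 0, 1:]\<close> is the \<open>1 / t^2\<close> in the derivative of
  \<open>1 / t\<close>; the polynomial factor contributes \<open>- pderiv p\<close> and the
  exponential \<open>p\<close>.\<close>

lemma flat_exp_has_derivative:
  "(flat_exp p has_real_derivative flat_exp ([:0, 0, 1:] * (p - pderiv p)) t) (at t)"
proof (cases t "0::real" rule: linorder_cases)
  case less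
  have "((\<lambda>t. 0) has_real_derivative 0) (at t)" by simp
  then have "(flat_exp p has_real_derivative 0) (at t)"
    by (rule has_field_derivative_transform_within_open[of _ _ _ "{..<0}"])
       (use less in \<open>auto simp: flat_exp_def\<close>)
  then show ?thesis using less by (simp add: flat_exp_def)
next
  case greater
  have "((\<lambda>t. poly p (1 / t) * exp (- (1 / t))) has_real_derivative
      poly (pderiv p) (1 / t) * (- (1 / (t * t))) * exp (- (1 / t)) +
      exp (- (1 / t)) * (1 / (t * t)) * poly p (1 / t)) (at t)"
    using greater
    by (auto intro!: derivative_eq_intros DERIV_chain2[OF poly_DERIV]
        simp: divide_simps power2_eq_square)
  moreover have "poly (pderiv p) (1 / t) * (- (1 / (t * t))) * exp (- (1 / t)) +
      exp (- (1 / t)) * (1 / (t * t)) * poly p (1 / t) = flat_exp ([:0, 0, 1:] * (p - pderiv p)) t"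
    using greater by (simp add: flat_exp_def algebra_simps)
  ultimately have "((\<lambda>t. poly p (1 / t) * exp (- (1 / t))) has_real_derivative
      flat_exp ([:0, 0, 1:] * (p - pderiv p)) t) (at t)" by simp
  then show ?thesis
    by (rule has_field_derivative_transform_within_open[of _ _ _ "{0<..}"])
       (use greater in \<open>auto simp: flat_exp_def\<close>)
next
  case equal
  \<comment> \<open>Division by \<open>h\<close> multiplies by \<open>1 / h\<close>, so for positive
    \<open>h\<close> the difference quotient is again a flat function, with polynomial
    \<open>[:0, 1:] * p\<close>.\<close>
  have "((\<lambda>h. flat_exp p h / h) \<longlongrightarrow> 0) (at_right 0)"
  proof (rule Lim_transform_eventually[OF flat_exp_tendsto_0[of "[:0, 1:] * p"]])
    show "\<forall>\<^sub>F t in at_right 0. flat_exp ([:0, 1:] * p) t = flat_exp p t / t"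
      by (rule eventually_at_rightI[of 0 1]) (auto simp: flat_exp_def)
  qed
  moreover have "((\<lambda>h. flat_exp p h / h) \<longlongrightarrow> 0) (at_left 0)"
  proof (rule Lim_transform_eventually[OF tendsto_const[of 0]])
    show "\<forall>\<^sub>F t in at_left 0. 0 = flat_exp p t / t"
      by (rule eventually_at_leftI[of "-1" 0]) (auto simp: flat_exp_def)
  qed
  ultimately have "((\<lambda>h. flat_exp p h / h) \<longlongrightarrow> 0) (at 0)"
    by (simp add: filterlim_at_split)
  then show ?thesis using equal
    by (simp add: has_field_derivative_iff flat_exp_def)
qed

text \<open>The induction has to cover all \<open>p\<close> at once, since differentiation changes
  the polynomial. Argument and value are embedded in the complex numbers so that the product rule of
  \<open>Ck_on\<close> for complex functions is available.\<close>

lemma Ck_on_flat_exp: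
  fixes u :: "'a::real_normed_vector \<Rightarrow> complex"
  assumes "open S" "\<And>k. Ck_on k S u"
  shows "Ck_on k S (\<lambda>x. complex_of_real (flat_exp p (Re (u x))))"
proof -
  have "(flat_exp p has_derivative (\<lambda>h. flat_exp ([:0, 0, 1:] * (p - pderiv p)) t * h)) (at t)" for p t
    using flat_exp_has_derivative[of p t] by (simp add: has_field_derivative_def)
  moreover have "(u has_derivative frechet_derivative u (at x)) (at x)" if "x \<in> S" for x
    using assms(2)[of "Suc 0"] that by (simp add: frechet_derivative_works)
  ultimately have der: "((\<lambda>x. complex_of_real (flat_exp p (Re (u x)))) has_derivative
      (\<lambda>v. complex_of_real (flat_exp ([:0, 0, 1:] * (p - pderiv p)) (Re (u x)))
         * complex_of_real (Re (frechet_derivative u (at x) v)))) (at x)" if "x \<in> S" for x p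
    unfolding of_real_mult[symmetric] using that
    by (intro bounded_linear.has_derivative[OF bounded_linear_of_real]
        has_derivative_compose[of "\<lambda>x. Re (u x)" _ x UNIV "flat_exp p"]
        bounded_linear.has_derivative[OF bounded_linear_Re]) blast+
  show ?thesis
  proof (induction k arbitrary: p)
    case 0
    have "isCont (\<lambda>x. complex_of_real (flat_exp p (Re (u x)))) x" if "x \<in> S" for x
      using has_derivative_continuous[OF der[OF that]] .
    then show ?case unfolding Ck_on.simps by (blast intro: continuous_at_imp_continuous_on)
  next
    case (Suc k)
    have "Ck_on k S (\<lambda>x. complex_of_real (Re (frechet_derivative u (at x) v)))" for v
      using assms(2)[of "Suc k"]
      by (intro Ck_on_bounded_linear[OF assms(1) bounded_linear_of_real]
          Ck_on_bounded_linear[OF assms(1) bounded_linear_Re]) simp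
    then show ?case
      by (intro Ck_on_SucI[OF assms(1) der] Ck_on_mult[OF assms(1)] Suc.IH)
  qed
qed


section \<open>Homotopies of differential graded modules\<close>

lemma graded_homD:
  assumes "graded_hom R M N n f"
  shows "x \<in> carrier M \<Longrightarrow> f x \<in> carrier N"
    and "x \<in> carrier M \<Longrightarrow> y \<in> carrier M \<Longrightarrow> f (x \<oplus>\<^bsub>M\<^esub> y) = f x \<oplus>\<^bsub>N\<^esub> f y"
    and "r \<in> carrier R \<Longrightarrow> x \<in> carrier M \<Longrightarrow> f (r \<odot>\<^bsub>M\<^esub> x) = r \<odot>\<^bsub>N\<^esub> f x"
    and "x \<in> grade M k \<Longrightarrow> f x \<in> grade N (k + n)"
  using assms unfolding graded_hom_def by blast+

lemma is_dg_moduleD: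
  assumes "is_dg_module R M"
  shows "Module.module R M" "submodule (grade M k) R M" "grade M k \<subseteq> carrier M"
    "graded_hom R M M 1 (differential M)"
    "x \<in> carrier M \<Longrightarrow> differential M (differential M x) = \<zero>\<^bsub>M\<^esub>"
    "x \<in> grade M k \<Longrightarrow> y \<in> grade M k \<Longrightarrow> x \<oplus>\<^bsub>M\<^esub> y \<in> grade M k"
proof -
  show *: "Module.module R M" "submodule (grade M k) R M" for k
    using assms by (auto simp: is_dg_module_def is_graded_module_def)
  show "graded_hom R M M 1 (differential M)"
    "x \<in> carrier M \<Longrightarrow> differential M (differential M x) = \<zero>\<^bsub>M\<^esub>"
    using assms by (auto simp: is_dg_module_def)
  interpret submodule "grade M k" R M by (rule *)
  show "grade M k \<subseteq> carrier M" using subset by simp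
  show "x \<in> grade M k \<Longrightarrow> y \<in> grade M k \<Longrightarrow> x \<oplus>\<^bsub>M\<^esub> y \<in> grade M k"
    using m_closed by simp
qed

lemma graded_hom_zero:
  assumes "Module.module R M" "Module.module R N" "graded_hom R M N n f"
  shows "f \<zero>\<^bsub>M\<^esub> = \<zero>\<^bsub>N\<^esub>"
proof -
  interpret M: Module.module R M by (rule assms)
  interpret N: Module.module R N by (rule assms)
  have f0: "f \<zero>\<^bsub>M\<^esub> \<in> carrier N" by (rule graded_homD(1)[OF assms(3)]) simp
  have "f (\<zero>\<^bsub>M\<^esub> \<oplus>\<^bsub>M\<^esub> \<zero>\<^bsub>M\<^esub>) = f \<zero>\<^bsub>M\<^esub> \<oplus>\<^bsub>N\<^esub> f \<zero>\<^bsub>M\<^esub>"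
    by (rule graded_homD(2)[OF assms(3)]) simp_all
  then show ?thesis using f0 by (metis M.zero_closed M.r_zero N.add.r_cancel_one')
qed

lemma graded_hom_add:
  assumes "is_dg_module R M" "is_dg_module R N"
    "graded_hom R M N n f" "graded_hom R M N n g"
  shows "graded_hom R M N n (\<lambda>x. f x \<oplus>\<^bsub>N\<^esub> g x)"
proof -
  interpret N: Module.module R N by (rule is_dg_moduleD(1)[OF assms(2)])
  note f = graded_homD[OF assms(3)] and g = graded_homD[OF assms(4)]
  show ?thesis unfolding graded_hom_def
    using f g is_dg_moduleD(6)[OF assms(2)]
    by (auto simp: N.smult_r_distr N.add.m_ac)
qed

lemma graded_hom_comp:
  assumes "graded_hom R M N m f" "graded_hom R N P n g"
  shows "graded_hom R M P (m + n) (\<lambda>x. g (f x))"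
  using graded_homD[OF assms(1)] graded_homD[OF assms(2)]
  unfolding graded_hom_def by (auto simp flip: add.assoc)

lemma graded_hom_ident: "graded_hom R M M 0 (\<lambda>x. x)"
  by (simp add: graded_hom_def)

text \<open>Stated for an abstract module, as it is applied with the same \<open>V\<close> to all
  forms and to those of compact support.\<close>

lemma homotopy_perturbation:
  assumes M: "is_dg_module R M" and V: "graded_hom R M M (- 1) V"
  defines "L \<equiv> \<lambda>x. x \<oplus>\<^bsub>M\<^esub> (differential M (V x) \<oplus>\<^bsub>M\<^esub> V (differential M x))"
  shows "dg_morphism R M M (L ^^ n)" "dg_homotopic R M M (L ^^ n) id"
proof -
  interpret M: Module.module R M by (rule is_dg_moduleD(1)[OF M])
  note D = is_dg_moduleD(4)[OF M]
  note d = graded_homD[OF D] and v = graded_homD[OF V]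
  have d0: "differential M \<zero>\<^bsub>M\<^esub> = \<zero>\<^bsub>M\<^esub>" and v0: "V \<zero>\<^bsub>M\<^esub> = \<zero>\<^bsub>M\<^esub>"
    using graded_hom_zero[OF M.module_axioms M.module_axioms] D V by blast+
  have L: "graded_hom R M M 0 L"
    unfolding L_def
    by (rule graded_hom_add[OF M M graded_hom_ident graded_hom_add[OF M M]])
       (use graded_hom_comp[OF V D] graded_hom_comp[OF D V] in simp_all)
  note l = graded_homD[OF L]
  \<comment> \<open>As the differential \<open>d\<close> squares to zero, composing the
    anticommutator \<open>d V + V d\<close> with \<open>d\<close> on either side leaves
    \<open>d V d\<close>.\<close>
  have dL: "L (differential M x) = differential M (L x)" if "x \<in> carrier M" for x
    unfolding L_def using that by (simp add: d v is_dg_moduleD(5)[OF M] v0)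
  have Ln: "graded_hom R M M 0 (L ^^ n)" for n
  proof (induction n)
    case 0
    then show ?case by (simp add: graded_hom_def)
  next
    case (Suc n)
    show ?case using graded_hom_comp[OF Suc L] by (simp add: o_def)
  qed
  have dLn: "(L ^^ n) (differential M x) = differential M ((L ^^ n) x)" if "x \<in> carrier M" for x n
    using that by (induction n) (simp_all add: dL graded_homD(1)[OF Ln])
  show "dg_morphism R M M (L ^^ n)"
    unfolding dg_morphism_def using M Ln dLn by blast
  show "dg_homotopic R M M (L ^^ n) id"
  proof (induction n)
    case 0
    have "graded_hom R M M (- 1) (\<lambda>x. \<zero>\<^bsub>M\<^esub>)"
      unfolding graded_hom_def
      using subgroup.one_closed[OF submodule.axioms(1)[OF is_dg_moduleD(2)[OF M]]] by simp
    then show ?case unfolding dg_homotopic_def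
      by (intro exI[of _ "\<lambda>x. \<zero>\<^bsub>M\<^esub>"]) (simp add: d0 M.minus_eq M.r_neg)
  next
    case (Suc n)
    then obtain h where h: "graded_hom R M M (- 1) h"
      and eq: "\<And>x. x \<in> carrier M \<Longrightarrow> (L ^^ n) x \<ominus>\<^bsub>M\<^esub> x = differential M (h x) \<oplus>\<^bsub>M\<^esub> h (differential M x)"
      unfolding dg_homotopic_def by auto
    \<comment> \<open>Telescoping: \<open>L^(n+1) - 1 = (L - 1) L^n + (L^n - 1)\<close>, where
      \<open>L - 1\<close> has the homotopy \<open>V\<close> and \<open>L^n\<close> commutes with
      the differential.\<close>
    let ?h = "\<lambda>x. V ((L ^^ n) x) \<oplus>\<^bsub>M\<^esub> h x"
    have "graded_hom R M M (- 1) ?h"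
      using graded_hom_add[OF M M graded_hom_comp[OF Ln V, simplified] h] by simp
    moreover have "(L ^^ Suc n) x \<ominus>\<^bsub>M\<^esub> x = differential M (?h x) \<oplus>\<^bsub>M\<^esub> ?h (differential M x)"
      if x: "x \<in> carrier M" for x
    proof -
      let ?y = "(L ^^ n) x"
      have y: "?y \<in> carrier M" by (rule graded_homD(1)[OF Ln x])
      have "(L ^^ Suc n) x \<ominus>\<^bsub>M\<^esub> x =
          (differential M (V ?y) \<oplus>\<^bsub>M\<^esub> V (differential M ?y)) \<oplus>\<^bsub>M\<^esub> (?y \<ominus>\<^bsub>M\<^esub> x)"
        using x y by (simp add: L_def d v M.minus_eq M.add.m_ac)
      also have "\<dots> = differential M (?h x) \<oplus>\<^bsub>M\<^esub> ?h (differential M x)"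
        using x y by (simp add: eq dLn d v graded_homD[OF h] M.add.m_ac)
      finally show ?thesis .
    qed
    ultimately show ?case unfolding dg_homotopic_def by auto
  qed
qed

section \<open>Passage to cohomology\<close>

lemma coboundaries_subset:
  assumes "is_dg_module R M"
  shows "coboundaries M k \<subseteq> grade M k"
  using graded_homD(4)[OF is_dg_moduleD(4)[OF assms], of _ "k - 1"]
  by (auto simp: coboundaries_def)

lemma coboundaries_subgroup:
  assumes M: "is_dg_module R M"
  shows "subgroup (coboundaries M k) (add_monoid M)"
proof -
  interpret M: Module.module R M by (rule is_dg_moduleD(1)[OF M])
  note D = is_dg_moduleD(4)[OF M]
  note d = graded_homD[OF D]
  interpret G: submodule "grade M (k - 1)" R M by (rule is_dg_moduleD(2)[OF M])
  have sub: "x \<in> carrier M" if "x \<in> grade M l" for x l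
    using is_dg_moduleD(3)[OF M] that by blast
  show ?thesis
  proof (rule M.add.subgroupI)
    show "coboundaries M k \<subseteq> carrier M"
      using coboundaries_subset[OF M] sub by blast
    show "coboundaries M k \<noteq> {}"
      using G.one_closed by (auto simp: coboundaries_def)
  next
    fix a assume "a \<in> coboundaries M k"
    then obtain x where x: "x \<in> grade M (k - 1)" "a = differential M x"
      by (auto simp: coboundaries_def)
    have nx: "\<ominus>\<^bsub>M\<^esub> x \<in> grade M (k - 1)"
      using G.m_inv_closed[OF x(1)] unfolding a_inv_def .
    have "differential M (x \<oplus>\<^bsub>M\<^esub> (\<ominus>\<^bsub>M\<^esub> x)) = differential M x \<oplus>\<^bsub>M\<^esub> differential M (\<ominus>\<^bsub>M\<^esub> x)"
      using x nx sub by (intro d(2)) auto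
    moreover have "differential M \<zero>\<^bsub>M\<^esub> = \<zero>\<^bsub>M\<^esub>"
      using graded_hom_zero[OF M.module_axioms M.module_axioms D] .
    ultimately have "differential M (\<ominus>\<^bsub>M\<^esub> x) = \<ominus>\<^bsub>M\<^esub> a"
      using x(1) nx by (metis sub x(2) d(1) M.add.inv_closed M.minus_equality M.r_neg M.a_comm)
    then show "\<ominus>\<^bsub>M\<^esub> a \<in> coboundaries M k"
      using nx by (force simp: coboundaries_def)
  next
    fix a b assume "a \<in> coboundaries M k" "b \<in> coboundaries M k"
    then obtain x y where xy: "x \<in> grade M (k - 1)" "a = differential M x"
        "y \<in> grade M (k - 1)" "b = differential M y"
      by (auto simp: coboundaries_def)
    then have "a \<oplus>\<^bsub>M\<^esub> b = differential M (x \<oplus>\<^bsub>M\<^esub> y)" using sub by (simp add: d(2))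
    then show "a \<oplus>\<^bsub>M\<^esub> b \<in> coboundaries M k"
      using is_dg_moduleD(6)[OF M xy(1,3)] by (auto simp: coboundaries_def)
  qed
qed

lemma cohomology_class_eq_iff:
  assumes M: "is_dg_module R M" and "x \<in> carrier M" "y \<in> carrier M"
  shows "coboundaries M k +>\<^bsub>M\<^esub> x = coboundaries M k +>\<^bsub>M\<^esub> y \<longleftrightarrow> x \<ominus>\<^bsub>M\<^esub> y \<in> coboundaries M k"
proof -
  interpret M: Module.module R M by (rule is_dg_moduleD(1)[OF M])
  interpret B: subgroup "coboundaries M k" "add_monoid M" by (rule coboundaries_subgroup[OF M])
  have xy: "x \<in> carrier (add_monoid M)" "y \<in> carrier (add_monoid M)" using assms by auto
  have "x \<in> coboundaries M k +>\<^bsub>M\<^esub> y \<longleftrightarrow> x \<ominus>\<^bsub>M\<^esub> y \<in> coboundaries M k"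
    using B.rcos_module[OF M.add.group_axioms xy(2,1)] by (simp add: a_r_coset_def a_inv_def a_minus_def)
  moreover have "x \<in> coboundaries M k +>\<^bsub>M\<^esub> y \<longleftrightarrow>
      coboundaries M k +>\<^bsub>M\<^esub> x = coboundaries M k +>\<^bsub>M\<^esub> y"
    using M.add.repr_independence[of x "coboundaries M k" y] assms(3) B.subgroup_axioms
      M.add.rcos_self[of x "coboundaries M k"] assms(2) unfolding a_r_coset_def by auto
  ultimately show ?thesis by blast
qed

lemma graded_hom_minus:
  assumes P: "Module.module R P" and Q: "Module.module R Q" and h: "graded_hom R P Q n h"
    and xy: "x \<in> carrier P" "y \<in> carrier P"
  shows "h (x \<ominus>\<^bsub>P\<^esub> y) = h x \<ominus>\<^bsub>Q\<^esub> h y"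
proof -
  interpret P: Module.module R P by (rule P)
  interpret Q: Module.module R Q by (rule Q)
  have "x = (x \<ominus>\<^bsub>P\<^esub> y) \<oplus>\<^bsub>P\<^esub> y" using xy by (simp add: P.minus_eq P.a_assoc P.l_neg)
  then have "h x = h (x \<ominus>\<^bsub>P\<^esub> y) \<oplus>\<^bsub>Q\<^esub> h y"
    using xy graded_homD(2)[OF h] by (metis P.minus_closed)
  then show ?thesis
    using xy graded_homD(1)[OF h] by (simp add: Q.minus_eq Q.a_assoc Q.r_neg)
qed

text \<open>On a cocycle the homotopy formula loses its term
  \<open>h (differential P x)\<close>.\<close>

lemma homotopic_id_coboundary:
  assumes P: "is_dg_module R P" and p: "dg_homotopic R P P p id" and x: "x \<in> cocycles P k"
  shows "p x \<ominus>\<^bsub>P\<^esub> x \<in> coboundaries P k"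
proof -
  interpret P: Module.module R P by (rule is_dg_moduleD(1)[OF P])
  obtain h where h: "graded_hom R P P (- 1) h"
    and eq: "\<And>x. x \<in> carrier P \<Longrightarrow> p x \<ominus>\<^bsub>P\<^esub> x = differential P (h x) \<oplus>\<^bsub>P\<^esub> h (differential P x)"
    using p unfolding dg_homotopic_def by auto
  have xk: "x \<in> grade P k" "differential P x = \<zero>\<^bsub>P\<^esub>" using x by (auto simp: cocycles_def)
  have xc: "x \<in> carrier P" using is_dg_moduleD(3)[OF P] xk by blast
  have "differential P (h x) \<in> carrier P"
    using xc graded_homD(1)[OF h] graded_homD(1)[OF is_dg_moduleD(4)[OF P]] by blast
  then have "p x \<ominus>\<^bsub>P\<^esub> x = differential P (h x)"
    using eq[OF xc] xk(2) graded_hom_zero[OF P.module_axioms P.module_axioms h] by simp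
  moreover have "h x \<in> grade P (k - 1)" using graded_homD(4)[OF h xk(1)] by simp
  ultimately show ?thesis by (auto simp: coboundaries_def)
qed

lemma dg_morphism_coboundary:
  assumes h: "dg_morphism R P Q h" and x: "x \<in> coboundaries P k"
  shows "h x \<in> coboundaries Q k"
proof -
  have P: "is_dg_module R P" and gh: "graded_hom R P Q 0 h" using h by (auto simp: dg_morphism_def)
  obtain y where y: "y \<in> grade P (k - 1)" "x = differential P y"
    using x by (auto simp: coboundaries_def)
  then have "h x = differential Q (h y)"
    using h is_dg_moduleD(3)[OF P] by (auto simp: dg_morphism_def)
  moreover have "h y \<in> grade Q (k - 1)" using graded_homD(4)[OF gh y(1)] by simp
  ultimately show ?thesis by (auto simp: coboundaries_def)
qed

text \<open>Both composites move a cocycle by a coboundary only, so \<open>g\<close> inverts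
  \<open>f\<close> on classes.\<close>

lemma homotopy_equivalence_imp_quasi_isomorphism:
  assumes "dg_homotopy_equivalence R M N f"
  shows "quasi_isomorphism R M N f"
proof -
  obtain g where f: "dg_morphism R M N f" and g: "dg_morphism R N M g"
    and gf: "dg_homotopic R M M (g \<circ> f) id" and fg: "dg_homotopic R N N (f \<circ> g) id"
    using assms unfolding dg_homotopy_equivalence_def by blast
  have M: "is_dg_module R M" and N: "is_dg_module R N"
    and fh: "graded_hom R M N 0 f" and gh: "graded_hom R N M 0 g"
    and fd: "\<And>x. x \<in> carrier M \<Longrightarrow> f (differential M x) = differential N (f x)"
    and gd: "\<And>x. x \<in> carrier N \<Longrightarrow> g (differential N x) = differential M (g x)"
    using f g unfolding dg_morphism_def by auto
  interpret M: Module.module R M by (rule is_dg_moduleD(1)[OF M])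
  interpret N: Module.module R N by (rule is_dg_moduleD(1)[OF N])
  note cobf = dg_morphism_coboundary[OF f] and cobg = dg_morphism_coboundary[OF g]
  note f = graded_homD[OF fh] and g = graded_homD[OF gh]
  have subM: "x \<in> carrier M" if "x \<in> grade M k" for x k
    using is_dg_moduleD(3)[OF M] that by blast
  have subN: "x \<in> carrier N" if "x \<in> grade N k" for x k
    using is_dg_moduleD(3)[OF N] that by blast
  \<comment> \<open>The union in \<open>cohomology_map\<close> collapses, because all
    representatives of a class give the same coset.\<close>
  have map: "cohomology_map N k f (coboundaries M k +>\<^bsub>M\<^esub> x) = coboundaries N k +>\<^bsub>N\<^esub> f x"
    if x: "x \<in> carrier M" for k x
  proof -
    interpret B: subgroup "coboundaries M k" "add_monoid M" by (rule coboundaries_subgroup[OF M])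
    have "coboundaries N k +>\<^bsub>N\<^esub> f y = coboundaries N k +>\<^bsub>N\<^esub> f x"
      if y: "y \<in> coboundaries M k +>\<^bsub>M\<^esub> x" for y
    proof -
      obtain b where b: "b \<in> coboundaries M k" "y = b \<oplus>\<^bsub>M\<^esub> x"
        using y by (auto simp: a_r_coset_def r_coset_def)
      have bc: "b \<in> carrier M" using b B.subset by auto
      have fb: "f b \<in> coboundaries N k" by (rule cobf[OF b(1)])
      have "f y \<ominus>\<^bsub>N\<^esub> f x = f b"
        using b(2) bc x f(1,2) by (simp add: N.minus_eq N.a_assoc N.r_neg)
      then show ?thesis
        using fb b bc x f(1) by (subst cohomology_class_eq_iff[OF N]) auto
    qed
    moreover have "x \<in> coboundaries M k +>\<^bsub>M\<^esub> x"
      using M.add.rcos_self[OF _ B.subgroup_axioms] x by (simp add: a_r_coset_def)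
    ultimately show ?thesis unfolding cohomology_map_def by blast
  qed
  have fz: "f x \<in> cocycles N k" if "x \<in> cocycles M k" for x k
    using that f(4)[of x k] fd[of x] subM[of x k]
      graded_hom_zero[OF M.module_axioms N.module_axioms fh] by (auto simp: cocycles_def)
  have gz: "g x \<in> cocycles M k" if "x \<in> cocycles N k" for x k
    using that g(4)[of x k] gd[of x] subN[of x k]
      graded_hom_zero[OF N.module_axioms M.module_axioms gh] by (auto simp: cocycles_def)
  have cM: "x \<in> carrier M" if "x \<in> cocycles M k" for x k
    using that subM by (auto simp: cocycles_def)
  have cN: "x \<in> carrier N" if "x \<in> cocycles N k" for x k
    using that subN by (auto simp: cocycles_def)
  have "bij_betw (cohomology_map N k f) (cohomology M k) (cohomology N k)" for k
    unfolding bij_betw_def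
  proof (intro conjI)
    show "inj_on (cohomology_map N k f) (cohomology M k)"
    proof (rule inj_onI)
      fix C D assume "C \<in> cohomology M k" "D \<in> cohomology M k"
        and eq: "cohomology_map N k f C = cohomology_map N k f D"
      then obtain x y where x: "x \<in> cocycles M k" "C = coboundaries M k +>\<^bsub>M\<^esub> x"
        and y: "y \<in> cocycles M k" "D = coboundaries M k +>\<^bsub>M\<^esub> y"
        by (auto simp: cohomology_def)
      note xc = cM[OF x(1)] and yc = cM[OF y(1)]
      have "f x \<ominus>\<^bsub>N\<^esub> f y \<in> coboundaries N k"
        using eq xc yc f(1) by (simp add: x(2) y(2) map cohomology_class_eq_iff[OF N])
      then have "g (f x \<ominus>\<^bsub>N\<^esub> f y) \<in> coboundaries M k" by (rule cobg)
      then have "g (f x) \<ominus>\<^bsub>M\<^esub> g (f y) \<in> coboundaries M k"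
        using graded_hom_minus[OF N.module_axioms M.module_axioms gh] xc yc f(1) by simp
      then have "coboundaries M k +>\<^bsub>M\<^esub> g (f x) = coboundaries M k +>\<^bsub>M\<^esub> g (f y)"
        using xc yc f(1) g(1) by (simp add: cohomology_class_eq_iff[OF M])
      moreover have "coboundaries M k +>\<^bsub>M\<^esub> g (f z) = coboundaries M k +>\<^bsub>M\<^esub> z"
        if "z \<in> cocycles M k" for z
        using homotopic_id_coboundary[OF M gf that] cM[OF that] f(1) g(1)
        by (simp add: cohomology_class_eq_iff[OF M])
      ultimately show "C = D" using x y by simp
    qed
    show "cohomology_map N k f ` cohomology M k = cohomology N k"
    proof
      show "cohomology_map N k f ` cohomology M k \<subseteq> cohomology N k"
        using fz cM map by (auto simp: cohomology_def)
      show "cohomology N k \<subseteq> cohomology_map N k f ` cohomology M k"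
      proof
        fix D assume "D \<in> cohomology N k"
        then obtain y where y: "y \<in> cocycles N k" "D = coboundaries N k +>\<^bsub>N\<^esub> y"
          by (auto simp: cohomology_def)
        have "coboundaries N k +>\<^bsub>N\<^esub> f (g y) = coboundaries N k +>\<^bsub>N\<^esub> y"
          using homotopic_id_coboundary[OF N fg y(1)] cN[OF y(1)] f(1) g(1)
          by (simp add: cohomology_class_eq_iff[OF N])
        then have "D = cohomology_map N k f (coboundaries M k +>\<^bsub>M\<^esub> g y)"
          using y(2) map[OF cM[OF gz[OF y(1)]]] by simp
        then show "D \<in> cohomology_map N k f ` cohomology M k"
          using gz[OF y(1)] by (auto simp: cohomology_def)
      qed
    qed
  qed
  moreover have "dg_morphism R M N f" by fact
  ultimately show ?thesis unfolding quasi_isomorphism_def by blast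
qed


section \<open>Wirtinger calculus in charts\<close>

lemma has_derivative_vecI:
  fixes f :: "'a::real_normed_vector \<Rightarrow> ('b::euclidean_space)^'n"
  assumes "\<And>i. ((\<lambda>x. f x $ i) has_derivative (\<lambda>v. D v $ i)) F"
    "F = at x within S"
  shows "(f has_derivative D) F"
  using assms(1) unfolding assms(2)
  by (subst has_derivative_componentwise_within)
     (auto simp: Basis_vec_def inner_axis intro!: has_derivative_inner_left)

locale complex_manifold =
  fixes \<A> :: "('x::t2_space, 'd::finite) chart set"
  assumes atlas: "complex_atlas \<A>"
begin

lemmas open_coord_image = Defs.open_coord_image[OF atlas]
  and coord_inv_coord = Defs.coord_inv_coord[OF atlas]
  and open_overlap = Defs.open_overlap[OF atlas]
  and smooth_inI = Defs.smooth_inI[OF atlas]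
  and smooth_inD = Defs.smooth_inD[OF atlas]
  and smooth_in_del = Defs.smooth_in_del[OF atlas]
  and holo_in_smooth_in = Defs.holo_in_smooth_in[OF atlas]
  and complex_linear_expand = Defs.complex_linear_expand[OF atlas]

lemma chart_exists: "\<exists>c\<in>\<A>. p \<in> fst c"
  using atlas by (auto simp: complex_atlas_def)

lemma open_chart: "c \<in> \<A> \<Longrightarrow> open (fst c)"
  using atlas by (auto simp: complex_atlas_def)

lemma coord_in_image: "p \<in> fst c \<Longrightarrow> snd c p \<in> coord_image c"
  by (auto simp: coord_image_def)

lemma coord_inv_in: "z \<in> coord_image c \<Longrightarrow> coord_inv c z \<in> fst c"
  unfolding coord_image_def coord_inv_def by (rule inv_into_into)

lemma coord_coord_inv: "z \<in> coord_image c \<Longrightarrow> snd c (coord_inv c z) = z"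
  unfolding coord_image_def coord_inv_def by (rule f_inv_into_f)

lemma chart_homeomorphism:
  "c \<in> \<A> \<Longrightarrow> homeomorphism (fst c) (coord_image c) (snd c) (coord_inv c)"
  using atlas by (auto simp: complex_atlas_def)

lemma open_coord_preimage:
  assumes "c \<in> \<A>" "open U"
  shows "open (snd c ` (fst c \<inter> U))"
proof -
  have "openin (top_of_set (fst c)) (fst c \<inter> U)"
    using assms(2) by (rule openin_open_Int)
  from homeomorphism_imp_open_map[OF chart_homeomorphism[OF assms(1)] this] show ?thesis
    using open_coord_image[OF assms(1)] openin_open_trans by blast
qed

lemma smooth_in_const: "c \<in> \<A> \<Longrightarrow> smooth_in c (\<lambda>p. r)"
  by (rule smooth_inI) (intro Ck_on_const)

lemma smooth_in_add:
  "c \<in> \<A> \<Longrightarrow> smooth_in c f \<Longrightarrow> smooth_in c g \<Longrightarrow> smooth_in c (\<lambda>p. f p + g p)"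
  by (rule smooth_inI) (intro Ck_on_add open_coord_image smooth_inD)

lemma smooth_in_diff:
  "c \<in> \<A> \<Longrightarrow> smooth_in c f \<Longrightarrow> smooth_in c g \<Longrightarrow> smooth_in c (\<lambda>p. f p - g p)"
  by (rule smooth_inI) (intro Ck_on_diff open_coord_image smooth_inD)

lemma smooth_in_mult:
  "c \<in> \<A> \<Longrightarrow> smooth_in c f \<Longrightarrow> smooth_in c g \<Longrightarrow> smooth_in c (\<lambda>p. f p * g p)"
  by (rule smooth_inI) (intro Ck_on_mult open_coord_image smooth_inD)

lemma smooth_in_sum:
  "c \<in> \<A> \<Longrightarrow> (\<And>i. i \<in> I \<Longrightarrow> smooth_in c (f i)) \<Longrightarrow> smooth_in c (\<lambda>p. \<Sum>i\<in>I. f i p)"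
  by (rule smooth_inI) (intro Ck_on_sum open_coord_image smooth_inD; auto)

lemma smooth_in_prod:
  "c \<in> \<A> \<Longrightarrow> (\<And>i. i \<in> I \<Longrightarrow> smooth_in c (f i)) \<Longrightarrow> smooth_in c (\<lambda>p. \<Prod>i\<in>I. f i p)"
  by (rule smooth_inI) (intro Ck_on_prod open_coord_image smooth_inD; auto)

lemma smooth_in_cnj: "c \<in> \<A> \<Longrightarrow> smooth_in c f \<Longrightarrow> smooth_in c (\<lambda>p. cnj (f p))"
  by (rule smooth_inI) (intro Ck_on_bounded_linear[OF _ bounded_linear_cnj] open_coord_image smooth_inD)

lemma smooth_in_inverse:
  assumes "c \<in> \<A>" "\<And>p. p \<in> fst c \<Longrightarrow> f p \<noteq> 0" "smooth_in c f"
  shows "smooth_in c (\<lambda>p. inverse (f p))"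
  by (rule smooth_inI) (intro Ck_on_inverse open_coord_image smooth_inD assms coord_inv_in)

lemma smooth_in_cong:
  assumes "c \<in> \<A>" "\<And>p. p \<in> fst c \<Longrightarrow> f p = g p" "smooth_in c f"
  shows "smooth_in c g"
  by (rule smooth_inI, rule Ck_on_cong[OF open_coord_image[OF assms(1)] _ smooth_inD[OF assms(3)]])
     (simp add: assms(2) coord_inv_in)

lemma smooth_in_ext_sum:
  "c \<in> \<A> \<Longrightarrow> (\<And>x C. smooth_in c (f x C)) \<Longrightarrow> smooth_in c (\<lambda>p. ext_sum B (\<lambda>x C. f x C p))"
  by (induction B arbitrary: f) (auto intro: smooth_in_const smooth_in_diff)

text \<open>A pointwise notion, because the coordinates of a second chart and the Jacobian entries
  are under control only on the overlap, where \<open>smooth_in\<close> cannot be used.\<close>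

definition chart_diff :: "('x, 'd) chart \<Rightarrow> ('x \<Rightarrow> complex) \<Rightarrow> 'x \<Rightarrow> bool" where
  "chart_diff c f p \<longleftrightarrow> (\<lambda>z. f (coord_inv c z)) differentiable (at (snd c p))"

lemma chart_diff_derivative:
  "chart_diff c f p \<Longrightarrow>
    ((\<lambda>z. f (coord_inv c z)) has_derivative (\<lambda>v. chart_dir c v f p)) (at (snd c p))"
  by (simp add: chart_diff_def chart_dir_def frechet_derivative_works o_def)

lemma chart_dir_eqI:
  "((\<lambda>z. f (coord_inv c z)) has_derivative D) (at (snd c p)) \<Longrightarrow> chart_dir c v f p = D v"
  by (simp add: chart_dir_def o_def frechet_derivative_eqI)

lemma chart_diffI:
  "((\<lambda>z. f (coord_inv c z)) has_derivative D) (at (snd c p)) \<Longrightarrow> chart_diff c f p"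
  by (auto simp: chart_diff_def differentiable_def)

lemma smooth_in_chart_diff: "smooth_in c f \<Longrightarrow> p \<in> fst c \<Longrightarrow> chart_diff c f p"
  using smooth_inD[of c f "Suc 0"] coord_in_image[of p c] by (simp add: chart_diff_def)

lemma chart_dir_cong:
  assumes "c \<in> \<A>" "p \<in> fst c" "open U" "p \<in> U" "\<And>q. q \<in> fst c \<Longrightarrow> q \<in> U \<Longrightarrow> f q = g q"
  shows "chart_dir c v f p = chart_dir c v g p"
proof -
  have "frechet_derivative (f \<circ> coord_inv c) (at (snd c p)) =
      frechet_derivative (g \<circ> coord_inv c) (at (snd c p))"
    by (rule frechet_derivative_cong_open[OF open_coord_preimage[OF assms(1,3)]])
       (use assms in \<open>auto simp: coord_inv_coord\<close>)
  then show ?thesis by (simp add: chart_dir_def)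
qed

lemma del_cong:
  assumes "c \<in> \<A>" "p \<in> fst c" "open U" "p \<in> U" "\<And>q. q \<in> fst c \<Longrightarrow> q \<in> U \<Longrightarrow> f q = g q"
  shows "del c a f p = del c a g p"
  using chart_dir_cong[OF assms] by (simp add: del_def)

lemma delbar_cong:
  assumes "c \<in> \<A>" "p \<in> fst c" "open U" "p \<in> U" "\<And>q. q \<in> fst c \<Longrightarrow> q \<in> U \<Longrightarrow> f q = g q"
  shows "delbar c a f p = delbar c a g p"
  using chart_dir_cong[OF assms] by (simp add: delbar_def)

lemma chart_diff_const: "chart_diff c (\<lambda>q. r) p"
  by (simp add: chart_diff_def)

lemma chart_diff_add:
  "chart_diff c f p \<Longrightarrow> chart_diff c g p \<Longrightarrow> chart_diff c (\<lambda>q. f q + g q) p"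
  by (simp add: chart_diff_def)

lemma chart_diff_diff:
  "chart_diff c f p \<Longrightarrow> chart_diff c g p \<Longrightarrow> chart_diff c (\<lambda>q. f q - g q) p"
  by (simp add: chart_diff_def)

lemma chart_diff_mult:
  "chart_diff c f p \<Longrightarrow> chart_diff c g p \<Longrightarrow> chart_diff c (\<lambda>q. f q * g q) p"
  by (simp add: chart_diff_def)

lemma chart_diff_sum:
  "(\<And>i. i \<in> I \<Longrightarrow> chart_diff c (f i) p) \<Longrightarrow> chart_diff c (\<lambda>q. \<Sum>i\<in>I. f i q) p"
  by (induction I rule: infinite_finite_induct) (auto intro: chart_diff_const chart_diff_add)

lemma chart_diff_cnj: "chart_diff c f p \<Longrightarrow> chart_diff c (\<lambda>q. cnj (f q)) p"
  using bounded_linear.has_derivative[OF bounded_linear_cnj chart_diff_derivative]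
  by (blast intro: chart_diffI)

lemma chart_dir_const: "chart_dir c v (\<lambda>q. r) p = 0"
  by (rule chart_dir_eqI) simp

lemma chart_dir_add:
  "chart_diff c f p \<Longrightarrow> chart_diff c g p \<Longrightarrow>
    chart_dir c v (\<lambda>q. f q + g q) p = chart_dir c v f p + chart_dir c v g p"
  by (rule chart_dir_eqI) (intro has_derivative_add chart_diff_derivative)

lemma chart_dir_mult:
  assumes "chart_diff c f p" "chart_diff c g p" "p \<in> fst c" "c \<in> \<A>"
  shows "chart_dir c v (\<lambda>q. f q * g q) p = f p * chart_dir c v g p + chart_dir c v f p * g p"
  using chart_dir_eqI[OF has_derivative_mult[OF assms(1,2)[THEN chart_diff_derivative]]] assms(3,4)
  by (simp add: coord_inv_coord)

lemma chart_dir_cnj: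
  "chart_diff c f p \<Longrightarrow> chart_dir c v (\<lambda>q. cnj (f q)) p = cnj (chart_dir c v f p)"
  by (rule chart_dir_eqI)
     (intro bounded_linear.has_derivative[OF bounded_linear_cnj chart_diff_derivative])

lemma delbar_const [simp]: "delbar c a (\<lambda>q. r) p = 0"
  by (simp add: delbar_def chart_dir_const)

lemma del_const [simp]: "del c a (\<lambda>q. r) p = 0"
  by (simp add: del_def chart_dir_const)

lemma delbar_add:
  "chart_diff c f p \<Longrightarrow> chart_diff c g p \<Longrightarrow>
    delbar c a (\<lambda>q. f q + g q) p = delbar c a f p + delbar c a g p"
  by (simp add: delbar_def chart_dir_add field_simps)

lemma delbar_mult:
  "chart_diff c f p \<Longrightarrow> chart_diff c g p \<Longrightarrow> p \<in> fst c \<Longrightarrow> c \<in> \<A> \<Longrightarrow>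
    delbar c a (\<lambda>q. f q * g q) p = f p * delbar c a g p + delbar c a f p * g p"
  by (simp add: delbar_def chart_dir_mult field_simps)

lemma delbar_scale:
  "chart_diff c f p \<Longrightarrow> p \<in> fst c \<Longrightarrow> c \<in> \<A> \<Longrightarrow> delbar c a (\<lambda>q. r * f q) p = r * delbar c a f p"
  by (simp add: delbar_mult chart_diff_const)

lemma delbar_diff:
  "chart_diff c f p \<Longrightarrow> chart_diff c g p \<Longrightarrow> p \<in> fst c \<Longrightarrow> c \<in> \<A> \<Longrightarrow>
    delbar c a (\<lambda>q. f q - g q) p = delbar c a f p - delbar c a g p"
  using delbar_add[of c f p "\<lambda>q. - 1 * g q" a] delbar_scale[of c g p a "-1"]
    chart_diff_mult[OF chart_diff_const, of c g p "-1"]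
  by simp

lemma delbar_sum:
  "(\<And>i. i \<in> I \<Longrightarrow> chart_diff c (f i) p) \<Longrightarrow>
    delbar c a (\<lambda>q. \<Sum>i\<in>I. f i q) p = (\<Sum>i\<in>I. delbar c a (f i) p)"
  by (induction I rule: infinite_finite_induct) (auto simp: delbar_add chart_diff_sum)

lemma delbar_cnj:
  "chart_diff c f p \<Longrightarrow> delbar c a (\<lambda>q. cnj (f q)) p = cnj (del c a f p)"
  by (simp add: delbar_def del_def chart_dir_cnj)

lemma chart_diff_ext_sum:
  "(\<And>x C. chart_diff c (f x C) p) \<Longrightarrow> chart_diff c (\<lambda>q. ext_sum B (\<lambda>x C. f x C q)) p"
  by (induction B arbitrary: f) (auto intro: chart_diff_const chart_diff_diff)

lemma delbar_ext_sum:
  assumes "p \<in> fst c" "c \<in> \<A>"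
  shows "(\<And>x C. chart_diff c (f x C) p) \<Longrightarrow>
    delbar c a (\<lambda>q. ext_sum B (\<lambda>x C. f x C q)) p = ext_sum B (\<lambda>x C. delbar c a (f x C) p)"
  by (induction B arbitrary: f) (auto simp: assms delbar_diff chart_diff_ext_sum)

lemma chart_diff_tensor_change:
  assumes "\<And>x y. chart_diff c (\<lambda>q. M q x y) p"
  shows "(\<And>C. chart_diff c (t C) p) \<Longrightarrow> chart_diff c (\<lambda>q. tensor_change (M q) A (\<lambda>C. t C q)) p"
  by (induction A arbitrary: t) (auto intro!: chart_diff_sum chart_diff_mult assms)

lemma delbar_tensor_change:
  assumes "p \<in> fst c" "c \<in> \<A>" "\<And>x y. chart_diff c (\<lambda>q. M q x y) p"
  shows "(\<And>C. chart_diff c (t C) p) \<Longrightarrow>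
    delbar c a (\<lambda>q. tensor_change (M q) A (\<lambda>C. t C q)) p =
      tensor_change (M p) A (\<lambda>C. delbar c a (t C) p) +
      tensor_change_deriv (M p) (\<lambda>x y. delbar c a (\<lambda>q. M q x y) p) A (\<lambda>C. t C p)"
proof (induction A arbitrary: t)
  case (Cons x A)
  have d: "chart_diff c (\<lambda>q. tensor_change (M q) A (\<lambda>C. t (b # C) q)) p" for b
    by (rule chart_diff_tensor_change[OF assms(3)]) (rule Cons.prems)
  have IH: "delbar c a (\<lambda>q. tensor_change (M q) A (\<lambda>C. t (b # C) q)) p =
      tensor_change (M p) A (\<lambda>C. delbar c a (t (b # C)) p) +
      tensor_change_deriv (M p) (\<lambda>x y. delbar c a (\<lambda>q. M q x y) p) A (\<lambda>C. t (b # C) p)" for b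
    by (rule Cons.IH) (rule Cons.prems)
  show ?case
    by (simp add: delbar_sum delbar_mult chart_diff_mult assms d IH sum.distrib algebra_simps)
qed simp

text \<open>Lies between \<open>smooth_in\<close> and \<open>chart_diff\<close>: it permits the
  repeated derivatives of transition functions near a point of the overlap.\<close>

definition smooth_near :: "('x, 'd) chart \<Rightarrow> ('x \<Rightarrow> complex) \<Rightarrow> 'x \<Rightarrow> bool" where
  "smooth_near c f p \<longleftrightarrow>
    (\<exists>S. open S \<and> snd c p \<in> S \<and> S \<subseteq> coord_image c \<and> (\<forall>k. Ck_on k S (\<lambda>z. f (coord_inv c z))))"

lemma smooth_in_smooth_near: "c \<in> \<A> \<Longrightarrow> smooth_in c f \<Longrightarrow> p \<in> fst c \<Longrightarrow> smooth_near c f p"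
  unfolding smooth_near_def
  by (intro exI[of _ "coord_image c"]) (simp add: open_coord_image coord_in_image smooth_inD)

lemma smooth_near_chart_diff: "smooth_near c f p \<Longrightarrow> chart_diff c f p"
  unfolding smooth_near_def chart_diff_def using Ck_on_differentiable[of 0] by blast

lemma smooth_near_chart_dir:
  assumes "smooth_near c f p" shows "smooth_near c (chart_dir c v f) p"
proof -
  obtain S where S: "open S" "snd c p \<in> S" "S \<subseteq> coord_image c"
    "\<And>k. Ck_on k S (\<lambda>z. f (coord_inv c z))"
    using assms unfolding smooth_near_def by blast
  have "Ck_on k S (\<lambda>z. chart_dir c v f (coord_inv c z))" for k
    by (rule Ck_on_cong[OF S(1) _ Ck_on_frechet_derivative[OF S(4)[of "Suc k"], of v]])
       (use S(3) in \<open>auto simp: chart_dir_def o_def coord_coord_inv\<close>)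
  then show ?thesis unfolding smooth_near_def using S by blast
qed

lemma chart_dir_commute:
  assumes "smooth_near c f p"
  shows "chart_dir c v (chart_dir c w f) p = chart_dir c w (chart_dir c v f) p"
proof -
  obtain S where S: "open S" "snd c p \<in> S" "S \<subseteq> coord_image c"
    "\<And>k. Ck_on k S (\<lambda>z. f (coord_inv c z))"
    using assms unfolding smooth_near_def by blast
  have "chart_dir c v (chart_dir c w f) p =
      frechet_derivative (\<lambda>y. frechet_derivative (\<lambda>z. f (coord_inv c z)) (at y) w) (at (snd c p)) v" for v w
    unfolding chart_dir_def[of c v]
    by (subst frechet_derivative_cong_open[OF S(1,2)])
       (use S(3) in \<open>auto simp: chart_dir_def o_def coord_coord_inv\<close>)
  then show ?thesis
    using frechet_derivative_commute[OF S(1,2) S(4)] by simp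
qed

lemma chart_dir_scale:
  "chart_diff c f p \<Longrightarrow> p \<in> fst c \<Longrightarrow> c \<in> \<A> \<Longrightarrow>
    chart_dir c v (\<lambda>q. r * f q) p = r * chart_dir c v f p"
  by (simp add: chart_dir_mult chart_diff_const chart_dir_const)

lemma chart_dir_del_delbar:
  assumes c: "c \<in> \<A>" "p \<in> fst c" and f: "smooth_near c f p"
  shows "chart_dir c v (del c a f) p =
      (chart_dir c v (chart_dir c (axis a 1) f) p - \<i> * chart_dir c v (chart_dir c (axis a \<i>) f) p) / 2"
    and "chart_dir c v (delbar c a f) p =
      (chart_dir c v (chart_dir c (axis a 1) f) p + \<i> * chart_dir c v (chart_dir c (axis a \<i>) f) p) / 2"
proof -
  have d: "chart_diff c (chart_dir c w f) p" for w
    by (intro smooth_near_chart_diff smooth_near_chart_dir f)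
  have e: "del c a f = (\<lambda>q. 1/2 * (chart_dir c (axis a 1) f q + - \<i> * chart_dir c (axis a \<i>) f q))"
    "delbar c a f = (\<lambda>q. 1/2 * (chart_dir c (axis a 1) f q + \<i> * chart_dir c (axis a \<i>) f q))"
    by (auto simp: del_def delbar_def)
  show "chart_dir c v (del c a f) p =
      (chart_dir c v (chart_dir c (axis a 1) f) p - \<i> * chart_dir c v (chart_dir c (axis a \<i>) f) p) / 2"
    unfolding e
    by (simp only: chart_dir_scale chart_dir_add chart_diff_add chart_diff_mult chart_diff_const d c)
       simp
  show "chart_dir c v (delbar c a f) p =
      (chart_dir c v (chart_dir c (axis a 1) f) p + \<i> * chart_dir c v (chart_dir c (axis a \<i>) f) p) / 2"
    unfolding e
    by (simp only: chart_dir_scale chart_dir_add chart_diff_add chart_diff_mult chart_diff_const d c)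
       simp
qed

lemma
  assumes c: "c \<in> \<A>" "p \<in> fst c" and f: "smooth_near c f p"
  shows delbar_delbar: "delbar c a (delbar c b f) p = delbar c b (delbar c a f) p"
    and del_del: "del c a (del c b f) p = del c b (del c a f) p"
    and delbar_del: "delbar c a (del c b f) p = del c b (delbar c a f) p"
  by (simp_all add: delbar_def[of c _ "delbar c _ f"] delbar_def[of c _ "del c _ f"]
      del_def[of c _ "delbar c _ f"] del_def[of c _ "del c _ f"] chart_dir_del_delbar[OF assms]
      chart_dir_commute[OF f, of "axis a _"] field_simps)

text \<open>Conjugation exchanges the two Wirtinger derivatives and so reduces the claim to
  \<open>smooth_in_del\<close>.\<close>

lemma smooth_in_delbar:
  assumes c: "c \<in> \<A>" and f: "smooth_in c f"
  shows "smooth_in c (delbar c a f)"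
proof -
  have "smooth_in c (\<lambda>q. cnj (del c a (\<lambda>q. cnj (f q)) q))"
    by (intro smooth_in_cnj smooth_in_del c f)
  then show ?thesis
    by (rule smooth_in_cong[OF c, rotated])
       (simp add: delbar_cnj[symmetric] chart_diff_cnj smooth_in_chart_diff[OF f])
qed

text \<open>Up to the factor 2 these are the antilinear and the complex linear part of
  \<open>D\<close>. The antilinear part is expanded through its conjugate, to which
  \<open>complex_linear_expand\<close> applies.\<close>

lemma antilinear_part_expand:
  fixes D :: "complex^'d \<Rightarrow> complex"
  assumes "linear D"
  shows "D w + \<i> * D (\<i> *s w) = (\<Sum>a\<in>UNIV. cnj (w $ a) * (D (axis a 1) + \<i> * D (axis a \<i>)))"
    and "D w - \<i> * D (\<i> *s w) = (\<Sum>a\<in>UNIV. w $ a * (D (axis a 1) - \<i> * D (axis a \<i>)))"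
proof -
  have ax: "\<i> *s axis a 1 = (axis a \<i> :: complex^'d)" for a
    by (simp add: vec_eq_iff axis_def)
  have ii: "D (\<i> *s (\<i> *s v)) = - D v" for v
  proof -
    have "\<i> *s (\<i> *s v) = (- 1) *\<^sub>R v" by (simp add: vec_eq_iff)
    then show ?thesis by (simp only: linear_scale[OF assms]) simp
  qed
  define P where "P v = cnj (D v + \<i> * D (\<i> *s v))" for v
  define Q where "Q v = D v - \<i> * D (\<i> *s v)" for v
  have lin: "D (u + v) = D u + D v" "D (r *\<^sub>R v) = r *\<^sub>R D v" for u v r
    by (simp_all add: linear_add[OF assms] linear_scale[OF assms])
  have sc: "\<i> *s (u + v) = \<i> *s u + \<i> *s v" "\<i> *s (r *\<^sub>R v) = r *\<^sub>R (\<i> *s v)"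
    for u v :: "complex^'d" and r :: real
    by (simp_all add: vec_eq_iff algebra_simps)
  have "linear P" "linear Q"
    unfolding P_def Q_def
    by (rule linearI; simp only: lin sc; simp add: algebra_simps scaleR_conv_of_real)+
  moreover have "P (\<i> *s v) = \<i> * P v" "Q (\<i> *s v) = \<i> * Q v" for v
    unfolding P_def Q_def by (simp_all only: ii) (simp_all add: algebra_simps)
  ultimately have "P w = (\<Sum>a\<in>UNIV. w $ a * P (axis a 1))" "Q w = (\<Sum>a\<in>UNIV. w $ a * Q (axis a 1))"
    by (intro complex_linear_expand; simp)+
  then have "cnj (P w) = cnj (\<Sum>a\<in>UNIV. w $ a * P (axis a 1))" "Q w = (\<Sum>a\<in>UNIV. w $ a * Q (axis a 1))"
    by simp_all
  then show "D w + \<i> * D (\<i> *s w) = (\<Sum>a\<in>UNIV. cnj (w $ a) * (D (axis a 1) + \<i> * D (axis a \<i>)))"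
    and "D w - \<i> * D (\<i> *s w) = (\<Sum>a\<in>UNIV. w $ a * (D (axis a 1) - \<i> * D (axis a \<i>)))"
    by (simp_all add: P_def Q_def ax)
qed

section \<open>Transition maps and Jacobians\<close>

context
  fixes c c' :: "('x, 'd) chart" and p :: 'x
  assumes c: "c \<in> \<A>" "p \<in> fst c" and c': "c' \<in> \<A>" "p \<in> fst c'"
begin

lemma holo_transition:
  "holo_on (snd c ` (fst c \<inter> fst c')) (\<lambda>z. snd c' (coord_inv c z) $ a)"
  using atlas c(1) c'(1) by (auto simp: complex_atlas_def)

lemma smooth_near_coord: "smooth_near c (\<lambda>q. snd c' q $ a) p"
  unfolding smooth_near_def
proof (intro exI conjI allI)
  show "open (snd c ` (fst c \<inter> fst c'))" by (rule open_overlap[OF c(1) c'(1)])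
  show "snd c p \<in> snd c ` (fst c \<inter> fst c')" using c c' by blast
  show "snd c ` (fst c \<inter> fst c') \<subseteq> coord_image c" by (auto simp: coord_image_def)
  show "Ck_on k (snd c ` (fst c \<inter> fst c')) (\<lambda>z. snd c' (coord_inv c z) $ a)" for k
    using holo_transition by (simp add: holo_on_def smooth_on_def)
qed

lemma chart_dir_coord_complex_linear:
  "chart_dir c (\<i> *s v) (\<lambda>q. snd c' q $ a) p = \<i> * chart_dir c v (\<lambda>q. snd c' q $ a) p"
  using holo_transition[of a] c c' by (simp add: holo_on_def chart_dir_def o_def)

lemma delbar_coord: "delbar c b (\<lambda>q. snd c' q $ a) p = 0"
proof -
  have "axis b \<i> = \<i> *s (axis b 1 :: complex^'d)" by (simp add: vec_eq_iff axis_def)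
  then show ?thesis by (simp add: delbar_def chart_dir_coord_complex_linear)
qed

lemma chart_dir_coord:
  "chart_dir c v (\<lambda>q. snd c' q $ a) p = (\<Sum>b\<in>UNIV. jac c c' p a b * v $ b)"
proof -
  let ?D = "\<lambda>v. chart_dir c v (\<lambda>q. snd c' q $ a) p"
  have "linear ?D"
    using chart_diff_derivative[OF smooth_near_chart_diff[OF smooth_near_coord]] has_derivative_linear by blast
  then have "?D v = (\<Sum>b\<in>UNIV. v $ b * ?D (axis b 1))"
    by (rule complex_linear_expand) (rule chart_dir_coord_complex_linear)
  moreover have "jac c c' p a b = ?D (axis b 1)" for b
  proof -
    have "axis b \<i> = \<i> *s (axis b 1 :: complex^'d)" by (simp add: vec_eq_iff axis_def)
    then show ?thesis by (simp add: jac_def del_def chart_dir_coord_complex_linear)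
  qed
  ultimately show ?thesis by (simp add: mult.commute)
qed

lemma transition_derivative:
  "((\<lambda>z. snd c' (coord_inv c z)) has_derivative (\<lambda>v. \<chi> a. \<Sum>b\<in>UNIV. jac c c' p a b * v $ b)) (at (snd c p))"
proof (rule has_derivative_vecI[OF _ refl])
  show "((\<lambda>z. snd c' (coord_inv c z) $ a) has_derivative
      (\<lambda>v. (\<chi> a. \<Sum>b\<in>UNIV. jac c c' p a b * v $ b) $ a)) (at (snd c p))" for a
    using chart_diff_derivative[OF smooth_near_chart_diff[OF smooth_near_coord[of a]]]
    by (simp add: chart_dir_coord)
qed

lemma
  assumes f: "chart_diff c' f p"
  shows chart_diff_change: "chart_diff c f p"
    and chart_dir_change:
      "chart_dir c v f p = chart_dir c' (\<chi> a. \<Sum>b\<in>UNIV. jac c c' p a b * v $ b) f p"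
proof -
  let ?D = "\<lambda>v. chart_dir c' (\<chi> a. \<Sum>b\<in>UNIV. jac c c' p a b * v $ b) f p"
  have "((\<lambda>z. f (coord_inv c' z)) has_derivative (\<lambda>v. chart_dir c' v f p)) (at (snd c' (coord_inv c (snd c p))))"
    using chart_diff_derivative[OF f] by (simp add: coord_inv_coord c)
  from diff_chain_at[OF transition_derivative this]
  have "((\<lambda>z. f (coord_inv c' (snd c' (coord_inv c z)))) has_derivative ?D) (at (snd c p))"
    by (simp add: o_def)
  then have "((\<lambda>z. f (coord_inv c z)) has_derivative ?D) (at (snd c p))"
    by (rule has_derivative_transform_within_open[OF _ open_overlap[OF c(1) c'(1)]])
       (use c c' in \<open>auto simp: coord_inv_coord\<close>)
  then show "chart_diff c f p" "chart_dir c v f p = ?D v"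
    by (auto intro: chart_diffI chart_dir_eqI)
qed

text \<open>The derivative of a transition map is complex linear, so the image of
  \<open>axis b \<i>\<close> is \<open>\<i>\<close> times that of \<open>axis b 1\<close>. Hence the
  linear and the antilinear part transform separately, and \<open>del\<close> and
  \<open>delbar\<close> do not mix.\<close>

lemma
  assumes f: "chart_diff c' f p"
  shows delbar_change: "delbar c b f p = (\<Sum>a\<in>UNIV. cnj (jac c c' p a b) * delbar c' a f p)"
    and del_change: "del c b f p = (\<Sum>a\<in>UNIV. jac c c' p a b * del c' a f p)"
proof -
  let ?w = "(\<chi> a. jac c c' p a b) :: complex^'d"
  have "(\<chi> a. \<Sum>x\<in>UNIV. jac c c' p a x * (axis b 1 :: complex^'d) $ x) = ?w"
    "(\<chi> a. \<Sum>x\<in>UNIV. jac c c' p a x * (axis b \<i> :: complex^'d) $ x) = \<i> *s ?w"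
    by (auto simp: vec_eq_iff axis_def if_distrib cong: if_cong)
  then have e: "chart_dir c (axis b 1) f p = chart_dir c' ?w f p"
    "chart_dir c (axis b \<i>) f p = chart_dir c' (\<i> *s ?w) f p"
    by (simp_all add: chart_dir_change[OF f])
  have "linear (\<lambda>v. chart_dir c' v f p)"
    using chart_diff_derivative[OF f] has_derivative_linear by blast
  note lin = antilinear_part_expand[OF this, of ?w]
  show "delbar c b f p = (\<Sum>a\<in>UNIV. cnj (jac c c' p a b) * delbar c' a f p)"
    by (simp add: delbar_def e lin sum_divide_distrib)
  show "del c b f p = (\<Sum>a\<in>UNIV. jac c c' p a b * del c' a f p)"
    by (simp add: del_def e lin sum_divide_distrib)
qed

lemma chart_diff_jac: "chart_diff c (\<lambda>q. jac c c' q a b) p"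
proof -
  have d: "chart_diff c (chart_dir c v (\<lambda>q. snd c' q $ a)) p" for v
    by (intro smooth_near_chart_diff smooth_near_chart_dir smooth_near_coord)
  have "(\<lambda>q. jac c c' q a b) = (\<lambda>q. 1/2 * (chart_dir c (axis b 1) (\<lambda>q. snd c' q $ a) q
      + - \<i> * chart_dir c (axis b \<i>) (\<lambda>q. snd c' q $ a) q))"
    by (auto simp: jac_def del_def)
  then show ?thesis
    by (simp only:) (intro chart_diff_mult chart_diff_add chart_diff_const d)
qed

text \<open>Both sides are mixed second derivatives of one coordinate function. This symmetry is
  what makes \<partial>bar on forms independent of the chart.\<close>

lemma del_jac_commute: "del c d (\<lambda>q. jac c c' q a b) p = del c b (\<lambda>q. jac c c' q a d) p"
  unfolding jac_def by (rule del_del[OF c smooth_near_coord])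

end

text \<open>A transition map is holomorphic, and so are its derivatives. Hence \<partial>bar does
  not see the matrices by which the polyvector indices transform.\<close>

lemma delbar_jac:
  assumes "c \<in> \<A>" "p \<in> fst c" "c' \<in> \<A>" "p \<in> fst c'"
  shows "delbar c d (\<lambda>q. jac c c' q a b) p = 0"
proof -
  have "delbar c d (\<lambda>q. jac c c' q a b) p = del c b (delbar c d (\<lambda>q. snd c' q $ a)) p"
    unfolding jac_def by (rule delbar_del[OF assms(1,2) smooth_near_coord[OF assms]])
  also have "\<dots> = del c b (\<lambda>q. 0) p"
    by (rule del_cong[OF assms(1,2) open_chart[OF assms(3)]])
       (use assms delbar_coord in auto)
  finally show ?thesis by simp
qed

text \<open>This is \<open>del_change\<close> applied to the coordinates of \<open>c\<close>
  itself.\<close>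

lemma jac_inverse:
  assumes c: "c \<in> \<A>" "p \<in> fst c" and c': "c' \<in> \<A>" "p \<in> fst c'"
  shows "(\<Sum>x\<in>UNIV. jac c' c p a x * jac c c' p x b) = (if a = b then 1 else 0)"
proof -
  have id: "((\<lambda>z. snd c (coord_inv c z) $ a) has_derivative (\<lambda>v. v $ a)) (at (snd c p))"
  proof (rule has_derivative_transform_within_open[OF _ open_coord_image[OF c(1)] coord_in_image[OF c(2)]])
    show "((\<lambda>z::complex^'d. z $ a) has_derivative (\<lambda>v. v $ a)) (at (snd c p))"
      by (rule bounded_linear.has_derivative[OF bounded_linear_vec_nth has_derivative_ident])
  qed (simp add: coord_coord_inv)
  have "(\<Sum>x\<in>UNIV. jac c' c p a x * jac c c' p x b) =
      (\<Sum>x\<in>UNIV. jac c c' p x b * del c' x (\<lambda>q. snd c q $ a) p)"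
    by (simp add: jac_def mult.commute)
  also have "\<dots> = del c b (\<lambda>q. snd c q $ a) p"
    by (rule del_change[OF c c', symmetric])
       (rule smooth_near_chart_diff[OF smooth_near_coord[OF c' c]])
  also have "\<dots> = (if a = b then 1 else 0)"
    by (simp add: del_def chart_dir_eqI[OF id] axis_def)
  finally show ?thesis .
qed

end


section \<open>Operators on polyvector-valued forms\<close>

text \<open>The sign \<open>(-1)\<^sup>j\<close> is the one in the product and in \<open>iota\<close>; the two cancel in the
  anticommutator.\<close>

definition pv_wedge ::
    "(('x, 'd) chart \<Rightarrow> 'x \<Rightarrow> 'd \<Rightarrow> complex) \<Rightarrow> ('x, 'd::finite) pv \<Rightarrow> ('x, 'd) pv" where
  "pv_wedge v \<alpha> = (\<lambda>c p A B. (-1) ^ length B * ext_sum A (\<lambda>x C. v c p x * \<alpha> c p C B))"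

text \<open>Values outside the charts are left arbitrary; \<open>pv_wedge\<close> multiplies them by
  components that are 0 there.\<close>

definition vector_field ::
    "('x, 'd::finite) chart set \<Rightarrow> (('x, 'd) chart \<Rightarrow> 'x \<Rightarrow> 'd \<Rightarrow> complex) \<Rightarrow> bool" where
  "vector_field \<A> v \<longleftrightarrow>
     (\<forall>c\<in>\<A>. \<forall>a. smooth_in c (\<lambda>p. v c p a)) \<and>
     (\<forall>c\<in>\<A>. \<forall>c'\<in>\<A>. \<forall>p\<in>fst c \<inter> fst c'. \<forall>a.
        v c' p a = (\<Sum>b\<in>UNIV. jac c c' p a b * v c p b))"

text \<open>These are the homogeneous components demanded by
  \<open>is_graded_module\<close>.\<close>

definition pv_truncate :: "int \<Rightarrow> ('x, 'd) pv \<Rightarrow> ('x, 'd) pv" where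
  "pv_truncate k \<alpha> = (\<lambda>c p A B. if - int (length A) + int (length B) = k then \<alpha> c p A B else 0)"

text \<open>Covariant indices transform by the inverse Jacobian, here conjugated. The transposition
  puts the index of the new chart first, so that both kinds of indices fit
  \<open>tensor_change\<close>.\<close>

definition cobar :: "('x, 'd::finite) chart \<Rightarrow> ('x, 'd) chart \<Rightarrow> 'x \<Rightarrow> 'd \<Rightarrow> 'd \<Rightarrow> complex" where
  "cobar c c' p x y = cnj (jac c' c p y x)"

lemma PV_tensor_sum_conv:
  "(\<Sum>A' | length A' = length A. \<Sum>B' | length B' = length B.
      (\<Prod>i<length A. jac c c' p (A ! i) (A' ! i)) *
      (\<Prod>j<length B. cnj (jac c' c p (B' ! j) (B ! j))) * t A' B') =
   tensor_change (jac c c' p) A (\<lambda>A'. tensor_change (cobar c c' p) B (t A'))"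
  by (simp add: tensor_change_conv[symmetric] cobar_def sum_distrib_left mult.assoc)

lemma alternating_ext_sum_param:
  fixes f :: "'e list \<Rightarrow> 'd \<Rightarrow> 'd list \<Rightarrow> complex"
  assumes "\<And>x C. alternating (\<lambda>A. f A x C)"
  shows "alternating (\<lambda>A. ext_sum B (f A))"
  unfolding alternating_def
proof (intro allI impI)
  fix A :: "'e list" and i j
  assume "i < length A \<and> j < length A \<and> i \<noteq> j"
  then have "f (A[i := A ! j, j := A ! i]) = (\<lambda>x C. - f A x C)"
    using assms by (simp add: alternating_def fun_eq_iff)
  then show "ext_sum B (f (A[i := A ! j, j := A ! i])) = - ext_sum B (f A)"
    by (simp add: ext_sum_minus)
qed

lemma alternating_add:
  "alternating t \<Longrightarrow> alternating u \<Longrightarrow> alternating (\<lambda>A. t A + u A)"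
  by (simp add: alternating_def)

lemma alternating_zero: "alternating (\<lambda>A. 0)"
  by (simp add: alternating_def)

lemma tensor_change_deriv_zero [simp]: "tensor_change_deriv M (\<lambda>x y. 0) A t = 0"
  by (induction A arbitrary: t) auto

text \<open>In \<open>iota W (pv_wedge v \<alpha>)\<close> the contracted index stands at the head
  of the list. Extracting it yields the pairing of the field with the differential of
  \<open>W\<close>; the other extractions reproduce \<open>pv_wedge v (iota W \<alpha>)\<close> with
  the opposite sign.\<close>

lemma iota_wedge:
  fixes \<alpha> :: "('x, 'd::finite) pv"
  shows "pv_add (iota W (pv_wedge v \<alpha>)) (pv_wedge v (iota W \<alpha>)) =
     (\<lambda>c p A B. (\<Sum>a\<in>UNIV. - \<i> * del c a W p * v c p a) * \<alpha> c p A B)"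
proof (intro ext)
  fix c :: "('x, 'd) chart" and p and A B :: "'d list"
  define w where "w a = - \<i> * del c a W p" for a
  have s: "(-1) ^ length B * ((-1) ^ length B * z) = z" for z :: complex
    by (simp flip: mult.assoc power_mult_distrib)
  have "iota W (pv_wedge v \<alpha>) c p A B =
      (\<Sum>a\<in>UNIV. (-1) ^ length B * ((-1) ^ length B *
        (w a * (v c p a * \<alpha> c p A B - ext_sum A (\<lambda>x C. v c p x * \<alpha> c p (a # C) B)))))"
    by (simp add: iota_def pv_wedge_def w_def sum_distrib_left mult_ac)
  also have "\<dots> = (\<Sum>a\<in>UNIV. w a * v c p a) * \<alpha> c p A B -
      (\<Sum>a\<in>UNIV. w a * ext_sum A (\<lambda>x C. v c p x * \<alpha> c p (a # C) B))"
    unfolding s by (simp add: right_diff_distrib sum_subtractf sum_distrib_left mult_ac)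
  finally have 1: "iota W (pv_wedge v \<alpha>) c p A B = \<dots>" .
  have "pv_wedge v (iota W \<alpha>) c p A B =
      (-1) ^ length B * ext_sum A (\<lambda>x C. (-1) ^ length B * (\<Sum>a\<in>UNIV. w a * (v c p x * \<alpha> c p (a # C) B)))"
    by (simp add: iota_def pv_wedge_def w_def sum_distrib_left mult_ac)
  also have "\<dots> = (\<Sum>a\<in>UNIV. w a * ext_sum A (\<lambda>x C. v c p x * \<alpha> c p (a # C) B))"
    unfolding ext_sum_scale s by (simp add: ext_sum_sum ext_sum_scale)
  finally show "pv_add (iota W (pv_wedge v \<alpha>)) (pv_wedge v (iota W \<alpha>)) c p A B =
     (\<Sum>a\<in>UNIV. - \<i> * del c a W p * v c p a) * \<alpha> c p A B"
    unfolding pv_add_def 1 by (simp add: w_def)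
qed

lemma pv_wedge_add: "pv_wedge v (pv_add \<alpha> \<beta>) = pv_add (pv_wedge v \<alpha>) (pv_wedge v \<beta>)"
  by (simp add: pv_wedge_def pv_add_def fun_eq_iff ext_sum_add algebra_simps)

lemma pv_wedge_smult: "pv_wedge v (pv_smult f \<alpha>) = pv_smult f (pv_wedge v \<alpha>)"
proof (intro ext)
  fix c p A B
  have "ext_sum A (\<lambda>x C. v c p x * (f p * \<alpha> c p C B)) =
      f p * ext_sum A (\<lambda>x C. v c p x * \<alpha> c p C B)"
    by (simp add: ext_sum_scale[symmetric] mult_ac)
  then show "pv_wedge v (pv_smult f \<alpha>) c p A B = pv_smult f (pv_wedge v \<alpha>) c p A B"
    by (simp add: pv_wedge_def pv_smult_def)
qed

lemma iota_add: "iota W (pv_add \<alpha> \<beta>) = pv_add (iota W \<alpha>) (iota W \<beta>)"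
  by (simp add: iota_def pv_add_def fun_eq_iff sum.distrib sum_negf sum_subtractf algebra_simps)

lemma iota_smult: "iota W (pv_smult f \<alpha>) = pv_smult f (iota W \<alpha>)"
  by (simp add: iota_def pv_smult_def fun_eq_iff sum_distrib_left mult_ac)

text \<open>A coefficient symmetric in two indices is summed against a component alternating in
  them.\<close>

lemma iota_iota:
  fixes \<alpha> :: "('x, 'd::finite) pv"
  assumes "\<And>c p B. alternating (\<lambda>A. \<alpha> c p A B)"
  shows "iota W (iota W \<alpha>) = pv_zero"
proof (intro ext)
  fix c :: "('x, 'd) chart" and p and A B :: "'d list"
  define w where "w a = - \<i> * del c a W p" for a
  let ?S = "\<Sum>a\<in>UNIV. \<Sum>b\<in>UNIV. w a * w b * \<alpha> c p (b # a # A) B"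
  have "?S = (\<Sum>b\<in>UNIV. \<Sum>a\<in>UNIV. w a * w b * \<alpha> c p (b # a # A) B)" by (rule sum.swap)
  also have "\<dots> = - ?S"
    unfolding sum_negf[symmetric]
  proof (intro sum.cong refl)
    fix b a
    have "\<alpha> c p (b # a # A) B = - \<alpha> c p (a # b # A) B"
      using alternating_adjacent[OF assms[of c p B], of "[]" b a A] by simp
    then show "w a * w b * \<alpha> c p (b # a # A) B = - (w b * w a * \<alpha> c p (a # b # A) B)" by simp
  qed
  finally have "?S = 0" by simp
  moreover have "iota W (iota W \<alpha>) c p A B = (-1) ^ length B * ((-1) ^ length B * ?S)"
    by (simp add: iota_def w_def sum_distrib_left mult_ac)
  ultimately show "iota W (iota W \<alpha>) c p A B = pv_zero c p A B" by (simp add: pv_zero_def)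
qed

context complex_manifold
begin

lemma PV_tensor_change:
  assumes "\<alpha> \<in> PV \<A>" "c \<in> \<A>" "c' \<in> \<A>" "p \<in> fst c" "p \<in> fst c'"
  shows "\<alpha> c' p A B =
    tensor_change (jac c c' p) A (\<lambda>A'. tensor_change (cobar c c' p) B (\<lambda>B'. \<alpha> c p A' B'))"
  using PV_transD[OF assms(1-3), of p A B] assms(4,5) by (simp add: PV_tensor_sum_conv)

lemma PV_I:
  assumes "\<And>c p A B. \<not> (c \<in> \<A> \<and> p \<in> fst c) \<Longrightarrow> \<alpha> c p A B = 0"
    and "\<And>c p B. c \<in> \<A> \<Longrightarrow> p \<in> fst c \<Longrightarrow> alternating (\<lambda>A. \<alpha> c p A B)"
    and "\<And>c p A. c \<in> \<A> \<Longrightarrow> p \<in> fst c \<Longrightarrow> alternating (\<lambda>B. \<alpha> c p A B)"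
    and "\<And>c A B. c \<in> \<A> \<Longrightarrow> smooth_in c (\<lambda>p. \<alpha> c p A B)"
    and "\<And>c c' p A B. c \<in> \<A> \<Longrightarrow> c' \<in> \<A> \<Longrightarrow> p \<in> fst c \<Longrightarrow> p \<in> fst c' \<Longrightarrow> \<alpha> c' p A B =
      tensor_change (jac c c' p) A (\<lambda>A'. tensor_change (cobar c c' p) B (\<lambda>B'. \<alpha> c p A' B'))"
  shows "\<alpha> \<in> PV \<A>"
proof -
  have alt: "alternating (\<lambda>A. \<alpha> c p A B)" "alternating (\<lambda>B. \<alpha> c p A B)" for c p A B
    using assms(1-3)[of c p] alternating_zero by (cases "c \<in> \<A> \<and> p \<in> fst c"; simp)+
  show ?thesis
    unfolding PV_def PV_tensor_sum_conv
    by (intro CollectI conjI allI ballI impI)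
       ((rule assms(1), assumption) | rule alt | (rule assms(4), assumption) | (rule assms(5); simp))+
qed

lemma PV_chart_diff: "\<alpha> \<in> PV \<A> \<Longrightarrow> c \<in> \<A> \<Longrightarrow> p \<in> fst c \<Longrightarrow> chart_diff c (\<lambda>q. \<alpha> c q A B) p"
  using PV_D(4) smooth_in_chart_diff by blast

lemma PV_length:
  assumes "\<alpha> \<in> PV \<A>" "CARD('d) < length A \<or> CARD('d) < length B"
  shows "\<alpha> c p A B = 0"
  using assms(2) alternating_length[OF PV_D(2)[OF assms(1)]] alternating_length[OF PV_D(3)[OF assms(1)]]
  by blast

lemma pv_zero_PV: "pv_zero \<in> PV \<A>"
  by (rule PV_I) (auto simp: pv_zero_def alternating_zero smooth_in_const)

lemma pv_add_PV:
  assumes \<alpha>: "\<alpha> \<in> PV \<A>" and \<beta>: "\<beta> \<in> PV \<A>"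
  shows "pv_add \<alpha> \<beta> \<in> PV \<A>"
proof (rule PV_I)
  fix c c' p A B
  assume **: "c \<in> \<A>" "c' \<in> \<A>" "p \<in> fst c" "p \<in> fst c'"
  show "pv_add \<alpha> \<beta> c' p A B =
      tensor_change (jac c c' p) A (\<lambda>A'. tensor_change (cobar c c' p) B (\<lambda>B'. pv_add \<alpha> \<beta> c p A' B'))"
    by (simp add: pv_add_def PV_tensor_change[OF \<alpha> **] PV_tensor_change[OF \<beta> **] tensor_change_add)
qed (auto simp: pv_add_def PV_D(1)[OF \<alpha>] PV_D(1)[OF \<beta>]
      intro: alternating_add smooth_in_add PV_D[OF \<alpha>] PV_D[OF \<beta>])

lemma pv_smult_PV:
  assumes "\<alpha> \<in> PV \<A>" "smooth_fun \<A> f"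
  shows "pv_smult f \<alpha> \<in> PV \<A>"
proof (rule PV_I)
  fix c c' p A B
  assume **: "c \<in> \<A>" "c' \<in> \<A>" "p \<in> fst c" "p \<in> fst c'"
  show "pv_smult f \<alpha> c' p A B =
      tensor_change (jac c c' p) A (\<lambda>A'. tensor_change (cobar c c' p) B (\<lambda>B'. pv_smult f \<alpha> c p A' B'))"
    by (simp add: pv_smult_def PV_tensor_change[OF assms(1) **] tensor_change_scale)
qed (use assms(2) in \<open>auto simp: pv_smult_def smooth_fun_def PV_D(1)[OF assms(1)]
      intro: alternating_scale smooth_in_mult PV_D[OF assms(1)]\<close>)

text \<open>Coordinate changes preserve the lengths of both index lists, so the test on lengths
  commutes with them.\<close>

lemma pv_truncate_PV:
  assumes "\<alpha> \<in> PV \<A>"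
  shows "pv_truncate k \<alpha> \<in> PV \<A>"
proof (rule PV_I)
  fix c c' p A B
  assume **: "c \<in> \<A>" "c' \<in> \<A>" "p \<in> fst c" "p \<in> fst c'"
  show "pv_truncate k \<alpha> c' p A B =
      tensor_change (jac c c' p) A (\<lambda>A'. tensor_change (cobar c c' p) B (\<lambda>B'. pv_truncate k \<alpha> c p A' B'))"
  proof (cases "- int (length A) + int (length B) = k")
    case True
    have "tensor_change (jac c c' p) A (\<lambda>A'. tensor_change (cobar c c' p) B (\<lambda>B'. pv_truncate k \<alpha> c p A' B'))
        = tensor_change (jac c c' p) A (\<lambda>A'. tensor_change (cobar c c' p) B (\<lambda>B'. \<alpha> c p A' B'))"
      by (intro tensor_change_cong) (use True in \<open>auto simp: pv_truncate_def\<close>)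
    then show ?thesis using True by (simp add: pv_truncate_def PV_tensor_change[OF assms **])
  next
    case False
    have "tensor_change (jac c c' p) A (\<lambda>A'. tensor_change (cobar c c' p) B (\<lambda>B'. pv_truncate k \<alpha> c p A' B'))
        = tensor_change (jac c c' p) A (\<lambda>A'. tensor_change (cobar c c' p) B (\<lambda>B'. 0))"
      by (intro tensor_change_cong) (use False in \<open>auto simp: pv_truncate_def\<close>)
    then show ?thesis using False by (simp add: pv_truncate_def)
  qed
next
  fix c p A B
  assume "\<not> (c \<in> \<A> \<and> p \<in> fst c)"
  then show "pv_truncate k \<alpha> c p A B = 0" using PV_D(1)[OF assms] by (auto simp: pv_truncate_def)
next
  fix c A B assume "c \<in> \<A>"
  then show "smooth_in c (\<lambda>p. pv_truncate k \<alpha> c p A B)"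
    using PV_D(4)[OF assms] by (cases "- int (length A) + int (length B) = k")
      (auto simp: pv_truncate_def smooth_in_const)
next
  fix c p A B
  show "alternating (\<lambda>A. pv_truncate k \<alpha> c p A B)" "alternating (\<lambda>B. pv_truncate k \<alpha> c p A B)"
    using PV_D(2,3)[OF assms, of c p] by (auto simp: alternating_def pv_truncate_def)
qed

lemma pv_wedge_PV:
  assumes v: "vector_field \<A> v" and \<alpha>: "\<alpha> \<in> PV \<A>"
  shows "pv_wedge v \<alpha> \<in> PV \<A>"
proof (rule PV_I)
  fix c p A B
  assume "\<not> (c \<in> \<A> \<and> p \<in> fst c)"
  then show "pv_wedge v \<alpha> c p A B = 0" using PV_D(1)[OF \<alpha>] by (simp add: pv_wedge_def)
next
  fix c p B
  show "alternating (\<lambda>A. pv_wedge v \<alpha> c p A B)"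
    unfolding pv_wedge_def by (intro alternating_scale alternating_ext_sum PV_D(2)[OF \<alpha>])
next
  fix c p A
  have "alternating (\<lambda>B. ext_sum A (\<lambda>x C. v c p x * \<alpha> c p C B))"
    by (intro alternating_ext_sum_param alternating_scale PV_D(3)[OF \<alpha>])
  then show "alternating (\<lambda>B. pv_wedge v \<alpha> c p A B)"
    by (simp add: pv_wedge_def alternating_def)
next
  fix c A B assume c: "c \<in> \<A>"
  show "smooth_in c (\<lambda>p. pv_wedge v \<alpha> c p A B)"
    unfolding pv_wedge_def using v c
    by (intro smooth_in_mult smooth_in_const smooth_in_ext_sum PV_D(4)[OF \<alpha>])
       (auto simp: vector_field_def)
next
  fix c c' p A B
  assume c: "c \<in> \<A>" "c' \<in> \<A>" "p \<in> fst c" "p \<in> fst c'"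
  let ?J = "jac c c' p" and ?K = "cobar c c' p"
  have "v c' p x = (\<Sum>y\<in>UNIV. ?J x y * v c p y)" for x
    using v c by (simp add: vector_field_def)
  then have "ext_sum A (\<lambda>x C. v c' p x * \<alpha> c' p C B) =
      ext_sum A (\<lambda>x C. \<Sum>y\<in>UNIV. ?J x y *
        tensor_change ?J C (\<lambda>A'. v c p y * tensor_change ?K B (\<alpha> c p A')))"
    by (simp add: PV_tensor_change[OF \<alpha> c] sum_distrib_right tensor_change_scale mult_ac)
  also have "\<dots> = tensor_change ?J A (\<lambda>A'. ext_sum A' (\<lambda>y C. tensor_change ?K B (\<lambda>B'. v c p y * \<alpha> c p C B')))"
    by (simp add: tensor_change_ext_sum tensor_change_scale)
  also have "\<dots> = tensor_change ?J A (\<lambda>A'. tensor_change ?K B (\<lambda>B'. ext_sum A' (\<lambda>y C. v c p y * \<alpha> c p C B')))"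
    by (simp add: tensor_change_ext_sum_swap)
  finally have "pv_wedge v \<alpha> c' p A B =
      tensor_change ?J A (\<lambda>A'. tensor_change ?K B (\<lambda>B'.
        (-1) ^ length B * ext_sum A' (\<lambda>y C. v c p y * \<alpha> c p C B')))"
    by (simp add: pv_wedge_def tensor_change_scale)
  \<comment> \<open>\<open>tensor_change\<close> evaluates its argument only at lists as long as
    \<open>B\<close>, so the sign may be moved inside as one in \<open>length B'\<close>.\<close>
  also have "\<dots> = tensor_change ?J A (\<lambda>A'. tensor_change ?K B (\<lambda>B'. pv_wedge v \<alpha> c p A' B'))"
    by (intro tensor_change_cong) (simp add: pv_wedge_def)
  finally show "pv_wedge v \<alpha> c' p A B = \<dots>" .
qed

section \<open>The Dolbeault operator\<close>

lemma pv_dbar_ext_sum: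
  "c \<in> \<A> \<Longrightarrow> p \<in> fst c \<Longrightarrow>
    pv_dbar \<A> \<alpha> c p A B = ext_sum B (\<lambda>x C. delbar c x (\<lambda>q. \<alpha> c q A C) p)"
  unfolding pv_dbar_def
  by (simp add: ext_sum_conv[where f = "\<lambda>x C. delbar c x (\<lambda>q. \<alpha> c q A C) p"])

lemma alternating_delbar:
  fixes t :: "'x \<Rightarrow> 'e list \<Rightarrow> complex"
  assumes "c \<in> \<A>" "p \<in> fst c" "\<And>q. alternating (t q)" "\<And>C. chart_diff c (\<lambda>q. t q C) p"
  shows "alternating (\<lambda>C. delbar c x (\<lambda>q. t q C) p)"
  unfolding alternating_def
proof (intro allI impI)
  fix A :: "'e list" and i j assume "i < length A \<and> j < length A \<and> i \<noteq> j"
  then have "(\<lambda>q. t q (A[i := A ! j, j := A ! i])) = (\<lambda>q. (- 1) * t q A)"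
    using assms(3) by (auto simp: alternating_def)
  then show "delbar c x (\<lambda>q. t q (A[i := A ! j, j := A ! i])) p = - delbar c x (\<lambda>q. t q A) p"
    using delbar_scale[OF assms(4,2,1), of x "-1" A] by simp
qed

text \<open>The transformation law is differentiated in the new chart. The matrix of the polyvector
  indices is holomorphic and contributes nothing. The matrix of the form indices contributes second
  derivatives of coordinates, symmetric in the new derivative index and the form index they act on,
  and the alternating sum removes them.\<close>

lemma pv_dbar_tensor_change:
  assumes \<alpha>: "\<alpha> \<in> PV \<A>" and c: "c \<in> \<A>" "c' \<in> \<A>" "p \<in> fst c" "p \<in> fst c'"
  shows "pv_dbar \<A> \<alpha> c' p A B =
    tensor_change (jac c c' p) A (\<lambda>A'. tensor_change (cobar c c' p) B (\<lambda>B'. pv_dbar \<A> \<alpha> c p A' B'))"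
proof -
  let ?J = "jac c c' p" and ?K = "cobar c c' p"
  define N where "N x y z = delbar c' x (\<lambda>q. cobar c c' q y z) p" for x y z
  have Jd: "chart_diff c' (\<lambda>q. jac c c' q a b) p" for a b
    by (rule chart_diff_change[OF c(2,4) c(1,3)]) (rule chart_diff_jac[OF c(1,3) c(2,4)])
  \<comment> \<open>The entries of \<open>jac c c'\<close> are derivatives in the coordinates of
    \<open>c\<close>, so their derivative in \<open>c'\<close> is first rewritten as one in
    \<open>c\<close>.\<close>
  have J0: "delbar c' x (\<lambda>q. jac c c' q a b) p = 0" for x a b
    by (subst delbar_change[OF c(2,4) c(1,3) chart_diff_jac[OF c(1,3) c(2,4)]])
       (simp add: delbar_jac[OF c(1,3) c(2,4)])
  have Kd: "chart_diff c' (\<lambda>q. cobar c c' q a b) p" for a b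
    unfolding cobar_def by (intro chart_diff_cnj chart_diff_jac c)
  \<comment> \<open>\<open>N x y z\<close> is the conjugate of a second derivative, in the
    directions \<open>x\<close> and \<open>y\<close>, of the coordinate \<open>z\<close> of
    \<open>c\<close>.\<close>
  have Nsym: "N x y z = N y x z" for x y z
    unfolding N_def cobar_def
    by (simp add: delbar_cnj chart_diff_jac[OF c(2,4) c(1,3)] del_jac_commute[OF c(2,4) c(1,3), of x z y])
  have \<alpha>d: "chart_diff c' (\<lambda>q. \<alpha> c q A' C) p" for A' C
    by (rule chart_diff_change[OF c(2,4) c(1,3) PV_chart_diff[OF \<alpha> c(1,3)]])
  have \<alpha>1: "delbar c' x (\<lambda>q. \<alpha> c q A' C) p = (\<Sum>y\<in>UNIV. ?K x y * delbar c y (\<lambda>q. \<alpha> c q A' C) p)" for x A' C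
    by (simp add: delbar_change[OF c(2,4) c(1,3) PV_chart_diff[OF \<alpha> c(1,3)]] cobar_def)
  have K1: "delbar c' x (\<lambda>q. tensor_change (cobar c c' q) C (\<lambda>C'. \<alpha> c q A' C')) p =
      tensor_change ?K C (\<lambda>C'. delbar c' x (\<lambda>q. \<alpha> c q A' C') p) +
      tensor_change_deriv ?K (\<lambda>y z. N x y z) C (\<lambda>C'. \<alpha> c p A' C')" for x A' C
    unfolding N_def by (rule delbar_tensor_change[OF c(4,2) Kd \<alpha>d])
  have step: "delbar c' x (\<lambda>q. \<alpha> c' q A C) p =
      tensor_change ?J A (\<lambda>A'. tensor_change ?K C (\<lambda>C'. \<Sum>y\<in>UNIV. ?K x y * delbar c y (\<lambda>q. \<alpha> c q A' C') p)
        + tensor_change_deriv ?K (N x) C (\<lambda>C'. \<alpha> c p A' C'))" for x C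
  proof -
    have "delbar c' x (\<lambda>q. \<alpha> c' q A C) p =
      delbar c' x (\<lambda>q. tensor_change (jac c c' q) A (\<lambda>A'. tensor_change (cobar c c' q) C (\<lambda>C'. \<alpha> c q A' C'))) p"
      by (rule delbar_cong[OF c(2,4) open_chart[OF c(1)] c(3)])
         (rule PV_tensor_change[OF \<alpha> c(1,2)])
    also have "\<dots> = tensor_change ?J A (\<lambda>A'. delbar c' x (\<lambda>q. tensor_change (cobar c c' q) C (\<lambda>C'. \<alpha> c q A' C')) p)"
      by (subst delbar_tensor_change[OF c(4,2) Jd chart_diff_tensor_change[OF Kd \<alpha>d]]) (simp add: J0)
    also have "\<dots> = tensor_change ?J A (\<lambda>A'. tensor_change ?K C (\<lambda>C'. delbar c' x (\<lambda>q. \<alpha> c q A' C') p)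
        + tensor_change_deriv ?K (N x) C (\<lambda>C'. \<alpha> c p A' C'))"
      by (simp add: K1)
    finally show ?thesis by (simp add: \<alpha>1)
  qed
  have "ext_sum B (\<lambda>x C. tensor_change_deriv ?K (N x) C (\<lambda>C'. \<alpha> c p A' C')) =
     ext_sum B (\<lambda>x C. ext_sum C (\<lambda>y D. \<Sum>z\<in>UNIV. N x y z * tensor_change ?K D (\<lambda>E. \<alpha> c p A' (z # E))))" for A'
    by (simp add: tensor_change_deriv_alternating[OF PV_D(3)[OF \<alpha>]])
  also have "\<dots> A' = 0" for A'
    by (rule ext_sum_ext_sum_symmetric) (simp add: Nsym)
  finally have deriv0: "ext_sum B (\<lambda>x C. tensor_change_deriv ?K (N x) C (\<lambda>C'. \<alpha> c p A' C')) = 0" for A' .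
  have "pv_dbar \<A> \<alpha> c' p A B =
      tensor_change ?J A (\<lambda>A'. ext_sum B (\<lambda>x C.
        tensor_change ?K C (\<lambda>C'. \<Sum>y\<in>UNIV. ?K x y * delbar c y (\<lambda>q. \<alpha> c q A' C') p)))"
    by (simp add: pv_dbar_ext_sum[OF c(2,4)] step tensor_change_ext_sum_swap[symmetric] ext_sum_add deriv0)
  also have "\<dots> = tensor_change ?J A (\<lambda>A'. tensor_change ?K B (\<lambda>B'. pv_dbar \<A> \<alpha> c p A' B'))"
    by (simp add: pv_dbar_ext_sum[OF c(1,3)] tensor_change_ext_sum tensor_change_sum tensor_change_scale)
  finally show ?thesis .
qed

lemma pv_dbar_PV:
  assumes \<alpha>: "\<alpha> \<in> PV \<A>"
  shows "pv_dbar \<A> \<alpha> \<in> PV \<A>"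
proof (rule PV_I)
  fix c p A B
  assume "\<not> (c \<in> \<A> \<and> p \<in> fst c)"
  then show "pv_dbar \<A> \<alpha> c p A B = 0" unfolding pv_dbar_def by auto
next
  fix c p B assume c: "c \<in> \<A>" "p \<in> fst c"
  show "alternating (\<lambda>A. pv_dbar \<A> \<alpha> c p A B)"
    unfolding pv_dbar_ext_sum[OF c]
    by (intro alternating_ext_sum_param alternating_delbar c PV_D(2)[OF \<alpha>] PV_chart_diff[OF \<alpha>])
next
  fix c p A assume c: "c \<in> \<A>" "p \<in> fst c"
  show "alternating (\<lambda>B. pv_dbar \<A> \<alpha> c p A B)"
    unfolding pv_dbar_ext_sum[OF c]
    by (intro alternating_ext_sum alternating_delbar c PV_D(3)[OF \<alpha>] PV_chart_diff[OF \<alpha>])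
next
  fix c A B assume c: "c \<in> \<A>"
  have "smooth_in c (\<lambda>p. ext_sum B (\<lambda>x C. delbar c x (\<lambda>q. \<alpha> c q A C) p))"
    by (intro smooth_in_ext_sum smooth_in_delbar c PV_D(4)[OF \<alpha>])
  then show "smooth_in c (\<lambda>p. pv_dbar \<A> \<alpha> c p A B)"
    by (rule smooth_in_cong[OF c, rotated]) (simp add: pv_dbar_ext_sum[OF c])
qed (rule pv_dbar_tensor_change[OF \<alpha>])

lemma pv_dbar_add:
  assumes "\<alpha> \<in> PV \<A>" "\<beta> \<in> PV \<A>"
  shows "pv_dbar \<A> (pv_add \<alpha> \<beta>) = pv_add (pv_dbar \<A> \<alpha>) (pv_dbar \<A> \<beta>)"
proof (intro ext)
  fix c p A B
  show "pv_dbar \<A> (pv_add \<alpha> \<beta>) c p A B = pv_add (pv_dbar \<A> \<alpha>) (pv_dbar \<A> \<beta>) c p A B"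
  proof (cases "c \<in> \<A> \<and> p \<in> fst c")
    case True
    then show ?thesis
      using PV_chart_diff[OF assms(1)] PV_chart_diff[OF assms(2)]
      by (simp add: pv_add_def pv_dbar_ext_sum delbar_add ext_sum_add)
  qed (auto simp: pv_dbar_def pv_add_def)
qed

lemma pv_dbar_pv_dbar:
  assumes \<alpha>: "\<alpha> \<in> PV \<A>"
  shows "pv_dbar \<A> (pv_dbar \<A> \<alpha>) = pv_zero"
proof (intro ext)
  fix c p A B
  show "pv_dbar \<A> (pv_dbar \<A> \<alpha>) c p A B = pv_zero c p A B"
  proof (cases "c \<in> \<A> \<and> p \<in> fst c")
    case True
    then have c: "c \<in> \<A>" "p \<in> fst c" by auto
    have s: "smooth_in c (\<lambda>q. \<alpha> c q A D)" for D by (rule PV_D(4)[OF \<alpha> c(1)])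
    have "delbar c x (\<lambda>q. pv_dbar \<A> \<alpha> c q A C) p =
        ext_sum C (\<lambda>y D. delbar c x (delbar c y (\<lambda>q. \<alpha> c q A D)) p)" for x C
    proof -
      have "delbar c x (\<lambda>q. pv_dbar \<A> \<alpha> c q A C) p =
          delbar c x (\<lambda>q. ext_sum C (\<lambda>y D. delbar c y (\<lambda>q. \<alpha> c q A D) q)) p"
        by (rule delbar_cong[OF c open_chart[OF c(1)] c(2)]) (simp add: pv_dbar_ext_sum c)
      also have "\<dots> = ext_sum C (\<lambda>y D. delbar c x (delbar c y (\<lambda>q. \<alpha> c q A D)) p)"
        by (intro delbar_ext_sum c smooth_in_chart_diff smooth_in_delbar s)
      finally show ?thesis .
    qed
    then have "pv_dbar \<A> (pv_dbar \<A> \<alpha>) c p A B =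
        ext_sum B (\<lambda>x C. ext_sum C (\<lambda>y D. delbar c x (delbar c y (\<lambda>q. \<alpha> c q A D)) p))"
      by (simp add: pv_dbar_ext_sum[OF c])
    also have "\<dots> = 0"
      by (intro ext_sum_ext_sum_symmetric delbar_delbar c smooth_in_smooth_near s)
    finally show ?thesis by (simp add: pv_zero_def)
  qed (auto simp: pv_dbar_def pv_zero_def)
qed

lemma holo_fun_smooth_fun: "holo_fun \<A> f \<Longrightarrow> smooth_fun \<A> f"
  by (simp add: holo_fun_def smooth_fun_def holo_in_smooth_in)

lemma holo_in_iff:
  assumes "c \<in> \<A>"
  shows "holo_in c f \<longleftrightarrow> smooth_in c f \<and>
    (\<forall>p\<in>fst c. \<forall>v. chart_dir c (\<i> *s v) f p = \<i> * chart_dir c v f p)"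
  by (auto simp: holo_in_def holo_on_def smooth_in_def chart_dir_def coord_image_def)

lemma delbar_holo:
  assumes "holo_fun \<A> f" "c \<in> \<A>" "p \<in> fst c"
  shows "delbar c a f p = 0"
proof -
  have "axis a \<i> = \<i> *s (axis a 1 :: complex^'d)" by (simp add: vec_eq_iff axis_def)
  moreover have "holo_in c f" using assms by (simp add: holo_fun_def)
  ultimately show ?thesis using assms by (simp add: delbar_def holo_in_iff)
qed

lemma delbar_del_holo:
  assumes "holo_fun \<A> f" "c \<in> \<A>" "p \<in> fst c"
  shows "delbar c b (del c a f) p = 0"
proof -
  have "smooth_near c f p"
    using assms holo_fun_smooth_fun smooth_in_smooth_near by (auto simp: smooth_fun_def)
  from delbar_del[OF assms(2,3) this]
  have "delbar c b (del c a f) p = del c a (delbar c b f) p" .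
  also have "\<dots> = del c a (\<lambda>q. 0) p"
    by (rule del_cong[OF assms(2,3) open_UNIV]) (auto simp: delbar_holo assms)
  finally show ?thesis by simp
qed

lemma pv_dbar_smult:
  assumes f: "holo_fun \<A> f" and \<alpha>: "\<alpha> \<in> PV \<A>"
  shows "pv_dbar \<A> (pv_smult f \<alpha>) = pv_smult f (pv_dbar \<A> \<alpha>)"
proof (intro ext)
  fix c p A B
  show "pv_dbar \<A> (pv_smult f \<alpha>) c p A B = pv_smult f (pv_dbar \<A> \<alpha>) c p A B"
  proof (cases "c \<in> \<A> \<and> p \<in> fst c")
    case True
    then have c: "c \<in> \<A>" "p \<in> fst c" by auto
    have "chart_diff c f p"
      using holo_fun_smooth_fun[OF f] c smooth_in_chart_diff by (simp add: smooth_fun_def)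
    then have "delbar c x (\<lambda>q. f q * \<alpha> c q A C) p = f p * delbar c x (\<lambda>q. \<alpha> c q A C) p" for x C
      using PV_chart_diff[OF \<alpha> c] by (simp add: delbar_mult c delbar_holo[OF f])
    then show ?thesis by (simp add: pv_smult_def pv_dbar_ext_sum c ext_sum_scale)
  qed (auto simp: pv_dbar_def pv_smult_def)
qed

text \<open>The coefficients of the differential of \<open>W\<close> are holomorphic, so the two
  operators act on separate indices and could only commute; the sign \<open>(-1)^length B\<close> in
  \<open>iota\<close> turns this into anticommutation.\<close>

lemma pv_dbar_iota:
  assumes W: "holo_fun \<A> W" and \<alpha>: "\<alpha> \<in> PV \<A>"
  shows "pv_add (pv_dbar \<A> (iota W \<alpha>)) (iota W (pv_dbar \<A> \<alpha>)) = pv_zero"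
proof (intro ext)
  fix c p A B
  show "pv_add (pv_dbar \<A> (iota W \<alpha>)) (iota W (pv_dbar \<A> \<alpha>)) c p A B = pv_zero c p A B"
  proof (cases "c \<in> \<A> \<and> p \<in> fst c")
    case True
    then have c: "c \<in> \<A>" "p \<in> fst c" by auto
    have Wd: "chart_diff c (del c a W) p" for a
      using W c by (intro smooth_in_chart_diff smooth_in_del)
        (auto simp: holo_fun_def holo_in_smooth_in)
    note \<alpha>d = PV_chart_diff[OF \<alpha> c]
    let ?w = "\<lambda>a. - \<i> * del c a W p"
    have w0: "delbar c x (\<lambda>q. - \<i> * del c a W q) p = 0" for x a
      using delbar_scale[OF Wd c(2,1), of x "- \<i>" a] delbar_del_holo[OF W c] by simp
    have wd: "chart_diff c (\<lambda>q. - \<i> * del c a W q) p" for a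
      by (intro chart_diff_mult chart_diff_const Wd)
    have "delbar c x (\<lambda>q. iota W \<alpha> c q A C) p =
        (-1) ^ length C * (\<Sum>a\<in>UNIV. ?w a * delbar c x (\<lambda>q. \<alpha> c q (a # A) C) p)" for x C
      unfolding iota_def
      by (subst delbar_scale; (intro chart_diff_sum chart_diff_mult wd \<alpha>d c)?)
         (subst delbar_sum, (intro chart_diff_mult wd \<alpha>d), simp only: delbar_mult[OF wd \<alpha>d c(2,1)] w0, simp)
    then have "pv_dbar \<A> (iota W \<alpha>) c p A B = ext_sum B (\<lambda>x C.
        (-1) ^ length C * (\<Sum>a\<in>UNIV. ?w a * delbar c x (\<lambda>q. \<alpha> c q (a # A) C) p))"
      by (simp add: pv_dbar_ext_sum[OF c])
    \<comment> \<open>Inside \<open>ext_sum\<close> the operator \<open>iota\<close> is evaluated at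
      \<open>C\<close>, one entry shorter than \<open>B\<close>. This is the source of the minus
      sign.\<close>
    also have "\<dots> = ext_sum B (\<lambda>x C.
        (- ((-1) ^ length B)) * (\<Sum>a\<in>UNIV. ?w a * delbar c x (\<lambda>q. \<alpha> c q (a # A) C) p))"
    proof (rule ext_sum_cong)
      fix x and C :: "'d list" assume "Suc (length C) = length B"
      then have "length B = Suc (length C)" by simp
      then show "(-1) ^ length C * (\<Sum>a\<in>UNIV. ?w a * delbar c x (\<lambda>q. \<alpha> c q (a # A) C) p) =
          (- ((-1) ^ length B)) * (\<Sum>a\<in>UNIV. ?w a * delbar c x (\<lambda>q. \<alpha> c q (a # A) C) p)"
        by simp
    qed
    also have "\<dots> = - iota W (pv_dbar \<A> \<alpha>) c p A B"
      unfolding ext_sum_scale ext_sum_sum by (simp add: iota_def pv_dbar_ext_sum[OF c])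
    finally show ?thesis by (simp add: pv_add_def pv_zero_def)
  next
    case False
    then have "iota W (pv_dbar \<A> \<alpha>) c p A B = 0" by (auto simp: iota_def pv_dbar_def)
    then show ?thesis using False by (auto simp: pv_dbar_def pv_zero_def pv_add_def)
  qed
qed

section \<open>The differential and the total degree\<close>

lemma delta_PV: "holo_fun \<A> W \<Longrightarrow> \<alpha> \<in> PV \<A> \<Longrightarrow> delta \<A> W \<alpha> \<in> PV \<A>"
  unfolding delta_def by (intro pv_add_PV pv_dbar_PV iota_PV[OF atlas])

lemma delta_add:
  "\<alpha> \<in> PV \<A> \<Longrightarrow> \<beta> \<in> PV \<A> \<Longrightarrow> delta \<A> W (pv_add \<alpha> \<beta>) = pv_add (delta \<A> W \<alpha>) (delta \<A> W \<beta>)"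
  by (simp add: delta_def pv_dbar_add iota_add) (simp add: pv_add_def add_ac)

lemma delta_smult:
  "holo_fun \<A> f \<Longrightarrow> \<alpha> \<in> PV \<A> \<Longrightarrow> delta \<A> W (pv_smult f \<alpha>) = pv_smult f (delta \<A> W \<alpha>)"
  by (simp add: delta_def pv_dbar_smult iota_smult) (simp add: pv_add_def pv_smult_def algebra_simps)

lemma delta_delta:
  assumes W: "holo_fun \<A> W" and \<alpha>: "\<alpha> \<in> PV \<A>"
  shows "delta \<A> W (delta \<A> W \<alpha>) = pv_zero"
proof -
  have "delta \<A> W (delta \<A> W \<alpha>) =
      pv_add (pv_add (pv_dbar \<A> (pv_dbar \<A> \<alpha>)) (iota W (iota W \<alpha>)))
        (pv_add (pv_dbar \<A> (iota W \<alpha>)) (iota W (pv_dbar \<A> \<alpha>)))"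
    using pv_dbar_PV[OF \<alpha>] iota_PV[OF atlas W \<alpha>]
    by (simp add: delta_def pv_dbar_add iota_add) (simp add: pv_add_def add_ac)
  also have "\<dots> = pv_zero"
    by (simp add: pv_dbar_pv_dbar[OF \<alpha>] pv_dbar_iota[OF W \<alpha>] iota_iota[OF PV_D(2)[OF \<alpha>]])
       (simp add: pv_add_def pv_zero_def)
  finally show ?thesis .
qed

lemma pv_dbar_deg:
  assumes \<alpha>: "\<alpha> \<in> PV_deg \<A> k" and nz: "pv_dbar \<A> \<alpha> c p A B \<noteq> 0"
  shows "- int (length A) + int (length B) = k + 1"
proof (rule ccontr)
  assume ne: "- int (length A) + int (length B) \<noteq> k + 1"
  have "\<alpha> c q A C = 0" if "Suc (length C) = length B" for q C
  proof (rule ccontr)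
    assume "\<alpha> c q A C \<noteq> 0"
    then have "- int (length A) + int (length C) = k" using \<alpha> unfolding PV_deg_def by blast
    then show False using ne that by linarith
  qed
  then have "ext_sum B (\<lambda>x C. delbar c x (\<lambda>q. \<alpha> c q A C) p) = 0"
    by (intro ext_sum_neutral) simp
  moreover have "c \<in> \<A>" "p \<in> fst c" using nz unfolding pv_dbar_def by presburger+
  ultimately show False using nz pv_dbar_ext_sum by metis
qed

lemma PV_degI:
  "\<alpha> \<in> PV \<A> \<Longrightarrow> (\<And>c p A B. \<alpha> c p A B \<noteq> 0 \<Longrightarrow> - int (length A) + int (length B) = k) \<Longrightarrow>
    \<alpha> \<in> PV_deg \<A> k"
  by (simp add: PV_deg_def)

lemma PV_degD:
  "\<alpha> \<in> PV_deg \<A> k \<Longrightarrow> \<alpha> \<in> PV \<A>"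
  "\<alpha> \<in> PV_deg \<A> k \<Longrightarrow> - int (length A) + int (length B) \<noteq> k \<Longrightarrow> \<alpha> c p A B = 0"
  unfolding PV_deg_def by blast+

lemma delta_deg:
  assumes W: "holo_fun \<A> W" and \<alpha>: "\<alpha> \<in> PV_deg \<A> k"
  shows "delta \<A> W \<alpha> \<in> PV_deg \<A> (k + 1)"
proof (rule PV_degI)
  show "delta \<A> W \<alpha> \<in> PV \<A>" using delta_PV[OF W] PV_degD(1)[OF \<alpha>] .
  fix c p A B assume "delta \<A> W \<alpha> c p A B \<noteq> 0"
  then consider "pv_dbar \<A> \<alpha> c p A B \<noteq> 0" | "iota W \<alpha> c p A B \<noteq> 0"
    by (cases "pv_dbar \<A> \<alpha> c p A B = 0") (auto simp: delta_def pv_add_def)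
  then show "- int (length A) + int (length B) = k + 1"
  proof cases
    case 1
    then show ?thesis by (rule pv_dbar_deg[OF \<alpha>])
  next
    case 2
    then obtain a where "\<alpha> c p (a # A) B \<noteq> 0"
      unfolding iota_def by (metis (no_types, lifting) mult_zero_right sum.neutral)
    then have "- int (length (a # A)) + int (length B) = k" using \<alpha> unfolding PV_deg_def by blast
    then show ?thesis by simp
  qed
qed

lemma pv_wedge_deg:
  assumes v: "vector_field \<A> v" and \<alpha>: "\<alpha> \<in> PV_deg \<A> k"
  shows "pv_wedge v \<alpha> \<in> PV_deg \<A> (k - 1)"
proof (rule PV_degI)
  show "pv_wedge v \<alpha> \<in> PV \<A>" using pv_wedge_PV[OF v] PV_degD(1)[OF \<alpha>] .
  fix c p A B assume nz: "pv_wedge v \<alpha> c p A B \<noteq> 0"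
  show "- int (length A) + int (length B) = k - 1"
  proof (rule ccontr)
    assume ne: "- int (length A) + int (length B) \<noteq> k - 1"
    have "ext_sum A (\<lambda>x C. v c p x * \<alpha> c p C B) = 0"
      by (rule ext_sum_neutral) (use ne in \<open>auto simp: PV_degD(2)[OF \<alpha>]\<close>)
    then show False using nz by (simp add: pv_wedge_def)
  qed
qed

section \<open>Vanishing on open sets and compact supports\<close>

definition pv_vanishes :: "('x, 'd) pv \<Rightarrow> 'x set \<Rightarrow> bool" where
  "pv_vanishes \<alpha> U \<longleftrightarrow> (\<forall>c. \<forall>p\<in>U. \<forall>A B. \<alpha> c p A B = 0)"

lemma pv_vanishesI: "(\<And>c p A B. p \<in> U \<Longrightarrow> \<alpha> c p A B = 0) \<Longrightarrow> pv_vanishes \<alpha> U"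
  unfolding pv_vanishes_def by blast

lemma pv_vanishesD: "pv_vanishes \<alpha> U \<Longrightarrow> p \<in> U \<Longrightarrow> \<alpha> c p A B = 0"
  unfolding pv_vanishes_def by blast

lemma delta_vanishes:
  assumes "open U" "pv_vanishes \<alpha> U"
  shows "pv_vanishes (delta \<A> W \<alpha>) U"
  unfolding pv_vanishes_def
proof (intro allI ballI)
  fix c p A B assume p: "p \<in> U"
  have "pv_dbar \<A> \<alpha> c p A B = 0"
  proof (cases "c \<in> \<A> \<and> p \<in> fst c")
    case True
    then have c: "c \<in> \<A>" "p \<in> fst c" by auto
    have "delbar c x (\<lambda>q. \<alpha> c q A C) p = delbar c x (\<lambda>q. 0) p" for x C
      by (rule delbar_cong[OF c assms(1) p]) (use assms(2) in \<open>unfold pv_vanishes_def, blast\<close>)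
    then show ?thesis by (simp add: pv_dbar_ext_sum c)
  qed (auto simp: pv_dbar_def)
  moreover have "iota W \<alpha> c p A B = 0" by (simp add: iota_def pv_vanishesD[OF assms(2) p])
  ultimately show "delta \<A> W \<alpha> c p A B = 0" by (simp add: delta_def pv_add_def)
qed

lemma pv_wedge_vanishes: "pv_vanishes \<alpha> U \<Longrightarrow> pv_vanishes (pv_wedge v \<alpha>) U"
  by (rule pv_vanishesI) (simp add: pv_wedge_def pv_vanishesD)

lemma PVcI:
  assumes "\<alpha> \<in> PV \<A>" "compact K" "pv_vanishes \<alpha> (- K)"
  shows "\<alpha> \<in> PVc \<A>"
proof -
  have "{p. \<exists>c A B. \<alpha> c p A B \<noteq> 0} \<subseteq> K" using assms(3) unfolding pv_vanishes_def by blast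
  then have "pv_support \<alpha> \<subseteq> K"
    unfolding pv_support_def using assms(2) by (simp add: closure_minimal compact_imp_closed)
  moreover have "closed (pv_support \<alpha>)" by (simp add: pv_support_def)
  ultimately show ?thesis
    using assms(1,2) compact_Int_closed[of K "pv_support \<alpha>"] by (simp add: PVc_def Int_absorb1)
qed

lemma PVc_vanishes: "pv_vanishes \<alpha> (- pv_support \<alpha>)"
proof (rule pv_vanishesI)
  fix c p A B assume p: "p \<in> - pv_support \<alpha>"
  have "{p. \<exists>c A B. \<alpha> c p A B \<noteq> 0} \<subseteq> pv_support \<alpha>"
    unfolding pv_support_def by (rule closure_subset)
  then show "\<alpha> c p A B = 0" using p by blast
qed

lemma PVcD: "\<alpha> \<in> PVc \<A> \<Longrightarrow> \<alpha> \<in> PV \<A>" "\<alpha> \<in> PVc \<A> \<Longrightarrow> compact (pv_support \<alpha>)"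
  by (simp_all add: PVc_def)

text \<open>A local operator cannot enlarge supports. Locality is expressed through open zero sets,
  which avoids computing with closures.\<close>

lemma PVc_local:
  assumes "\<alpha> \<in> PVc \<A>" "\<beta> \<in> PV \<A>" "\<And>U. open U \<Longrightarrow> pv_vanishes \<alpha> U \<Longrightarrow> pv_vanishes \<beta> U"
  shows "\<beta> \<in> PVc \<A>"
proof (rule PVcI[OF assms(2) PVcD(2)[OF assms(1)]])
  have "open (- pv_support \<alpha>)" by (simp add: pv_support_def open_Compl)
  then show "pv_vanishes \<beta> (- pv_support \<alpha>)" by (rule assms(3)[OF _ PVc_vanishes])
qed

end


section \<open>The differential graded modules of polyvector-valued forms\<close>

text \<open>Covers \<open>PV_dg\<close> and \<open>PVc_dg\<close> together, so that the axioms are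
  verified only once.\<close>

definition PV_sub_dg ::
    "('x, 'd::finite) chart set \<Rightarrow> ('x \<Rightarrow> complex) \<Rightarrow> ('x, 'd) pv set \<Rightarrow>
     ('x \<Rightarrow> complex, ('x, 'd) pv) dg_mod" where
  "PV_sub_dg \<A> W S = (PV_dg \<A> W)\<lparr>carrier := S, grade := (\<lambda>k. PV_deg \<A> k \<inter> S)\<rparr>"

lemma PV_sub_dg_simps [simp]:
  "carrier (PV_sub_dg \<A> W S) = S"
  "grade (PV_sub_dg \<A> W S) k = PV_deg \<A> k \<inter> S"
  "differential (PV_sub_dg \<A> W S) = delta \<A> W"
  "\<alpha> \<oplus>\<^bsub>PV_sub_dg \<A> W S\<^esub> \<beta> = pv_add \<alpha> \<beta>"
  "\<zero>\<^bsub>PV_sub_dg \<A> W S\<^esub> = pv_zero"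
  "f \<odot>\<^bsub>PV_sub_dg \<A> W S\<^esub> \<alpha> = pv_smult f \<alpha>"
  by (simp_all add: PV_sub_dg_def PV_dg_def)

lemma PV_dg_eq_sub: "PV_dg \<A> W = PV_sub_dg \<A> W (PV \<A>)"
proof -
  have "PV_deg \<A> k \<inter> PV \<A> = PV_deg \<A> k" for k by (auto simp: PV_deg_def)
  then show ?thesis by (simp add: PV_sub_dg_def PV_dg_def)
qed

lemma PVc_dg_eq_sub: "PVc_dg \<A> W = PV_sub_dg \<A> W (PVc \<A>)"
  by (simp add: PV_sub_dg_def PVc_dg_def)

lemma holo_ring_simps [simp]:
  "carrier (holo_ring \<A>) = {f. holo_fun \<A> f}"
  "f \<otimes>\<^bsub>holo_ring \<A>\<^esub> g = (\<lambda>p. f p * g p)"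
  "f \<oplus>\<^bsub>holo_ring \<A>\<^esub> g = (\<lambda>p. f p + g p)"
  "\<zero>\<^bsub>holo_ring \<A>\<^esub> = (\<lambda>p. 0)"
  "\<one>\<^bsub>holo_ring \<A>\<^esub> = (\<lambda>p. 1)"
  by (simp_all add: holo_ring_def)

context complex_manifold
begin

lemma holo_fun_const: "holo_fun \<A> (\<lambda>p. r)"
  by (auto simp: holo_fun_def holo_in_iff smooth_in_const chart_dir_const)

lemma holo_fun_add: "holo_fun \<A> f \<Longrightarrow> holo_fun \<A> g \<Longrightarrow> holo_fun \<A> (\<lambda>p. f p + g p)"
  by (auto simp: holo_fun_def holo_in_iff smooth_in_add chart_dir_add smooth_in_chart_diff algebra_simps)

lemma holo_fun_mult: "holo_fun \<A> f \<Longrightarrow> holo_fun \<A> g \<Longrightarrow> holo_fun \<A> (\<lambda>p. f p * g p)"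
  by (auto simp: holo_fun_def holo_in_iff smooth_in_mult chart_dir_mult smooth_in_chart_diff algebra_simps)

lemma cring_holo_ring: "cring (holo_ring \<A>)"
proof (rule cringI)
  show "abelian_group (holo_ring \<A>)"
  proof (rule abelian_groupI)
    fix f assume "f \<in> carrier (holo_ring \<A>)"
    then have "holo_fun \<A> (\<lambda>p. (- 1) * f p)" by (intro holo_fun_mult holo_fun_const) simp
    then show "\<exists>g\<in>carrier (holo_ring \<A>). g \<oplus>\<^bsub>holo_ring \<A>\<^esub> f = \<zero>\<^bsub>holo_ring \<A>\<^esub>"
      by (intro bexI[of _ "\<lambda>p. (- 1) * f p"]) auto
  qed (auto simp: holo_fun_const holo_fun_add add_ac)
  show "comm_monoid (holo_ring \<A>)"
    by (rule comm_monoidI) (auto simp: holo_fun_const holo_fun_mult mult_ac)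
qed (auto simp: algebra_simps)

text \<open>Negation is \<open>pv_smult\<close> by the constant -1. Truncation is included because
  the homogeneous components of an element have to stay in \<open>S\<close>.\<close>

definition dg_closed :: "('x \<Rightarrow> complex) \<Rightarrow> ('x, 'd) pv set \<Rightarrow> bool" where
  "dg_closed W S \<longleftrightarrow> S \<subseteq> PV \<A> \<and> pv_zero \<in> S \<and> (\<forall>\<alpha>\<in>S. \<forall>\<beta>\<in>S. pv_add \<alpha> \<beta> \<in> S) \<and>
     (\<forall>f. \<forall>\<alpha>\<in>S. holo_fun \<A> f \<longrightarrow> pv_smult f \<alpha> \<in> S) \<and>
     (\<forall>\<alpha>\<in>S. delta \<A> W \<alpha> \<in> S) \<and> (\<forall>\<alpha>\<in>S. \<forall>k. pv_truncate k \<alpha> \<in> S)"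

lemma dg_closed_PV:
  assumes "holo_fun \<A> W" shows "dg_closed W (PV \<A>)"
  by (simp add: dg_closed_def pv_zero_PV pv_add_PV pv_smult_PV holo_fun_smooth_fun
      delta_PV[OF assms] pv_truncate_PV)

lemma dg_closed_PVc:
  assumes W: "holo_fun \<A> W" shows "dg_closed W (PVc \<A>)"
  unfolding dg_closed_def
proof (intro conjI ballI allI impI)
  show "PVc \<A> \<subseteq> PV \<A>" using PVcD by blast
  show "pv_zero \<in> PVc \<A>"
    by (rule PVcI[OF pv_zero_PV compact_empty]) (simp add: pv_vanishesI pv_zero_def)
  fix \<alpha> assume \<alpha>: "\<alpha> \<in> PVc \<A>"
  note PV = PVcD(1)[OF \<alpha>]
  show "pv_add \<alpha> \<beta> \<in> PVc \<A>" if \<beta>: "\<beta> \<in> PVc \<A>" for \<beta>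
  proof (rule PVcI[OF pv_add_PV[OF PV PVcD(1)[OF \<beta>]]])
    show "compact (pv_support \<alpha> \<union> pv_support \<beta>)" using PVcD(2) \<alpha> \<beta> by blast
    show "pv_vanishes (pv_add \<alpha> \<beta>) (- (pv_support \<alpha> \<union> pv_support \<beta>))"
      by (rule pv_vanishesI) (simp add: pv_add_def pv_vanishesD[OF PVc_vanishes])
  qed
  show "pv_smult f \<alpha> \<in> PVc \<A>" if "holo_fun \<A> f" for f
    by (rule PVc_local[OF \<alpha> pv_smult_PV[OF PV holo_fun_smooth_fun[OF that]]])
       (rule pv_vanishesI, simp add: pv_smult_def pv_vanishesD)
  show "delta \<A> W \<alpha> \<in> PVc \<A>"
    by (rule PVc_local[OF \<alpha> delta_PV[OF W PV]]) (rule delta_vanishes)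
  show "pv_truncate k \<alpha> \<in> PVc \<A>" for k
    by (rule PVc_local[OF \<alpha> pv_truncate_PV[OF PV]])
       (rule pv_vanishesI, simp add: pv_truncate_def pv_vanishesD)
qed

lemma dg_closedD:
  assumes "dg_closed W S"
  shows "\<alpha> \<in> S \<Longrightarrow> \<alpha> \<in> PV \<A>" "pv_zero \<in> S" "\<alpha> \<in> S \<Longrightarrow> \<beta> \<in> S \<Longrightarrow> pv_add \<alpha> \<beta> \<in> S"
    "holo_fun \<A> f \<Longrightarrow> \<alpha> \<in> S \<Longrightarrow> pv_smult f \<alpha> \<in> S"
    "\<alpha> \<in> S \<Longrightarrow> delta \<A> W \<alpha> \<in> S" "\<alpha> \<in> S \<Longrightarrow> pv_truncate k \<alpha> \<in> S"
  using assms unfolding dg_closed_def by blast+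

lemma module_PV_sub_dg:
  assumes S: "dg_closed W S"
  shows "Module.module (holo_ring \<A>) (PV_sub_dg \<A> W S)"
proof (rule moduleI[OF cring_holo_ring])
  show "abelian_group (PV_sub_dg \<A> W S)"
  proof (rule abelian_groupI)
    fix \<alpha> assume "\<alpha> \<in> carrier (PV_sub_dg \<A> W S)"
    then show "\<exists>\<beta>\<in>carrier (PV_sub_dg \<A> W S). \<beta> \<oplus>\<^bsub>PV_sub_dg \<A> W S\<^esub> \<alpha> = \<zero>\<^bsub>PV_sub_dg \<A> W S\<^esub>"
      using dg_closedD(4)[OF S holo_fun_const[of "-1"]]
      by (intro bexI[of _ "pv_smult (\<lambda>_. -1) \<alpha>"]) (auto simp: pv_add_def pv_smult_def pv_zero_def)
  qed (use dg_closedD[OF S] in \<open>simp_all add: pv_add_def pv_zero_def add_ac\<close>)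
qed (use dg_closedD[OF S] in \<open>simp_all add: pv_add_def pv_smult_def algebra_simps\<close>)

lemma submodule_PV_deg:
  assumes S: "dg_closed W S"
  shows "submodule (PV_deg \<A> k \<inter> S) (holo_ring \<A>) (PV_sub_dg \<A> W S)"
proof -
  interpret M: Module.module "holo_ring \<A>" "PV_sub_dg \<A> W S" by (rule module_PV_sub_dg[OF S])
  have smult: "pv_smult f \<alpha> \<in> PV_deg \<A> k \<inter> S" if "\<alpha> \<in> PV_deg \<A> k \<inter> S" "holo_fun \<A> f" for f \<alpha>
  proof -
    have "pv_smult f \<alpha> \<in> S" using that dg_closedD(4)[OF S] by blast
    moreover from this have "pv_smult f \<alpha> \<in> PV_deg \<A> k"
      using that dg_closedD(1)[OF S] by (intro PV_degI) (auto simp: pv_smult_def PV_deg_def)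
    ultimately show ?thesis by blast
  qed
  show ?thesis
  proof (rule M.submoduleI)
    show "\<zero>\<^bsub>PV_sub_dg \<A> W S\<^esub> \<in> PV_deg \<A> k \<inter> S"
      using dg_closedD(1,2)[OF S] by (auto intro!: PV_degI simp: pv_zero_def)
    show "a \<odot>\<^bsub>PV_sub_dg \<A> W S\<^esub> x \<in> PV_deg \<A> k \<inter> S"
      if "a \<in> carrier (holo_ring \<A>)" "x \<in> PV_deg \<A> k \<inter> S" for a x
      using smult that by simp
    fix a assume a: "a \<in> PV_deg \<A> k \<inter> S"
    show "a \<oplus>\<^bsub>PV_sub_dg \<A> W S\<^esub> b \<in> PV_deg \<A> k \<inter> S" if b: "b \<in> PV_deg \<A> k \<inter> S" for b
    proof -
      have "pv_add a b \<in> S" using a b dg_closedD(3)[OF S] by blast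
      moreover from this have "pv_add a b \<in> PV_deg \<A> k"
      proof (intro PV_degI)
        fix c p A B assume "pv_add a b c p A B \<noteq> 0"
        then have "a c p A B \<noteq> 0 \<or> b c p A B \<noteq> 0" by (auto simp: pv_add_def)
        then show "- int (length A) + int (length B) = k"
          using a b unfolding PV_deg_def by blast
      qed (use dg_closedD(1)[OF S] in blast)
      ultimately show ?thesis by simp
    qed
    have "pv_smult (\<lambda>_. - 1) a \<in> PV_deg \<A> k \<inter> S" by (rule smult[OF a holo_fun_const])
    moreover have "\<ominus>\<^bsub>PV_sub_dg \<A> W S\<^esub> a = pv_smult (\<lambda>_. - 1) a"
      using a calculation
      by (intro M.minus_equality) (auto simp: pv_add_def pv_smult_def pv_zero_def)
    ultimately show "\<ominus>\<^bsub>PV_sub_dg \<A> W S\<^esub> a \<in> PV_deg \<A> k \<inter> S" by simp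
  qed auto
qed

lemma finsum_PV_sub_dg:
  assumes S: "dg_closed W S" and "finite F" "\<And>k. k \<in> F \<Longrightarrow> g k \<in> S"
  shows "finsum (PV_sub_dg \<A> W S) g F c p A B = (\<Sum>k\<in>F. g k c p A B)"
proof -
  interpret M: Module.module "holo_ring \<A>" "PV_sub_dg \<A> W S" by (rule module_PV_sub_dg[OF S])
  show ?thesis using assms(2,3)
  proof (induction F rule: finite_induct)
    case empty
    show ?case by (simp add: pv_zero_def)
  next
    case (insert k F)
    have "finsum (PV_sub_dg \<A> W S) g (insert k F) = pv_add (g k) (finsum (PV_sub_dg \<A> W S) g F)"
      using M.finsum_insert[of F k g] insert by auto
    then show ?case using insert by (simp add: pv_add_def)
  qed
qed

lemma is_graded_module_PV_sub_dg:
  assumes S: "dg_closed W S"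
  shows "is_graded_module (holo_ring \<A>) (PV_sub_dg \<A> W S)"
  unfolding is_graded_module_def
proof (intro conjI allI ballI)
  let ?M = "PV_sub_dg \<A> W S"
  show "Module.module (holo_ring \<A>) ?M" by (rule module_PV_sub_dg[OF S])
  show "submodule (grade ?M k) (holo_ring \<A>) ?M" for k using submodule_PV_deg[OF S] by simp
  fix x assume "x \<in> carrier ?M"
  then have x: "x \<in> S" by simp
  let ?g = "\<lambda>k. pv_truncate k x"
  note PVx = dg_closedD(1)[OF S x]
  have fin: "finite {k. ?g k \<noteq> \<zero>\<^bsub>?M\<^esub>}"
  proof (rule finite_subset)
    \<comment> \<open>A nonzero component has both index lists of length at most
      \<open>CARD('d)\<close>, which confines the degree.\<close>
    show "{k. ?g k \<noteq> \<zero>\<^bsub>?M\<^esub>} \<subseteq> {- int CARD('d) .. int CARD('d)}"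
    proof
      fix k assume "k \<in> {k. ?g k \<noteq> \<zero>\<^bsub>?M\<^esub>}"
      then obtain c p A B where nz: "?g k c p A B \<noteq> 0" by (auto simp: pv_zero_def fun_eq_iff)
      then have "- int (length A) + int (length B) = k" "x c p A B \<noteq> 0"
        unfolding pv_truncate_def by presburger+
      moreover from this have "length A \<le> CARD('d)" "length B \<le> CARD('d)"
        using PV_length[OF PVx] by (meson not_le)+
      ultimately show "k \<in> {- int CARD('d) .. int CARD('d)}" by simp
    qed
  qed simp
  \<comment> \<open>At given index lists only one degree can contribute. Existence and uniqueness of
    the decomposition both follow from this formula.\<close>
  have sum: "finsum ?M g {k. g k \<noteq> \<zero>\<^bsub>?M\<^esub>} c p A B = g (- int (length A) + int (length B)) c p A B"
    if g: "\<And>k. g k \<in> grade ?M k" and f: "finite {k. g k \<noteq> \<zero>\<^bsub>?M\<^esub>}" for g c p A B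
  proof -
    have "finsum ?M g {k. g k \<noteq> \<zero>\<^bsub>?M\<^esub>} c p A B = (\<Sum>k\<in>{k. g k \<noteq> \<zero>\<^bsub>?M\<^esub>}. g k c p A B)"
      using g by (intro finsum_PV_sub_dg[OF S f]) simp
    also have "\<dots> = (\<Sum>k\<in>{k. g k \<noteq> \<zero>\<^bsub>?M\<^esub>}.
        if k = - int (length A) + int (length B) then g k c p A B else 0)"
      using g PV_degD(2)[of _ _ A B c p] by (intro sum.cong refl) force
    also have "\<dots> = g (- int (length A) + int (length B)) c p A B"
      using f by (simp add: pv_zero_def)
    finally show ?thesis .
  qed
  have gr: "?g k \<in> grade ?M k" for k
    using dg_closedD(6)[OF S x] dg_closedD(1)[OF S]
    by (auto intro!: PV_degI simp: pv_truncate_def split: if_splits)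
  show "\<exists>!g. (\<forall>k. g k \<in> grade ?M k) \<and> finite {k. g k \<noteq> \<zero>\<^bsub>?M\<^esub>} \<and>
      x = (\<Oplus>\<^bsub>?M\<^esub>k\<in>{k. g k \<noteq> \<zero>\<^bsub>?M\<^esub>}. g k)"
  proof (rule ex1I[of _ ?g], intro conjI allI gr fin)
    show "x = (\<Oplus>\<^bsub>?M\<^esub>k\<in>{k. ?g k \<noteq> \<zero>\<^bsub>?M\<^esub>}. ?g k)"
      by (intro ext, subst sum[OF gr fin]) (simp add: pv_truncate_def)
  next
    fix g assume g: "(\<forall>k. g k \<in> grade ?M k) \<and> finite {k. g k \<noteq> \<zero>\<^bsub>?M\<^esub>} \<and>
      x = (\<Oplus>\<^bsub>?M\<^esub>k\<in>{k. g k \<noteq> \<zero>\<^bsub>?M\<^esub>}. g k)"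
    then have x_eq: "x c p A B = g (- int (length A) + int (length B)) c p A B" for c p A B
      using sum[of g] by metis
    show "g = ?g"
    proof (intro ext)
      fix k c p A B
      have "g k \<in> PV_deg \<A> k" using g by simp
      then show "g k c p A B = ?g k c p A B"
        using PV_degD(2)[of "g k" k A B c p] by (auto simp: pv_truncate_def x_eq)
    qed
  qed
qed

lemma is_dg_module_PV_sub_dg:
  assumes W: "holo_fun \<A> W" and S: "dg_closed W S"
  shows "is_dg_module (holo_ring \<A>) (PV_sub_dg \<A> W S)"
  unfolding is_dg_module_def graded_hom_def
  using is_graded_module_PV_sub_dg[OF S] dg_closedD[OF S] delta_add delta_smult
    delta_deg[OF W] delta_delta[OF W]
  by simp

lemma graded_hom_pv_wedge:
  assumes v: "vector_field \<A> v" and "\<And>\<alpha>. \<alpha> \<in> S \<Longrightarrow> pv_wedge v \<alpha> \<in> S"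
  shows "graded_hom (holo_ring \<A>) (PV_sub_dg \<A> W S) (PV_sub_dg \<A> W S) (- 1) (pv_wedge v)"
  unfolding graded_hom_def using assms(2) pv_wedge_deg[OF v]
  by (simp add: pv_wedge_add pv_wedge_smult)


section \<open>Cutoff functions\<close>

text \<open>Positivity on \<open>C\<close> rather than the value 1 is asked, as \<rho> is only added
  to a denominator. The values are complex, though real in fact, because \<open>smooth_fun\<close>
  is about complex functions.\<close>

definition cutoff_fun :: "'x set \<Rightarrow> 'x set \<Rightarrow> ('x \<Rightarrow> complex) \<Rightarrow> bool" where
  "cutoff_fun C K \<rho> \<longleftrightarrow> smooth_fun \<A> \<rho> \<and> (\<forall>q. \<rho> q \<in> \<real> \<and> Re (\<rho> q) \<ge> 0) \<and>
     (\<forall>q. q \<notin> K \<longrightarrow> \<rho> q = 0) \<and> (\<forall>q\<in>C. Re (\<rho> q) > 0)"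

lemma local_cutoff:
  assumes c: "c \<in> \<A>" "p \<in> fst c"
  shows "\<exists>U K \<rho>. open U \<and> p \<in> U \<and> compact K \<and> cutoff_fun U K \<rho>"
proof -
  let ?z = "snd c p"
  obtain r where r: "r > 0" "cball ?z r \<subseteq> coord_image c"
    using open_coord_image[OF c(1)] coord_in_image[OF c(2)] open_contains_cball by blast
  \<comment> \<open>This is \<open>r^2 - |z - ?z|^2\<close>, written as a polynomial in the
    coordinates and their conjugates so that its smoothness follows from sums and products. It is
    positive exactly on the open ball of radius \<open>r\<close>, and so is
    \<open>flat_exp 1\<close> of it.\<close>
  define u where "u z = complex_of_real (r\<^sup>2) - (\<Sum>a\<in>UNIV. (z $ a - ?z $ a) * cnj (z $ a - ?z $ a))"
    for z :: "complex^'d"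
  define \<rho> where "\<rho> q = (if q \<in> fst c then complex_of_real (flat_exp 1 (Re (u (snd c q)))) else 0)" for q
  define K where "K = coord_inv c ` cball ?z r"
  define U where "U = fst c \<inter> snd c -` ball ?z r"
  have Re_u: "Re (u z) = r\<^sup>2 - (dist ?z z)\<^sup>2" for z
  proof -
    have "(dist ?z z)\<^sup>2 = (\<Sum>a\<in>UNIV. (cmod (z $ a - ?z $ a))\<^sup>2)"
      by (simp add: dist_norm norm_vec_def L2_set_def sum_nonneg norm_minus_commute)
    moreover have "(\<Sum>a\<in>UNIV. (z $ a - ?z $ a) * cnj (z $ a - ?z $ a)) =
        complex_of_real (\<Sum>a\<in>UNIV. (cmod (z $ a - ?z $ a))\<^sup>2)"
      by (simp only: of_real_sum complex_norm_square)
    ultimately show ?thesis by (simp add: u_def)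
  qed
  have K_sub: "K \<subseteq> fst c" unfolding K_def using r(2) coord_inv_in by blast
  have "continuous_on (coord_image c) (coord_inv c)"
    using chart_homeomorphism[OF c(1)] by (simp add: homeomorphism_def)
  then have K: "compact K"
    unfolding K_def by (intro compact_continuous_image continuous_on_subset[OF _ r(2)] compact_cball)
  have "continuous_on (fst c) (snd c)"
    using chart_homeomorphism[OF c(1)] by (simp add: homeomorphism_def)
  then have U: "open U" unfolding U_def
    by (rule continuous_open_preimage) (simp_all add: open_chart c)
  have zero: "\<rho> q = 0" if "q \<notin> K" for q
  proof (cases "q \<in> fst c")
    case True
    have "snd c q \<notin> cball ?z r"
      using that coord_inv_coord[OF c(1) True] unfolding K_def by (metis imageI)
    then have "Re (u (snd c q)) < 0"
      unfolding Re_u using r(1) by (simp add: power_strict_mono)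
    then show ?thesis by (simp add: \<rho>_def flat_exp_def)
  qed (simp add: \<rho>_def)
  have pos: "Re (\<rho> q) > 0" if "q \<in> U" for q
  proof -
    have "Re (u (snd c q)) > 0"
      using that r(1) unfolding Re_u by (simp add: U_def power_strict_mono)
    then show ?thesis using that by (simp add: \<rho>_def U_def flat_exp_def)
  qed
  have "smooth_in c' \<rho>" if c': "c' \<in> \<A>" for c'
  proof (rule smooth_inI)
    fix k
    \<comment> \<open>The domain of \<open>c'\<close> is covered by its overlap with
      \<open>c\<close>, where the formula for \<rho> holds, and the complement of \<open>K\<close>,
      where \<rho> is 0. The complement is open because compact sets of a Hausdorff space are
      closed.\<close>
    let ?O = "snd c' ` (fst c' \<inter> fst c)" and ?Z = "snd c' ` (fst c' \<inter> - K)"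
    have O: "open ?O" by (rule open_overlap[OF c' c(1)])
    have Z: "open ?Z" using K by (intro open_coord_preimage c') (simp add: compact_imp_closed open_Compl)
    have T: "Ck_on k ?O (\<lambda>z. snd c (coord_inv c' z) $ a)" for a k
      using atlas c(1) c' by (auto simp: complex_atlas_def holo_on_def smooth_on_def)
    have "Ck_on k ?O (\<lambda>z. u (snd c (coord_inv c' z)))" for k
      unfolding u_def
      by (intro Ck_on_diff Ck_on_const Ck_on_sum Ck_on_mult Ck_on_bounded_linear[OF _ bounded_linear_cnj] T O)
    from Ck_on_flat_exp[OF O this] have "Ck_on k ?O (\<lambda>z. \<rho> (coord_inv c' z))"
      by (rule Ck_on_cong[OF O, rotated]) (auto simp: \<rho>_def coord_inv_coord c')
    moreover have "Ck_on k ?Z (\<lambda>z. \<rho> (coord_inv c' z))"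
      by (rule Ck_on_cong[OF Z _ Ck_on_const[of _ _ 0]]) (auto simp: zero coord_inv_coord c')
    moreover have "coord_image c' = ?O \<union> ?Z" using K_sub by (auto simp: coord_image_def)
    ultimately show "Ck_on k (coord_image c') (\<lambda>z. \<rho> (coord_inv c' z))"
      by (simp add: Ck_on_Un O Z)
  qed
  then have "cutoff_fun U K \<rho>"
    unfolding cutoff_fun_def smooth_fun_def using zero pos
    by (auto simp: \<rho>_def flat_exp_def)
  moreover have "p \<in> U" using c r by (simp add: U_def)
  ultimately show ?thesis using U K by blast
qed

text \<open>Local cutoffs on a finite cover of \<open>C\<close> are added; since none of them is
  negative, the sum is positive wherever one summand is.\<close>

lemma cutoff_exists:
  assumes "compact C"
  shows "\<exists>K \<rho>. compact K \<and> cutoff_fun C K \<rho>"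
proof -
  define P where "P U \<longleftrightarrow> (\<exists>K \<rho>. compact K \<and> cutoff_fun U K \<rho>)" for U
  have "\<exists>U. open U \<and> p \<in> U \<and> P U" for p
  proof -
    obtain c where "c \<in> \<A>" "p \<in> fst c" using chart_exists by blast
    from local_cutoff[OF this] show ?thesis unfolding P_def by blast
  qed
  then have "C \<subseteq> \<Union>{U. open U \<and> P U}" by blast
  with assms obtain D where D: "D \<subseteq> {U. open U \<and> P U}" "finite D" "C \<subseteq> \<Union>D"
    by (rule compactE) blast
  from D(2,1) have "P (\<Union>D)"
  proof (induction D rule: finite_induct)
    case empty
    have "cutoff_fun {} {} (\<lambda>q. 0)"
      by (simp add: cutoff_fun_def smooth_fun_def smooth_in_const)
    then show ?case unfolding P_def using compact_empty by (metis Union_empty)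
  next
    case (insert U D)
    then obtain K L \<rho> \<sigma> where 1: "compact K" "cutoff_fun U K \<rho>" and 2: "compact L" "cutoff_fun (\<Union>D) L \<sigma>"
      unfolding P_def by auto
    have "cutoff_fun (\<Union>(insert U D)) (K \<union> L) (\<lambda>q. \<rho> q + \<sigma> q)"
      using 1(2) 2(2) unfolding cutoff_fun_def smooth_fun_def
      by (auto simp: smooth_in_add add_pos_nonneg add_nonneg_pos)
    then show ?case unfolding P_def using 1(1) 2(1) by (meson compact_Un)
  qed
  then show ?thesis using D(3) unfolding P_def cutoff_fun_def by (meson subsetD)
qed


section \<open>A normalized gradient vector field\<close>

lemma smooth_in_det:
  fixes M :: "'x \<Rightarrow> complex^'d^'d"
  assumes "c \<in> \<A>" "\<And>i j. smooth_in c (\<lambda>p. M p $ i $ j)"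
  shows "smooth_in c (\<lambda>p. det (M p))"
  unfolding det_def by (intro smooth_in_sum smooth_in_mult smooth_in_const smooth_in_prod assms)

text \<open>A kernel vector would have length zero. The indices are exchanged to match the linear
  system in \<open>gradient_field\<close>, which sums over the first index of
  \<open>h\<close>.\<close>

lemma hermitian_matrix_det:
  fixes h :: "'d \<Rightarrow> 'd \<Rightarrow> complex"
  assumes "\<And>v::complex^'d. v \<noteq> 0 \<Longrightarrow> 0 < Re (\<Sum>a\<in>UNIV. \<Sum>b\<in>UNIV. h a b * v $ a * cnj (v $ b))"
  shows "det (\<chi> b a. h a b) \<noteq> 0"
proof -
  have "v = 0" if "(\<chi> b a. h a b) *v v = 0" for v :: "complex^'d"
  proof (rule ccontr)
    have "(\<Sum>a\<in>UNIV. h a b * v $ a) = 0" for b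
      using that by (simp add: vec_eq_iff matrix_vector_mult_def)
    then have "(\<Sum>b\<in>UNIV. \<Sum>a\<in>UNIV. h a b * v $ a * cnj (v $ b)) = 0"
      by (simp flip: sum_distrib_right)
    then have "(\<Sum>a\<in>UNIV. \<Sum>b\<in>UNIV. h a b * v $ a * cnj (v $ b)) = 0" by (subst sum.swap)
    moreover assume "v \<noteq> 0"
    ultimately show False using assms by fastforce
  qed
  then have "\<exists>B. B ** (\<chi> b a. h a b) = mat 1" by (subst matrix_left_invertible_ker) blast
  then show ?thesis by (simp add: invertible_left_inverse flip: invertible_det_nz)
qed

text \<open>\<open>w\<close> represents the differential of \<open>W\<close> through the metric, so
  that its pairing with that differential is the squared length of \<open>w\<close>, positive unless
  \<open>w\<close> and hence the differential is 0. Cramer's rule supplies an explicit smooth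
  formula; unique solvability supplies the transformation law.\<close>

lemma gradient_field:
  assumes h: "hermitian_metric \<A> h" and W: "holo_fun \<A> W"
  shows "\<exists>w. vector_field \<A> w \<and>
    (\<forall>c\<in>\<A>. \<forall>p\<in>fst c. 0 \<le> Re (\<Sum>a\<in>UNIV. del c a W p * w c p a)) \<and>
    (\<forall>c\<in>\<A>. \<forall>p\<in>fst c. Re (\<Sum>a\<in>UNIV. del c a W p * w c p a) = 0 \<longrightarrow> (\<forall>a. del c a W p = 0))"
proof -
  define H where "H c p = ((\<chi> b a. h c p a b) :: complex^'d^'d)" for c p
  define e where "e c p = (\<chi> b. cnj (del c b W p))" for c :: "('x, 'd) chart" and p
  define w where "w c p k = det (\<chi> i j. if j = k then e c p $ i else H c p $ i $ j) * inverse (det (H c p))"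
    for c p k
  note h1 = bspec[OF conjunct1[OF h[unfolded hermitian_metric_def]]]
    and h2 = conjunct2[OF h[unfolded hermitian_metric_def]]
  have h_smooth: "smooth_in c (\<lambda>p. h c p a b)" if "c \<in> \<A>" for c a b
    using h1[OF that] by blast
  have h_herm: "h c p b a = cnj (h c p a b)" if "c \<in> \<A>" "p \<in> fst c" for c p a b
    using h1[OF that(1)] that(2) by blast
  have h_pos: "0 < Re (\<Sum>a\<in>UNIV. \<Sum>b\<in>UNIV. h c p a b * v $ a * cnj (v $ b))"
    if "c \<in> \<A>" "p \<in> fst c" "v \<noteq> 0" for c p and v :: "complex^'d"
    using h1[OF that(1)] that(2,3) by blast
  have h_trans: "h c p a b =
      (\<Sum>a'\<in>UNIV. \<Sum>b'\<in>UNIV. jac c c' p a' a * cnj (jac c c' p b' b) * h c' p a' b')"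
    if "c \<in> \<A>" "c' \<in> \<A>" "p \<in> fst c" "p \<in> fst c'" for c c' p a b
    using h2 that by (meson IntI)
  have det: "det (H c p) \<noteq> 0" if "c \<in> \<A>" "p \<in> fst c" for c p
    unfolding H_def by (rule hermitian_matrix_det) (rule h_pos[OF that])
  have W_smooth: "smooth_in c (del c a W)" if "c \<in> \<A>" for c a
    using W that by (intro smooth_in_del) (auto simp: holo_fun_def holo_in_smooth_in)
  have w_vec: "(\<chi> k. w c p k) = (\<chi> k. det (\<chi> i j. if j = k then e c p $ i else H c p $ i $ j) / det (H c p))"
    for c p by (simp add: w_def divide_inverse)
  have w_eq: "(\<Sum>a\<in>UNIV. h c p a b * w c p a) = cnj (del c b W p)" if "c \<in> \<A>" "p \<in> fst c" for c p b
  proof -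
    have "H c p *v (\<chi> k. w c p k) = e c p"
      unfolding cramer[OF det[OF that]] by (rule w_vec)
    then show ?thesis by (simp add: vec_eq_iff matrix_vector_mult_def H_def e_def)
  qed
  have w_unique: "x b = w c p b"
    if "c \<in> \<A>" "p \<in> fst c" "\<And>b. (\<Sum>a\<in>UNIV. h c p a b * x a) = cnj (del c b W p)" for c p x b
  proof -
    have "H c p *v (\<chi> k. x k) = e c p"
      using that(3) by (simp add: vec_eq_iff matrix_vector_mult_def H_def e_def)
    then have "(\<chi> k. x k) = (\<chi> k. w c p k)"
      unfolding cramer[OF det[OF that(1,2)]] w_vec .
    then show ?thesis by (simp add: vec_eq_iff)
  qed
  have w_smooth: "smooth_in c (\<lambda>p. w c p k)" if "c \<in> \<A>" for c k
  proof -
    have "smooth_in c (\<lambda>p. H c p $ i $ j)" for i j by (simp add: H_def h_smooth that)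
    moreover have "smooth_in c (\<lambda>p. e c p $ i)" for i
      by (simp add: e_def smooth_in_cnj W_smooth that)
    ultimately have "smooth_in c (\<lambda>p. if j = k then e c p $ i else H c p $ i $ j)" for i j
      by (cases "j = k") simp_all
    then show ?thesis unfolding w_def
      by (intro smooth_in_mult smooth_in_inverse smooth_in_det that det)
         (simp_all add: H_def h_smooth that)
  qed
  \<comment> \<open>It suffices that the transformed vector solves the linear system of the chart
    \<open>c'\<close>. \<open>?X\<close> is its defect there.\<close>
  have w_trans: "w c' p a = (\<Sum>b\<in>UNIV. jac c c' p a b * w c p b)"
    if c: "c \<in> \<A>" "c' \<in> \<A>" "p \<in> fst c" "p \<in> fst c'" for c c' p a
  proof (rule w_unique[OF c(2,4), symmetric])
    fix d
    let ?J = "jac c c' p"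
    let ?X = "\<lambda>b'. (\<Sum>a'\<in>UNIV. h c' p a' b' * (\<Sum>b\<in>UNIV. ?J a' b * w c p b)) - cnj (del c' b' W p)"
    have Wd: "chart_diff c' W p"
      using W c by (intro smooth_in_chart_diff holo_in_smooth_in) (auto simp: holo_fun_def)
    have X: "(\<Sum>b'\<in>UNIV. cnj (?J b' b) * ?X b') = 0" for b
    proof -
      have "cnj (del c b W p) = (\<Sum>a\<in>UNIV. h c p a b * w c p a)" using w_eq[OF c(1,3)] by simp
      also have "\<dots> = (\<Sum>a\<in>UNIV. \<Sum>a'\<in>UNIV. \<Sum>b'\<in>UNIV. cnj (?J b' b) * (h c' p a' b' * (?J a' a * w c p a)))"
        by (simp add: h_trans[OF c] sum_distrib_left mult_ac)
      also have "\<dots> = (\<Sum>a'\<in>UNIV. \<Sum>a\<in>UNIV. \<Sum>b'\<in>UNIV. cnj (?J b' b) * (h c' p a' b' * (?J a' a * w c p a)))"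
        by (rule sum.swap)
      also have "\<dots> = (\<Sum>a'\<in>UNIV. \<Sum>b'\<in>UNIV. \<Sum>a\<in>UNIV. cnj (?J b' b) * (h c' p a' b' * (?J a' a * w c p a)))"
        by (intro sum.cong refl sum.swap)
      also have "\<dots> = (\<Sum>b'\<in>UNIV. \<Sum>a'\<in>UNIV. \<Sum>a\<in>UNIV. cnj (?J b' b) * (h c' p a' b' * (?J a' a * w c p a)))"
        by (rule sum.swap)
      also have "\<dots> = (\<Sum>b'\<in>UNIV. cnj (?J b' b) * (\<Sum>a'\<in>UNIV. h c' p a' b' * (\<Sum>a\<in>UNIV. ?J a' a * w c p a)))"
        by (simp only: sum_distrib_left)
      finally have "(\<Sum>b'\<in>UNIV. cnj (?J b' b) * (\<Sum>a'\<in>UNIV. h c' p a' b' * (\<Sum>a\<in>UNIV. ?J a' a * w c p a)))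
          = (\<Sum>b'\<in>UNIV. cnj (?J b' b) * cnj (del c' b' W p))"
        by (simp add: del_change[OF c(1,3) c(2,4) Wd])
      then show ?thesis by (simp add: right_diff_distrib sum_subtractf)
    qed
    \<comment> \<open>By \<open>X\<close> the conjugate Jacobian annihilates the defect;
      multiplication by its inverse isolates the single entry \<open>?X d\<close>.\<close>
    have "?X d = (\<Sum>b'\<in>UNIV. (if b' = d then 1 else 0) * ?X b')"
      by (simp add: if_distrib[of "\<lambda>x. x * _"] cong: if_cong)
    also have "\<dots> = (\<Sum>b'\<in>UNIV. (\<Sum>b\<in>UNIV. cnj (jac c' c p b d) * cnj (?J b' b)) * ?X b')"
    proof (intro sum.cong refl arg_cong2[where f = "(*)"])
      fix b'
      have "cnj (\<Sum>b\<in>UNIV. ?J b' b * jac c' c p b d) = (if b' = d then 1 else 0)"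
        by (simp add: jac_inverse[OF c(2,4) c(1,3)])
      then show "(if b' = d then 1 else 0) = (\<Sum>b\<in>UNIV. cnj (jac c' c p b d) * cnj (?J b' b))"
        by (simp add: mult.commute)
    qed
    also have "\<dots> = (\<Sum>b\<in>UNIV. \<Sum>b'\<in>UNIV. cnj (jac c' c p b d) * (cnj (?J b' b) * ?X b'))"
      by (subst sum.swap) (simp only: sum_distrib_right mult.assoc)
    also have "\<dots> = 0" by (simp only: sum_distrib_left[symmetric] X) simp
    finally show "(\<Sum>a'\<in>UNIV. h c' p a' d * (\<Sum>b\<in>UNIV. ?J a' b * w c p b)) = cnj (del c' d W p)"
      by simp
  qed
  have s_eq: "(\<Sum>a\<in>UNIV. del c a W p * w c p a) =
      (\<Sum>a\<in>UNIV. \<Sum>b\<in>UNIV. h c p a b * (\<chi> k. w c p k) $ a * cnj ((\<chi> k. w c p k) $ b))"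
    if c: "c \<in> \<A>" "p \<in> fst c" for c p
  proof (intro sum.cong refl)
    fix a
    have "del c a W p = cnj (\<Sum>b\<in>UNIV. h c p b a * w c p b)" by (simp add: w_eq[OF c])
    also have "\<dots> = (\<Sum>b\<in>UNIV. h c p a b * cnj (w c p b))"
      by (simp add: h_herm[OF c, of _ a])
    finally show "del c a W p * w c p a =
      (\<Sum>b\<in>UNIV. h c p a b * (\<chi> k. w c p k) $ a * cnj ((\<chi> k. w c p k) $ b))"
      by (simp add: sum_distrib_left mult_ac)
  qed
  have nonneg: "Re (\<Sum>a\<in>UNIV. del c a W p * w c p a) > 0 \<or> (\<forall>a. del c a W p = 0)"
    if c: "c \<in> \<A>" "p \<in> fst c" for c p
  proof (cases "(\<chi> k. w c p k) = (0 :: complex^'d)")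
    case True
    then have "w c p a = 0" for a by (simp add: vec_eq_iff)
    then have "cnj (del c b W p) = 0" for b using w_eq[OF c, of b] by simp
    then show ?thesis by simp
  next
    case False
    then show ?thesis unfolding s_eq[OF c] using h_pos[OF c] by blast
  qed
  show ?thesis
  proof (intro exI[of _ w] conjI ballI impI)
    show "vector_field \<A> w" unfolding vector_field_def using w_smooth w_trans by blast
    fix c p assume c: "c \<in> \<A>" "p \<in> fst c"
    show "0 \<le> Re (\<Sum>a\<in>UNIV. del c a W p * w c p a)" using nonneg[OF c] by auto
    show "\<forall>a. del c a W p = 0" if "Re (\<Sum>a\<in>UNIV. del c a W p * w c p a) = 0"
      using nonneg[OF c] that by auto
  qed
qed

lemma normalized_field:
  assumes h: "hermitian_metric \<A> h" and W: "holo_fun \<A> W" and \<rho>: "cutoff_fun (crit_set \<A> W) K \<rho>"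
  shows "\<exists>v. vector_field \<A> v \<and>
    (\<forall>c\<in>\<A>. \<forall>p\<in>fst c - K. (\<Sum>a\<in>UNIV. - \<i> * del c a W p * v c p a) = - 1)"
proof -
  obtain w where w: "vector_field \<A> w"
    and s0: "\<And>c p. c \<in> \<A> \<Longrightarrow> p \<in> fst c \<Longrightarrow> 0 \<le> Re (\<Sum>a\<in>UNIV. del c a W p * w c p a)"
    and s1: "\<And>c p a. c \<in> \<A> \<Longrightarrow> p \<in> fst c \<Longrightarrow> Re (\<Sum>a\<in>UNIV. del c a W p * w c p a) = 0 \<Longrightarrow> del c a W p = 0"
    using gradient_field[OF h W] by blast
  define s where "s c p = (\<Sum>a\<in>UNIV. del c a W p * w c p a)" for c p
  have Wd: "chart_diff c W p" if "c \<in> \<A>" "p \<in> fst c" for c p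
    using W that by (intro smooth_in_chart_diff holo_in_smooth_in) (auto simp: holo_fun_def)
  have W_smooth: "smooth_in c (del c a W)" if "c \<in> \<A>" for c a
    using W that by (intro smooth_in_del) (auto simp: holo_fun_def holo_in_smooth_in)
  have w_smooth: "smooth_in c (\<lambda>p. w c p a)" if "c \<in> \<A>" for c a
    using w that by (simp add: vector_field_def)
  have w_trans: "w c' p a = (\<Sum>b\<in>UNIV. jac c c' p a b * w c p b)"
    if "c \<in> \<A>" "c' \<in> \<A>" "p \<in> fst c" "p \<in> fst c'" for c c' p a
    using w that by (simp add: vector_field_def)
  \<comment> \<open>The pairing of a covector with a vector does not depend on the chart, so
    dividing by it preserves the transformation law of the field.\<close>
  have s_trans: "s c' p = s c p" if c: "c \<in> \<A>" "c' \<in> \<A>" "p \<in> fst c" "p \<in> fst c'" for c c' p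
  proof -
    have "s c p = (\<Sum>b\<in>UNIV. \<Sum>a\<in>UNIV. del c' a W p * (jac c c' p a b * w c p b))"
      by (simp add: s_def del_change[OF c(1,3) c(2,4) Wd[OF c(2,4)]] sum_distrib_left mult_ac)
    also have "\<dots> = s c' p"
      by (subst sum.swap) (simp add: s_def w_trans[OF c] sum_distrib_left)
    finally show ?thesis by simp
  qed
  \<comment> \<open>The real part of \<open>s\<close> is 0 only at critical points, where \<rho> is
    positive. Criticality is required in every chart, hence the use of
    \<open>del_change\<close>.\<close>
  have nz: "s c p + \<rho> p \<noteq> 0" if c: "c \<in> \<A>" "p \<in> fst c" for c p
  proof (cases "Re (s c p) = 0")
    case True
    then have d0: "del c a W p = 0" for a using s1[OF c] by (simp add: s_def)
    have "p \<in> crit_set \<A> W"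
      unfolding crit_set_def
    proof (intro CollectI ballI impI allI)
      fix c' a assume "c' \<in> \<A>" "p \<in> fst c'"
      from del_change[OF this c Wd[OF c]] show "del c' a W p = 0" by (simp add: d0)
    qed
    then have "Re (s c p + \<rho> p) > 0" using \<rho> True by (simp add: cutoff_fun_def)
    then show ?thesis by (metis less_irrefl zero_complex.sel(1))
  next
    case False
    then have "Re (s c p + \<rho> p) > 0"
      using s0[OF c] \<rho> by (simp add: cutoff_fun_def s_def add_pos_nonneg)
    then show ?thesis by (metis less_irrefl zero_complex.sel(1))
  qed
  \<comment> \<open>This \<open>- \<i>\<close> and the one in the contraction multiply to -1, so the
    contraction is \<open>- s / (s + \<rho>)\<close>, which is -1 where \<rho> is 0.\<close>
  define v where "v c p a = - \<i> * w c p a * inverse (s c p + \<rho> p)" for c p a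
  have "vector_field \<A> v" unfolding vector_field_def
  proof (intro conjI ballI allI)
    fix c a assume c: "c \<in> \<A>"
    have "smooth_in c (s c)"
      unfolding s_def by (intro smooth_in_sum smooth_in_mult W_smooth w_smooth c)
    moreover have "smooth_in c \<rho>" using \<rho> c by (simp add: cutoff_fun_def smooth_fun_def)
    ultimately show "smooth_in c (\<lambda>p. v c p a)"
      unfolding v_def
      by (intro smooth_in_mult smooth_in_const smooth_in_inverse smooth_in_add w_smooth nz c) auto
  next
    fix c c' p a assume "c \<in> \<A>" "c' \<in> \<A>" "p \<in> fst c \<inter> fst c'"
    then have c: "c \<in> \<A>" "c' \<in> \<A>" "p \<in> fst c" "p \<in> fst c'" by auto
    show "v c' p a = (\<Sum>b\<in>UNIV. jac c c' p a b * v c p b)"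
      by (simp add: v_def w_trans[OF c] s_trans[OF c] sum_distrib_left sum_distrib_right sum_negf mult_ac)
  qed
  moreover have "(\<Sum>a\<in>UNIV. - \<i> * del c a W p * v c p a) = - 1" if "c \<in> \<A>" "p \<in> fst c - K" for c p
  proof -
    have c: "c \<in> \<A>" "p \<in> fst c" and "\<rho> p = 0" using that \<rho> by (auto simp: cutoff_fun_def)
    have "(\<Sum>a\<in>UNIV. - \<i> * del c a W p * v c p a) = - (s c p * inverse (s c p + \<rho> p))"
      by (simp add: v_def s_def sum_distrib_right sum_negf mult_ac flip: mult.assoc[of \<i> \<i>])
    then show ?thesis using nz[OF c] \<open>\<rho> p = 0\<close> by simp
  qed
  ultimately show ?thesis by blast
qed


section \<open>The perturbed identity\<close>

definition perturbation ::
    "('x \<Rightarrow> complex) \<Rightarrow> (('x, 'd) chart \<Rightarrow> 'x \<Rightarrow> 'd \<Rightarrow> complex) \<Rightarrow> ('x, 'd) pv \<Rightarrow> ('x, 'd) pv" where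
  "perturbation W v \<alpha> =
     pv_add \<alpha> (pv_add (delta \<A> W (pv_wedge v \<alpha>)) (pv_wedge v (delta \<A> W \<alpha>)))"

text \<open>Where contraction and multiplication anticommute to \<open>-1\<close>, only the part of bidegree
  \<open>(-1, 1)\<close> remains.\<close>

lemma perturbation_eq:
  assumes "(\<Sum>a\<in>UNIV. - \<i> * del c a W p * v c p a) = - 1"
  shows "perturbation W v \<alpha> c p A B =
    pv_dbar \<A> (pv_wedge v \<alpha>) c p A B + pv_wedge v (pv_dbar \<A> \<alpha>) c p A B"
proof -
  have "iota W (pv_wedge v \<alpha>) c p A B + pv_wedge v (iota W \<alpha>) c p A B = - \<alpha> c p A B"
    using fun_cong[OF fun_cong[OF fun_cong[OF fun_cong[OF iota_wedge]]], of W v \<alpha> c p A B] assms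
    by (simp add: pv_add_def)
  then show ?thesis
    by (simp add: perturbation_def delta_def pv_wedge_add) (simp add: pv_add_def algebra_simps)
qed

lemma perturbation_PV:
  assumes "holo_fun \<A> W" "vector_field \<A> v" "\<alpha> \<in> PV \<A>"
  shows "perturbation W v \<alpha> \<in> PV \<A>"
  unfolding perturbation_def using assms by (intro pv_add_PV delta_PV pv_wedge_PV)

text \<open>By \<open>perturbation_eq\<close> each remaining term applies \<partial>bar and
  \<open>pv_wedge v\<close> once; the first keeps the polyvector length and the second adds one. The
  vanishing is assumed on an open set, since a derivative at \<open>p\<close> involves the points
  nearby.\<close>

lemma perturbation_raises_length:
  assumes W: "holo_fun \<A> W" and v: "vector_field \<A> v" and U: "open U"
    and eq: "\<And>c p. c \<in> \<A> \<Longrightarrow> p \<in> fst c \<Longrightarrow> p \<in> U \<Longrightarrow> (\<Sum>a\<in>UNIV. - \<i> * del c a W p * v c p a) = - 1"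
    and \<alpha>: "\<alpha> \<in> PV \<A>" "\<And>c p A B. p \<in> U \<Longrightarrow> length A < n \<Longrightarrow> \<alpha> c p A B = 0"
    and p: "p \<in> U" "length A < Suc n"
  shows "perturbation W v \<alpha> c p A B = 0"
proof (cases "c \<in> \<A> \<and> p \<in> fst c")
  case True
  then have c: "c \<in> \<A>" "p \<in> fst c" by auto
  have "pv_wedge v \<alpha> c q A C = 0" if "q \<in> U" for q C
  proof -
    have "ext_sum A (\<lambda>x D. v c q x * \<alpha> c q D C) = 0"
      using \<alpha>(2)[OF that] p(2) by (intro ext_sum_neutral) auto
    then show ?thesis by (simp add: pv_wedge_def)
  qed
  then have "delbar c x (\<lambda>q. pv_wedge v \<alpha> c q A C) p = delbar c x (\<lambda>q. 0) p" for x C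
    by (intro delbar_cong[OF c U p(1)])
  then have 1: "pv_dbar \<A> (pv_wedge v \<alpha>) c p A B = 0" by (simp add: pv_dbar_ext_sum[OF c])
  have "pv_dbar \<A> \<alpha> c p D B = 0" if "Suc (length D) = length A" for D
  proof -
    have "delbar c x (\<lambda>q. \<alpha> c q D C) p = delbar c x (\<lambda>q. 0) p" for x C
      by (rule delbar_cong[OF c U p(1)]) (use that p(2) \<alpha>(2) in auto)
    then show ?thesis by (simp add: pv_dbar_ext_sum[OF c])
  qed
  then have "pv_wedge v (pv_dbar \<A> \<alpha>) c p A B = 0"
    by (simp add: pv_wedge_def ext_sum_neutral)
  then show ?thesis using 1 by (simp add: perturbation_eq[of c W p v \<alpha> A B, OF eq[OF c p(1)]])
next
  case False
  then show ?thesis using PV_D(1)[OF perturbation_PV[OF W v \<alpha>(1)]] by blast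
qed

text \<open>Off \<open>K\<close>, each application kills one more polyvector length from below,
  while lengths above \<open>CARD('d)\<close> are excluded by alternation. The lengths from 0 to
  \<open>CARD('d)\<close> take \<open>Suc CARD('d)\<close> applications.\<close>

lemma perturbation_power_PVc:
  assumes W: "holo_fun \<A> W" and v: "vector_field \<A> v" and K: "compact K"
    and eq: "\<And>c p. c \<in> \<A> \<Longrightarrow> p \<in> fst c - K \<Longrightarrow> (\<Sum>a\<in>UNIV. - \<i> * del c a W p * v c p a) = - 1"
    and \<alpha>: "\<alpha> \<in> PV \<A>"
  shows "(perturbation W v ^^ Suc CARD('d)) \<alpha> \<in> PVc \<A>"
proof -
  let ?L = "perturbation W v"
  have U: "open (- K)" using K by (simp add: compact_imp_closed open_Compl)
  have PV: "(?L ^^ n) \<alpha> \<in> PV \<A>" for n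
    by (induction n) (simp_all add: \<alpha> perturbation_PV[OF W v])
  have short: "(?L ^^ n) \<alpha> c p A B = 0" if "p \<in> - K" "length A < n" for n c p A B
    using that
  proof (induction n arbitrary: c p A B)
    case (Suc n)
    show ?case unfolding funpow.simps comp_apply
      by (rule perturbation_raises_length[OF W v U _ PV Suc.IH Suc.prems]) (use eq in auto)
  qed simp
  show ?thesis
  proof (rule PVcI[OF PV K pv_vanishesI])
    fix c p A B assume "p \<in> - K"
    then show "(?L ^^ Suc CARD('d)) \<alpha> c p A B = 0"
      using short[of p A "Suc CARD('d)" c B] PV_length[OF PV, of A B "Suc CARD('d)" c p]
      by (cases "length A < Suc CARD('d)") simp_all
  qed
qed

end

theorem proposition3p7:
  fixes \<A> :: "('x::t2_space, 'd::finite) chart set"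
    and W :: "'x \<Rightarrow> complex"
  assumes "LG_pair \<A> W"
    and "compact (crit_set \<A> W)"
  shows "dg_homotopy_equivalence (holo_ring \<A>) (PVc_dg \<A> W) (PV_dg \<A> W) (\<lambda>\<alpha>. \<alpha>) \<and>
         quasi_isomorphism (holo_ring \<A>) (PVc_dg \<A> W) (PV_dg \<A> W) (\<lambda>\<alpha>. \<alpha>)"
proof -
  interpret complex_manifold \<A>
    using assms(1) by unfold_locales (simp add: LG_pair_def)
  have W: "holo_fun \<A> W" using assms(1) by (simp add: LG_pair_def)
  obtain h where h: "hermitian_metric \<A> h"
    using assms(1) by (auto simp: LG_pair_def kaehler_metric_def)
  obtain K \<rho> where K: "compact K" "cutoff_fun (crit_set \<A> W) K \<rho>"
    using cutoff_exists[OF assms(2)] by blast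
  obtain v where v: "vector_field \<A> v"
    and v_eq: "\<And>c p. c \<in> \<A> \<Longrightarrow> p \<in> fst c - K \<Longrightarrow> (\<Sum>a\<in>UNIV. - \<i> * del c a W p * v c p a) = - 1"
    using normalized_field[OF h W K(2)] by blast
  let ?R = "holo_ring \<A>" and ?M = "PV_sub_dg \<A> W (PV \<A>)" and ?N = "PV_sub_dg \<A> W (PVc \<A>)"
  let ?g = "perturbation W v ^^ Suc CARD('d)"
  have M: "is_dg_module ?R ?M" by (rule is_dg_module_PV_sub_dg[OF W dg_closed_PV[OF W]])
  have N: "is_dg_module ?R ?N" by (rule is_dg_module_PV_sub_dg[OF W dg_closed_PVc[OF W]])
  have "pv_wedge v \<alpha> \<in> PVc \<A>" if "\<alpha> \<in> PVc \<A>" for \<alpha>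
    by (rule PVc_local[OF that pv_wedge_PV[OF v PVcD(1)[OF that]]]) (rule pv_wedge_vanishes)
  then have VN: "graded_hom ?R ?N ?N (- 1) (pv_wedge v)" by (rule graded_hom_pv_wedge[OF v])
  have VM: "graded_hom ?R ?M ?M (- 1) (pv_wedge v)"
    by (rule graded_hom_pv_wedge[OF v]) (rule pv_wedge_PV[OF v])
  have L: "perturbation W v = (\<lambda>\<alpha>. pv_add \<alpha> (pv_add (delta \<A> W (pv_wedge v \<alpha>)) (pv_wedge v (delta \<A> W \<alpha>))))"
    by (simp add: fun_eq_iff perturbation_def)
  have gM: "dg_morphism ?R ?M ?M ?g" "dg_homotopic ?R ?M ?M ?g id"
    using homotopy_perturbation[OF M VM, of "Suc CARD('d)"] unfolding PV_sub_dg_simps L by blast+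
  have gN: "dg_homotopic ?R ?N ?N ?g id"
    using homotopy_perturbation(2)[OF N VN, of "Suc CARD('d)"] unfolding PV_sub_dg_simps L by blast
  have incl: "dg_morphism ?R ?N ?M (\<lambda>\<alpha>. \<alpha>)"
    using M N PVcD(1) unfolding dg_morphism_def graded_hom_def by simp
  have "?g \<alpha> \<in> PVc \<A>" if "\<alpha> \<in> PV \<A>" for \<alpha>
    by (rule perturbation_power_PVc[OF W v K(1) v_eq that])
  \<comment> \<open>The two modules share all operations, so once the values lie in
    \<open>PVc\<close> the properties of \<open>?g\<close> as an endomorphism carry over to the
    smaller codomain.\<close>
  then have "dg_morphism ?R ?M ?N ?g"
    using gM(1) N unfolding dg_morphism_def graded_hom_def by simp
  \<comment> \<open>Both composites with the inclusion are \<open>?g\<close> as a function, so the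
    required homotopies are \<open>gN\<close> and \<open>gM(2)\<close>.\<close>
  then have "dg_homotopy_equivalence ?R ?N ?M (\<lambda>\<alpha>. \<alpha>)"
    unfolding dg_homotopy_equivalence_def using incl gM(2) gN
    by (intro conjI exI[of _ ?g]) (simp_all add: comp_def)
  then show ?thesis
    unfolding PV_dg_eq_sub PVc_dg_eq_sub using homotopy_equivalence_imp_quasi_isomorphism by blast
qed

end
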